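(* The Gabor system $\mathcal{G}\big(h_9, \tfrac{1}{\sqrt{3}}\,\mathbb{Z}^2\big)$ is a frame for $L^2(\mathbb{R})$.
   Context: For $n \in \mathbb{N}_0$, the $n$-th Hermite function (of unit $L^2(\mathbb{R})$-norm) is $h_n(t) = c_n (-1)^n e^{\pi t^2} \frac{d^n}{dt^n} e^{-2\pi t^2}$, $t\in\mathbb{R}$, with $c_n = 2^{1/4}/\sqrt{n!\,(2\pi)^n 2^n}$. For $z=(x,\omega)\in\mathbb{R}^2$ the time-frequency shift $\pi(z)$ acts on $g\in L^2(\mathbb{R})$ by $\pi(z)g(t) = e^{2\pi i \omega t} g(t-x)$. For a lattice $\Lambda\subset\mathbb{R}^2$ the Gabor system is $\mathcal{G}(g,\Lambda)=\{\pi(\lambda)g \mid \lambda\in\Lambda\}$. It is a frame for $L^2(\mathbb{R})$ if there exist constants $0<A\leq B<\infty$ such that $A\|f\|_{L^2(\mathbb{R})}^2 \leq \sum_{\lambda\in\Lambda} |\langle f,\pi(\lambda)g\rangle|^2 \leq B\|f\|_{L^2(\mathbb{R})}^2$ for all $f\in L^2(\mathbb{R})$, where $\langle f,g\rangle=\int_{\mathbb{R}} f(t)\overline{g(t)}\,dt$. *)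

theory Defs
  imports "HOL-Analysis.Analysis"
begin

text \<open>
  Elements of $L^2(\mathbb{R})$ are represented by functions, not by equivalence classes
  modulo null sets: everything below depends on a function only up to almost-everywhere equality.
\<close>

definition L2 :: "(real \<Rightarrow> complex) set" where
  "L2 = {f \<in> borel_measurable lebesgue. integrable lebesgue (\<lambda>t. (cmod (f t))\<^sup>2)}"

definition L2_norm :: "(real \<Rightarrow> complex) \<Rightarrow> real" where
  "L2_norm f = sqrt (LINT t|lebesgue. (cmod (f t))\<^sup>2)"

definition L2_inner :: "(real \<Rightarrow> complex) \<Rightarrow> (real \<Rightarrow> complex) \<Rightarrow> complex" where
  "L2_inner f g = (LINT t|lebesgue. f t * cnj (g t))"

definition tf_shift :: "real \<times> real \<Rightarrow> (real \<Rightarrow> complex) \<Rightarrow> real \<Rightarrow> complex" where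
  "tf_shift = (\<lambda>(x, \<omega>) g t. exp (2 * complex_of_real pi * \<i> * complex_of_real \<omega> * complex_of_real t) * g (t - x))"

text \<open>
  Frames are families indexed by a set. The membership condition excludes junk values of
  \<^const>\<open>L2_inner\<close>, and the summability condition excludes the junk value 0 of a divergent
  \<^const>\<open>infsum\<close>; for non-negative terms it says exactly that the sum is finite.
\<close>

definition is_L2_frame :: "('i \<Rightarrow> real \<Rightarrow> complex) \<Rightarrow> 'i set \<Rightarrow> bool" where
  "is_L2_frame \<phi> I \<longleftrightarrow>
     (\<forall>i\<in>I. \<phi> i \<in> L2) \<and>
     (\<exists>A B :: real. 0 < A \<and> A \<le> B \<and>
        (\<forall>f\<in>L2.
           (\<lambda>i. (cmod (L2_inner f (\<phi> i)))\<^sup>2) summable_on I \<and>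
           A * (L2_norm f)\<^sup>2 \<le> (\<Sum>\<^sub>\<infinity>i\<in>I. (cmod (L2_inner f (\<phi> i)))\<^sup>2) \<and>
           (\<Sum>\<^sub>\<infinity>i\<in>I. (cmod (L2_inner f (\<phi> i)))\<^sup>2) \<le> B * (L2_norm f)\<^sup>2))"

definition gabor_system :: "(real \<Rightarrow> complex) \<Rightarrow> real \<times> real \<Rightarrow> real \<Rightarrow> complex" where
  "gabor_system g z = tf_shift z g"

definition gabor_frame :: "(real \<Rightarrow> complex) \<Rightarrow> (real \<times> real) set \<Rightarrow> bool" where
  "gabor_frame g \<Lambda> \<longleftrightarrow> is_L2_frame (gabor_system g) \<Lambda>"

definition hermite_const :: "nat \<Rightarrow> real" where
  "hermite_const n = 2 powr (1/4) / sqrt (fact n * (2 * pi) ^ n * 2 ^ n)"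

definition hermite_fun :: "nat \<Rightarrow> real \<Rightarrow> complex" where
  "hermite_fun n t = complex_of_real
     (hermite_const n * (-1) ^ n * exp (pi * t\<^sup>2) * (deriv ^^ n) (\<lambda>s. exp (- 2 * pi * s\<^sup>2)) t)"

end

theory Submission
  imports Defs "HOL-Probability.Characteristic_Functions" "HOL-Probability.Sinc_Integral"
begin

text \<open>
  The adjoint lattice of \<open>\<Lambda> = 3\<^sup>-\<^sup>1\<^sup>/\<^sup>2 \<int>\<^sup>2\<close> is \<open>\<surd>3 \<int>\<^sup>2\<close>. In Janssen's representation
  the frame operator of a window \<open>g\<close> is, up to the factor given by the density of \<open>\<Lambda>\<close>, the sum of the
  time-frequency shifts over the adjoint lattice, weighted with the values of the ambiguity function of
  \<open>g\<close>. The origin contributes a multiple of the identity. If the other weights have an absolute sum that is smaller than the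
  weight of the origin, the frame operator is therefore invertible and the system is a frame. This is
  \<open>janssen_criterion\<close>.

  The ambiguity function of a Hermite function is a Laguerre function
  (\<open>norm_ambiguity_hermite_fun\<close>): at a point \<open>\<surd>3 (m, n)\<close> with \<open>r = m\<^sup>2 + n\<^sup>2\<close> the weight of \<open>h\<^sub>9\<close> is
  $|L_9(3 \pi r)| e^{-3 \pi r / 2}$. The polynomial $L_9$ happens to have zeros close to \<open>3 \<pi>\<close> and \<open>6 \<pi>\<close>, which
  makes the contributions of the squared radii 1 and 2 small. The four points with \<open>r = 4\<close> and the eight with
  \<open>r = 5\<close> contribute about 0.56 and 0.17, and the exponential dominates from \<open>r = 8\<close> on. The absolute sum
  over the punctured lattice is about 0.77, less than the weight 1 of the origin
  (\<open>lattice_weight_sum\<close>).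

  The criterion is proved without the representation itself. For fixed translation parameter, Parseval's
  identity turns the sum over the modulations into an integral over one period (\<open>parseval_interval\<close>).
  What remains is a quadratic form in the values of \<open>f\<close> on a coset of \<open>\<surd>3 \<int>\<close>. Its matrix consists of
  lattice sums of products of two translates of the window, and by Poisson summation
  (\<open>poisson_summation\<close>) these are Fourier series with values of the ambiguity function as coefficients. Schur's test
  then bounds the form from both sides (\<open>gram_bounds\<close>). Parseval's identity rests on the density of the
  trigonometric polynomials, which comes from the Stone--Weierstrass theorem.
\<close>

section \<open>Trigonometric polynomials and Parseval's identity\<close>

lemma norm_add_squared_le: "(norm (a + b))\<^sup>2 \<le> 2 * (norm a)\<^sup>2 + 2 * (norm (b::'a::real_normed_vector))\<^sup>2"
proof -
  have "(norm (a + b))\<^sup>2 \<le> (norm a + norm b)\<^sup>2"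
    by (intro power_mono norm_triangle_ineq) auto
  also have "\<dots> \<le> 2 * (norm a)\<^sup>2 + 2 * (norm b)\<^sup>2"
    using sum_squares_bound[of "norm a" "norm b"] by (simp add: power2_sum)
  finally show ?thesis .
qed

lemma norm_diff_squared_le:
  "(norm (a - b))\<^sup>2 \<le> 2 * (norm (a - c))\<^sup>2 + 2 * (norm (c - b::'a::real_normed_vector))\<^sup>2"
  using norm_add_squared_le[of "a - c" "c - b"] by simp

text \<open>
  Lebesgue measure on one period \<open>[0, T)\<close>, and the characters of that period, indexed by the integers.
  The characters are not normalised: each has square integral \<open>T\<close>.
\<close>

definition interval_measure :: "real \<Rightarrow> real measure" where
  "interval_measure T = restrict_space lborel {0..<T}"

definition trig :: "real \<Rightarrow> int \<Rightarrow> real \<Rightarrow> complex" where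
  "trig T l t = cis (2 * pi * of_int l * t / T)"

lemma space_interval_measure [simp]: "space (interval_measure T) = {0..<T}"
  by (simp add: interval_measure_def space_restrict_space)

lemma measurable_interval_measure: "f \<in> borel_measurable borel \<Longrightarrow> f \<in> borel_measurable (interval_measure T)"
  unfolding interval_measure_def by (intro measurable_restrict_space1) simp

lemma emeasure_interval_measure: "T \<ge> 0 \<Longrightarrow> emeasure (interval_measure T) {0..<T} = ennreal T"
  unfolding interval_measure_def by (subst emeasure_restrict_space) auto

lemma finite_interval_measure: "T \<ge> 0 \<Longrightarrow> finite_measure (interval_measure T)"
  by (intro finite_measureI) (simp add: emeasure_interval_measure)

lemma integrable_interval_bounded:
  fixes f :: "real \<Rightarrow> 'a::{banach, second_countable_topology}"
  assumes "T \<ge> 0" "f \<in> borel_measurable (interval_measure T)" "\<And>t. t \<in> {0..<T} \<Longrightarrow> norm (f t) \<le> B"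
  shows "integrable (interval_measure T) f"
proof -
  interpret finite_measure "interval_measure T" using assms(1) by (rule finite_interval_measure)
  show ?thesis by (rule integrable_const_bound[where B = B]) (use assms in auto)
qed

lemma measurable_trig [measurable]: "trig T l \<in> borel_measurable borel"
proof -
  have "continuous_on UNIV (\<lambda>t. cis ((2 * pi * of_int l / T) * t))" by (intro continuous_intros)
  hence "continuous_on UNIV (trig T l)" by (simp add: trig_def[abs_def])
  thus ?thesis by (rule borel_measurable_continuous_onI)
qed

lemma norm_trig [simp]: "norm (trig T l t) = 1" by (simp add: trig_def)
lemma trig_0 [simp]: "trig T 0 t = 1" by (simp add: trig_def)
lemma trig_mult: "trig T l t * trig T m t = trig T (l + m) t"
  by (simp add: trig_def cis_mult ring_distribs add_divide_distrib)

lemma cnj_trig [simp]: "cnj (trig T l t) = trig T (- l) t"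
  by (simp add: trig_def cis_cnj)

lemma integral_trig:
  assumes T: "T > 0"
  shows "(\<integral>t. trig T l t \<partial>interval_measure T) = (if l = 0 then of_real T else 0)"
proof (cases "l = 0")
  case True
  have "(\<integral>t. trig T l t \<partial>interval_measure T) = of_real (measure (interval_measure T) {0..<T})"
    using True by (simp add: scaleR_conv_of_real)
  also have "measure (interval_measure T) {0..<T} = T"
    using T emeasure_interval_measure[of T] by (simp add: measure_def)
  finally show ?thesis using True by simp
next
  case False
  define c where "c = 2 * pi * of_int l / T"
  have c: "c \<noteq> 0" using False T by (simp add: c_def)
  have tr: "trig T l t = cis (c * t)" for t by (simp add: trig_def c_def)
  have "(\<integral>t. trig T l t \<partial>interval_measure T) = (LINT t|lborel. indicator {0..<T} t *\<^sub>R trig T l t)"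
    unfolding interval_measure_def by (subst integral_restrict_space) (auto simp: set_lebesgue_integral_def)
  also have "\<dots> = (LINT t|lborel. indicator {0..T} t *\<^sub>R trig T l t)"
  proof (rule integral_cong_AE)
    have "AE t in lborel. t \<noteq> T" by (rule AE_lborel_singleton)
    thus "AE t in lborel. indicator {0..<T} t *\<^sub>R trig T l t = indicator {0..T} t *\<^sub>R trig T l t"
      by eventually_elim (auto simp: indicator_def)
  qed auto
  also have "\<dots> = cis (c * T) / (\<i> * c) - cis (c * 0) / (\<i> * c)"
  proof (rule integral_FTC_Icc)
    show "0 \<le> T" using T by simp
    show "((\<lambda>t. cis (c * t) / (\<i> * complex_of_real c)) has_vector_derivative trig T l x) (at x within {0..T})" for x
      unfolding tr cis_conv_exp using c
      by (auto intro!: derivative_eq_intros has_vector_derivative_real_field simp: field_simps)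
    show "continuous_on {0..T} (trig T l)"
      unfolding trig_def using T by (intro continuous_intros) auto
  qed
  also have "cis (c * T) = 1"
    using T by (simp add: c_def cis_multiple_2pi)
  finally show ?thesis using False by simp
qed

text \<open>
  The trigonometric polynomials of period \<open>T\<close>, as the complex span of the characters.
\<close>

inductive_set trig_polys :: "real \<Rightarrow> (real \<Rightarrow> complex) set" for T :: real where
  trig: "trig T l \<in> trig_polys T"
| scale: "p \<in> trig_polys T \<Longrightarrow> (\<lambda>t. a * p t) \<in> trig_polys T"
| add: "p \<in> trig_polys T \<Longrightarrow> q \<in> trig_polys T \<Longrightarrow> (\<lambda>t. p t + q t) \<in> trig_polys T"

lemma trig_polys_const: "(\<lambda>t. c) \<in> trig_polys T"
proof -
  have "(\<lambda>t. c * trig T 0 t) \<in> trig_polys T" by (intro trig_polys.intros)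
  thus ?thesis by simp
qed

lemma trig_polys_mult:
  assumes "p \<in> trig_polys T" "q \<in> trig_polys T"
  shows "(\<lambda>t. p t * q t) \<in> trig_polys T"
  using assms
proof (induction)
  case (trig l)
  show ?case using trig
  proof (induction)
    case (trig m)
    show ?case unfolding trig_mult using trig_polys.trig[of T "l + m"] by simp
  next
    case (scale p a)
    show ?case using trig_polys.scale[OF scale.IH, of a] by (simp add: algebra_simps)
  next
    case (add p q)
    show ?case using trig_polys.add[OF add.IH] by (simp add: algebra_simps)
  qed
next
  case (scale p a)
  show ?case using trig_polys.scale[OF scale.IH[OF scale.prems], of a] by (simp add: algebra_simps)
next
  case (add p q)
  show ?case using trig_polys.add[OF add.IH[OF add.prems]] by (simp add: algebra_simps)
qed

lemma trig_polys_eq_sum: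
  assumes "p \<in> trig_polys T"
  obtains F a where "finite F" "\<And>l. l \<notin> F \<Longrightarrow> a l = 0" "p = (\<lambda>t. \<Sum>l\<in>F. a l * trig T l t)"
proof -
  have "\<exists>F a. finite F \<and> (\<forall>l. l \<notin> F \<longrightarrow> a l = 0) \<and> p = (\<lambda>t. \<Sum>l\<in>F. a l * trig T l t)"
    using assms
  proof (induction)
    case (trig l)
    show ?case
      by (rule exI[of _ "{l}"], rule exI[of _ "\<lambda>k. if k = l then 1 else 0"]) auto
  next
    case (scale p c)
    then obtain F a where "finite F" "\<forall>l. l \<notin> F \<longrightarrow> a l = 0" "p = (\<lambda>t. \<Sum>l\<in>F. a l * trig T l t)"
      by blast
    thus ?case
      by (intro exI[of _ F] exI[of _ "\<lambda>l. c * a l"]) (auto simp: sum_distrib_left mult.assoc)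
  next
    case (add p q)
    then obtain F a G b where
      F: "finite F" "\<forall>l. l \<notin> F \<longrightarrow> a l = 0" "p = (\<lambda>t. \<Sum>l\<in>F. a l * trig T l t)" and
      G: "finite G" "\<forall>l. l \<notin> G \<longrightarrow> b l = 0" "q = (\<lambda>t. \<Sum>l\<in>G. b l * trig T l t)"
      by blast
    have "p = (\<lambda>t. \<Sum>l\<in>F \<union> G. a l * trig T l t)" "q = (\<lambda>t. \<Sum>l\<in>F \<union> G. b l * trig T l t)"
      unfolding F(3) G(3) by (intro ext sum.mono_neutral_left; use F G in auto)+
    thus ?case using F(1,2) G(1,2)
      by (intro exI[of _ "F \<union> G"] exI[of _ "\<lambda>l. a l + b l"]) (auto simp: ring_distribs sum.distrib)
  qed
  thus ?thesis using that by blast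
qed

lemma trig_polys_measurable [measurable_dest]: "p \<in> trig_polys T \<Longrightarrow> p \<in> borel_measurable borel"
  by (induction rule: trig_polys.induct) auto

lemma trig_polys_bounded:
  assumes "p \<in> trig_polys T" obtains B where "\<And>t. norm (p t) \<le> B"
proof -
  obtain F a where p: "p = (\<lambda>t. \<Sum>l\<in>F. a l * trig T l t)"
    using trig_polys_eq_sum[OF assms] by blast
  have "norm (p t) \<le> (\<Sum>l\<in>F. norm (a l))" for t
    unfolding p by (rule sum_norm_le) (simp add: norm_mult)
  thus ?thesis using that by blast
qed

text \<open>
  The first character wraps the period around the unit circle, so that the real polynomials in two variables,
  to which the Stone--Weierstrass theorem applies, turn into trigonometric polynomials.
\<close>

lemma real_polynomial_on_circle:
  fixes f :: "complex \<Rightarrow> real"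
  assumes "real_polynomial_function f"
  shows "(\<lambda>t. complex_of_real (f (trig T 1 t))) \<in> trig_polys T"
  using assms
proof (induction)
  case (linear f)
  interpret bounded_linear f by fact
  have eq: "complex_of_real (f z) = (f 1 - \<i> * f \<i>) / 2 * z + (f 1 + \<i> * f \<i>) / 2 * cnj z" for z
  proof -
    have "z = Re z *\<^sub>R 1 + Im z *\<^sub>R \<i>" by (simp add: complex_eq_iff)
    hence "f z = f (Re z *\<^sub>R 1 + Im z *\<^sub>R \<i>)" by (rule arg_cong)
    also have "\<dots> = Re z * f 1 + Im z * f \<i>" by (simp add: add scaleR)
    finally show ?thesis by (simp add: complex_eq_iff field_simps)
  qed
  have "(\<lambda>t. complex_of_real (f (trig T 1 t))) =
      (\<lambda>t. (f 1 - \<i> * f \<i>) / 2 * trig T 1 t + (f 1 + \<i> * f \<i>) / 2 * trig T (- 1) t)"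
    by (rule ext) (rule eq[of "trig T 1 _", unfolded cnj_trig])
  thus ?case by (simp only: trig_polys.intros)
next
  case (const c)
  show ?case by (rule trig_polys_const)
next
  case (add f g)
  thus ?case using trig_polys.add[OF add.IH] by simp
next
  case (mult f g)
  thus ?case using trig_polys_mult[OF mult.IH] by simp
qed

text \<open>
  \<open>trig_approximable T u\<close> says that \<open>u\<close> lies in the closure of the trigonometric polynomials in
  $L^2$ of one period. Only the values of \<open>u\<close> on \<open>[0, T)\<close> matter, periodicity is not required.
\<close>

definition square_integrable :: "real \<Rightarrow> (real \<Rightarrow> complex) \<Rightarrow> bool" where
  "square_integrable T u \<longleftrightarrow> u \<in> borel_measurable (interval_measure T) \<and>
     integrable (interval_measure T) (\<lambda>t. (norm (u t))\<^sup>2)"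

definition trig_approximable :: "real \<Rightarrow> (real \<Rightarrow> complex) \<Rightarrow> bool" where
  "trig_approximable T u \<longleftrightarrow> square_integrable T u \<and>
     (\<forall>\<epsilon>>0. \<exists>p\<in>trig_polys T. (\<integral>t. (norm (u t - p t))\<^sup>2 \<partial>interval_measure T) < \<epsilon>)"

lemma square_integrable_measurable [measurable_dest]:
  "square_integrable T u \<Longrightarrow> u \<in> borel_measurable (interval_measure T)"
  by (simp add: square_integrable_def)

lemma square_integrable_add:
  assumes [measurable]: "square_integrable T u" "square_integrable T v"
  shows "square_integrable T (\<lambda>t. u t + v t)"
  unfolding square_integrable_def
proof
  show "integrable (interval_measure T) (\<lambda>t. (norm (u t + v t))\<^sup>2)"
  proof (rule Bochner_Integration.integrable_bound)
    show "integrable (interval_measure T) (\<lambda>t. 2 * (norm (u t))\<^sup>2 + 2 * (norm (v t))\<^sup>2)"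
      using assms by (simp add: square_integrable_def)
  qed (auto intro!: norm_add_squared_le)
qed measurable

lemma square_integrable_scale:
  assumes [measurable]: "square_integrable T u"
  shows "square_integrable T (\<lambda>t. a * u t)"
  using assms by (simp add: square_integrable_def norm_mult power_mult_distrib)

lemma square_integrable_diff:
  assumes "square_integrable T u" "square_integrable T v"
  shows "square_integrable T (\<lambda>t. u t - v t)"
  using square_integrable_add[OF assms(1) square_integrable_scale[OF assms(2), of "-1"]] by simp

lemma square_integrable_bounded:
  assumes "T \<ge> 0" and [measurable]: "u \<in> borel_measurable (interval_measure T)"
    and "\<And>t. t \<in> {0..<T} \<Longrightarrow> norm (u t) \<le> B"
  shows "square_integrable T u"
  unfolding square_integrable_def
  by (safe intro!: integrable_interval_bounded[where B = "B\<^sup>2"]) (use assms in \<open>auto intro!: power_mono\<close>)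

lemma square_integrable_trig_poly:
  assumes "T \<ge> 0" "p \<in> trig_polys T"
  shows "square_integrable T p"
proof -
  obtain B where "\<And>t. norm (p t) \<le> B" using trig_polys_bounded[OF assms(2)] by blast
  thus ?thesis using assms
    by (intro square_integrable_bounded[where B = B]) (auto intro: measurable_interval_measure trig_polys_measurable)
qed

lemma integrable_norm_diff_squared:
  assumes "square_integrable T u" "square_integrable T v"
  shows "integrable (interval_measure T) (\<lambda>t. (norm (u t - v t))\<^sup>2)"
  using square_integrable_diff[OF assms] by (simp add: square_integrable_def)

lemma integral_norm_diff_squared_le:
  assumes "square_integrable T u" "square_integrable T v" "square_integrable T w"
  shows "(\<integral>t. (norm (u t - w t))\<^sup>2 \<partial>interval_measure T) \<le>
     2 * (\<integral>t. (norm (u t - v t))\<^sup>2 \<partial>interval_measure T) + 2 * (\<integral>t. (norm (v t - w t))\<^sup>2 \<partial>interval_measure T)"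
proof -
  note [intro, simp] = integrable_norm_diff_squared[OF assms(1,2)] integrable_norm_diff_squared[OF assms(2,3)]
     integrable_norm_diff_squared[OF assms(1,3)]
  have "(\<integral>t. (norm (u t - w t))\<^sup>2 \<partial>interval_measure T) \<le>
     (\<integral>t. 2 * (norm (u t - v t))\<^sup>2 + 2 * (norm (v t - w t))\<^sup>2 \<partial>interval_measure T)"
    by (intro integral_mono norm_diff_squared_le) auto
  also have "\<dots> = 2 * (\<integral>t. (norm (u t - v t))\<^sup>2 \<partial>interval_measure T) + 2 * (\<integral>t. (norm (v t - w t))\<^sup>2 \<partial>interval_measure T)"
    by (subst Bochner_Integration.integral_add) auto
  finally show ?thesis .
qed

lemma trig_approximable_approx:
  assumes T: "T \<ge> 0" and u: "square_integrable T u"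
    and ap: "\<And>\<epsilon>. \<epsilon> > 0 \<Longrightarrow> \<exists>v. trig_approximable T v \<and> (\<integral>t. (norm (u t - v t))\<^sup>2 \<partial>interval_measure T) < \<epsilon>"
  shows "trig_approximable T u"
  unfolding trig_approximable_def
proof (safe intro!: u)
  fix \<epsilon> :: real assume \<epsilon>: "\<epsilon> > 0"
  obtain v where v: "trig_approximable T v" "(\<integral>t. (norm (u t - v t))\<^sup>2 \<partial>interval_measure T) < \<epsilon> / 4"
    using ap[of "\<epsilon> / 4"] \<epsilon> by auto
  obtain p where p: "p \<in> trig_polys T" "(\<integral>t. (norm (v t - p t))\<^sup>2 \<partial>interval_measure T) < \<epsilon> / 4"
    using v(1) \<epsilon> unfolding trig_approximable_def by (meson divide_pos_pos zero_less_numeral)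
  have "(\<integral>t. (norm (u t - p t))\<^sup>2 \<partial>interval_measure T) < \<epsilon>"
    using integral_norm_diff_squared_le[OF u, of v p] v p T square_integrable_trig_poly[of T p]
    by (auto simp: trig_approximable_def)
  thus "\<exists>p\<in>trig_polys T. (\<integral>t. (norm (u t - p t))\<^sup>2 \<partial>interval_measure T) < \<epsilon>" using p by blast
qed

lemma trig_approximable_dominated:
  assumes T: "T \<ge> 0" and v: "\<And>n. trig_approximable T (v n)"
    and [measurable]: "u \<in> borel_measurable (interval_measure T)"
    and lim: "\<And>t. t \<in> {0..<T} \<Longrightarrow> (\<lambda>n. v n t) \<longlonglongrightarrow> u t"
    and dom: "\<And>n t. t \<in> {0..<T} \<Longrightarrow> norm (v n t) \<le> w t" and w: "integrable (interval_measure T) (\<lambda>t. (w t)\<^sup>2)"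
  shows "trig_approximable T u"
proof -
  have vs: "square_integrable T (v n)" for n using v by (auto simp: trig_approximable_def)
  note [measurable] = square_integrable_measurable[OF vs]
  have du: "norm (u t) \<le> w t" if "t \<in> {0..<T}" for t
    by (rule LIMSEQ_le_const2[OF tendsto_norm[OF lim[OF that]]]) (use dom that in auto)
  have us: "square_integrable T u" unfolding square_integrable_def
  proof
    show "integrable (interval_measure T) (\<lambda>t. (norm (u t))\<^sup>2)"
      by (rule Bochner_Integration.integrable_bound[OF w]) (auto intro!: AE_I2 power_mono du)
  qed measurable
  have "(\<lambda>n. \<integral>t. (norm (u t - v n t))\<^sup>2 \<partial>interval_measure T) \<longlonglongrightarrow> (\<integral>t. 0 \<partial>interval_measure T)"
  proof (rule integral_dominated_convergence[where w = "\<lambda>t. 4 * (w t)\<^sup>2"])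
    show "AE t in interval_measure T. (\<lambda>n. (norm (u t - v n t))\<^sup>2) \<longlonglongrightarrow> 0"
    proof (rule AE_I2)
      fix t assume "t \<in> space (interval_measure T)"
      hence "(\<lambda>n. v n t) \<longlonglongrightarrow> u t" using lim by auto
      hence "(\<lambda>n. (norm (u t - v n t))\<^sup>2) \<longlonglongrightarrow> (norm (u t - u t))\<^sup>2" by (intro tendsto_intros)
      thus "(\<lambda>n. (norm (u t - v n t))\<^sup>2) \<longlonglongrightarrow> 0" by simp
    qed
    show "AE t in interval_measure T. norm ((norm (u t - v n t))\<^sup>2) \<le> 4 * (w t)\<^sup>2" for n
    proof (rule AE_I2)
      fix t assume "t \<in> space (interval_measure T)"
      hence "norm (u t - v n t) \<le> 2 * w t" using dom[of t n] du[of t] norm_triangle_ineq4[of "u t" "v n t"] by auto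
      hence "(norm (u t - v n t))\<^sup>2 \<le> (2 * w t)\<^sup>2" by (intro power_mono) auto
      thus "norm ((norm (u t - v n t))\<^sup>2) \<le> 4 * (w t)\<^sup>2" by (simp add: power_mult_distrib)
    qed
    show "integrable (interval_measure T) (\<lambda>t. 4 * (w t)\<^sup>2)" using w by simp
  qed auto
  hence "(\<lambda>n. \<integral>t. (norm (u t - v n t))\<^sup>2 \<partial>interval_measure T) \<longlonglongrightarrow> 0" by simp
  hence "\<exists>n. (\<integral>t. (norm (u t - v n t))\<^sup>2 \<partial>interval_measure T) < \<epsilon>" if "\<epsilon> > 0" for \<epsilon>
    using that order_tendstoD(2)[of _ 0 sequentially \<epsilon>] eventually_happens[of _ sequentially] by fastforce
  thus ?thesis using v by (intro trig_approximable_approx[OF T us]) blast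
qed

lemma trig_approximable_add:
  assumes T: "T \<ge> 0" and u: "trig_approximable T u" and v: "trig_approximable T v"
  shows "trig_approximable T (\<lambda>t. u t + v t)"
proof -
  have us: "square_integrable T u" and vs: "square_integrable T v" using u v by (auto simp: trig_approximable_def)
  show ?thesis unfolding trig_approximable_def
  proof (safe intro!: square_integrable_add us vs)
    fix \<epsilon> :: real assume \<epsilon>: "\<epsilon> > 0"
    obtain p where p: "p \<in> trig_polys T" "(\<integral>t. (norm (u t - p t))\<^sup>2 \<partial>interval_measure T) < \<epsilon> / 4"
      using u \<epsilon> unfolding trig_approximable_def by (meson divide_pos_pos zero_less_numeral)
    obtain q where q: "q \<in> trig_polys T" "(\<integral>t. (norm (v t - q t))\<^sup>2 \<partial>interval_measure T) < \<epsilon> / 4"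
      using v \<epsilon> unfolding trig_approximable_def by (meson divide_pos_pos zero_less_numeral)
    have pq: "(\<lambda>t. p t + q t) \<in> trig_polys T" using p q by (intro trig_polys.add)
    note sq = square_integrable_trig_poly[OF T p(1)] square_integrable_trig_poly[OF T q(1)] square_integrable_trig_poly[OF T pq]
    have "(\<integral>t. (norm (u t + v t - (p t + q t)))\<^sup>2 \<partial>interval_measure T) \<le>
        2 * (\<integral>t. (norm (u t + v t - (p t + v t)))\<^sup>2 \<partial>interval_measure T) +
        2 * (\<integral>t. (norm (p t + v t - (p t + q t)))\<^sup>2 \<partial>interval_measure T)"
      by (intro integral_norm_diff_squared_le square_integrable_add us vs sq)
    also have "\<dots> < \<epsilon>" using p q by simp
    finally show "\<exists>p\<in>trig_polys T. (\<integral>t. (norm (u t + v t - p t))\<^sup>2 \<partial>interval_measure T) < \<epsilon>"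
      by (intro bexI[OF _ pq])
  qed
qed

lemma trig_approximable_scale:
  assumes T: "T \<ge> 0" and u: "trig_approximable T u"
  shows "trig_approximable T (\<lambda>t. a * u t)"
proof -
  have us: "square_integrable T u" using u by (auto simp: trig_approximable_def)
  show ?thesis unfolding trig_approximable_def
  proof (safe intro!: square_integrable_scale us)
    fix \<epsilon> :: real assume \<epsilon>: "\<epsilon> > 0"
    define c where "c = (norm a)\<^sup>2 + 1"
    have c: "c > 0" by (simp add: c_def add_nonneg_pos)
    obtain p where p: "p \<in> trig_polys T" "(\<integral>t. (norm (u t - p t))\<^sup>2 \<partial>interval_measure T) < \<epsilon> / c"
      using u \<epsilon> c unfolding trig_approximable_def by (meson divide_pos_pos)
    have "(\<integral>t. (norm (a * u t - a * p t))\<^sup>2 \<partial>interval_measure T) =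
        (norm a)\<^sup>2 * (\<integral>t. (norm (u t - p t))\<^sup>2 \<partial>interval_measure T)"
      by (simp add: right_diff_distrib[symmetric] norm_mult power_mult_distrib)
    also have "\<dots> \<le> c * (\<integral>t. (norm (u t - p t))\<^sup>2 \<partial>interval_measure T)"
      by (intro mult_right_mono integral_nonneg) (auto simp: c_def)
    also have "\<dots> < \<epsilon>" using p c by (simp add: field_simps)
    finally show "\<exists>p\<in>trig_polys T. (\<integral>t. (norm (a * u t - p t))\<^sup>2 \<partial>interval_measure T) < \<epsilon>"
      by (intro bexI[OF _ trig_polys.scale[OF p(1)]])
  qed
qed

lemma trig_approximable_const:
  assumes "T \<ge> 0" shows "trig_approximable T (\<lambda>t. c)"
  using assms trig_polys_const[of c T] square_integrable_trig_poly[of T "\<lambda>t. c"]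
  by (auto simp: trig_approximable_def intro!: bexI[of _ "\<lambda>t. c"])

lemma trig_approximable_sum:
  assumes "T \<ge> 0" "\<And>i. i \<in> I \<Longrightarrow> trig_approximable T (u i)"
  shows "trig_approximable T (\<lambda>t. \<Sum>i\<in>I. u i t)"
  using assms(2)
  by (induction I rule: infinite_finite_induct)
     (auto intro!: trig_approximable_const trig_approximable_add assms(1))

text \<open>
  The indicator of a closed subset of the circle is the limit of continuous functions, namely of a steep
  function of the distance to the set, and each of these is uniformly close to a polynomial.
\<close>

lemma trig_approximable_indicator_circle:
  assumes T: "T > 0" and K: "closed K" "K \<noteq> {}"
  shows "trig_approximable T (\<lambda>t. complex_of_real (indicator K (trig T 1 t)))"
proof -
  define f where "f = (\<lambda>n z. max 0 (1 - real n * infdist z K))"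
  have cont: "continuous_on A (f n)" for n A
    unfolding f_def by (intro continuous_intros)
  have f01: "0 \<le> f n z" "f n z \<le> 1" for n z
    by (auto simp: f_def infdist_nonneg)
  have ap: "trig_approximable T (\<lambda>t. complex_of_real (f n (trig T 1 t)))" for n
    unfolding trig_approximable_def
  proof safe
    have [measurable]: "f n \<in> borel_measurable borel"
      using cont by (rule borel_measurable_continuous_onI)
    show sq: "square_integrable T (\<lambda>t. complex_of_real (f n (trig T 1 t)))"
      using T f01 by (intro square_integrable_bounded[where B = 1] measurable_interval_measure) auto
    fix \<epsilon> :: real assume \<epsilon>: "\<epsilon> > 0"
    define \<delta> where "\<delta> = sqrt (\<epsilon> / (2 * T))"
    have \<delta>: "\<delta> > 0" "\<delta>\<^sup>2 = \<epsilon> / (2 * T)" using \<epsilon> T by (auto simp: \<delta>_def)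
    obtain g where g: "real_polynomial_function g" "\<And>z. z \<in> sphere 0 1 \<Longrightarrow> \<bar>f n z - g z\<bar> < \<delta>"
      using Stone_Weierstrass_real_polynomial_function[OF compact_sphere cont \<delta>(1)] by blast
    have gp: "(\<lambda>t. complex_of_real (g (trig T 1 t))) \<in> trig_polys T"
      using g(1) by (rule real_polynomial_on_circle)
    have "(\<integral>t. (norm (complex_of_real (f n (trig T 1 t)) - complex_of_real (g (trig T 1 t))))\<^sup>2 \<partial>interval_measure T) \<le>
        (\<integral>t. \<delta>\<^sup>2 \<partial>interval_measure T)"
    proof (rule integral_mono)
      show "integrable (interval_measure T) (\<lambda>t. (norm (complex_of_real (f n (trig T 1 t)) - complex_of_real (g (trig T 1 t))))\<^sup>2)"
        using T by (intro integrable_norm_diff_squared sq square_integrable_trig_poly gp) auto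
      show "integrable (interval_measure T) (\<lambda>t. \<delta>\<^sup>2)"
        using T by (intro integrable_interval_bounded[where B = "\<delta>\<^sup>2"]) auto
      fix t
      have "\<bar>f n (trig T 1 t) - g (trig T 1 t)\<bar> \<le> \<delta>" using g(2)[of "trig T 1 t"] by simp
      hence "\<bar>f n (trig T 1 t) - g (trig T 1 t)\<bar>\<^sup>2 \<le> \<delta>\<^sup>2" by (intro power_mono) auto
      thus "(norm (complex_of_real (f n (trig T 1 t)) - complex_of_real (g (trig T 1 t))))\<^sup>2 \<le> \<delta>\<^sup>2"
        by (metis norm_of_real of_real_diff)
    qed
    also have "\<dots> = T * \<delta>\<^sup>2"
      using T emeasure_interval_measure[of T] by (simp add: measure_def)
    also have "\<dots> < \<epsilon>" using T \<epsilon> \<delta> by simp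
    finally show "\<exists>p\<in>trig_polys T. (\<integral>t. (norm (complex_of_real (f n (trig T 1 t)) - p t))\<^sup>2 \<partial>interval_measure T) < \<epsilon>"
      by (intro bexI[OF _ gp])
  qed
  show ?thesis
  proof (rule trig_approximable_dominated[where w = "\<lambda>_. 1"])
    show "(\<lambda>t. complex_of_real (indicator K (trig T 1 t))) \<in> borel_measurable (interval_measure T)"
    proof (rule measurable_interval_measure)
      have [measurable]: "K \<in> sets borel" using K(1) by simp
      show "(\<lambda>t. complex_of_real (indicator K (trig T 1 t))) \<in> borel_measurable borel" by measurable
    qed
    show "(\<lambda>n. complex_of_real (f n (trig T 1 t))) \<longlonglongrightarrow> complex_of_real (indicator K (trig T 1 t))" for t
    proof (cases "trig T 1 t \<in> K")
      case True
      thus ?thesis by (simp add: f_def)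
    next
      case False
      hence pos: "infdist (trig T 1 t) K > 0" using K by (simp add: infdist_pos_not_in_closed)
      have "eventually (\<lambda>n. real n > 1 / infdist (trig T 1 t) K) sequentially"
        using filterlim_real_sequentially by (simp add: filterlim_at_top_dense)
      hence "eventually (\<lambda>n. complex_of_real (f n (trig T 1 t)) = 0) sequentially"
        by eventually_elim (use pos in \<open>auto simp: f_def field_simps\<close>)
      thus ?thesis using False by (simp add: tendsto_eventually)
    qed
    show "integrable (interval_measure T) (\<lambda>t. 1\<^sup>2 :: real)"
      using T by (intro integrable_interval_bounded[where B = 1]) auto
  qed (use T f01 ap in auto)
qed

lemma inj_on_trig_1: "T > 0 \<Longrightarrow> inj_on (trig T 1) {0..<T}"
proof (rule inj_onI)
  fix x y assume T: "T > 0" and xy: "x \<in> {0..<T}" "y \<in> {0..<T}" "trig T 1 x = trig T 1 y"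
  have "cis (2 * pi * (x / T)) = cis (2 * pi * (y / T))" using xy(3) by (simp add: trig_def)
  moreover have "2 * pi * (x / T) \<in> {0..<2 * pi}" "2 * pi * (y / T) \<in> {0..<2 * pi}"
    using xy T by (auto simp: field_simps)
  ultimately have "2 * pi * (x / T) = 2 * pi * (y / T)"
    by (metis Arg2pi_unique atLeastLessThan_iff cis_conv_exp mult_1 of_real_1 zero_less_one)
  thus "x = y" using T by simp
qed

lemma trig_approximable_indicator_atMost:
  assumes T: "T > 0"
  shows "trig_approximable T (\<lambda>t. complex_of_real (indicator {..b} t))"
proof -
  have cong: "trig_approximable T u" if "trig_approximable T v" "\<And>t. t \<in> {0..<T} \<Longrightarrow> u t = v t" for u v
  proof -
    have "(\<integral>t. (norm (u t - p t))\<^sup>2 \<partial>interval_measure T) = (\<integral>t. (norm (v t - p t))\<^sup>2 \<partial>interval_measure T)" for p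
      by (rule Bochner_Integration.integral_cong) (auto simp: that)
    moreover have "square_integrable T u \<longleftrightarrow> square_integrable T v"
      unfolding square_integrable_def
      by (intro conj_cong measurable_cong Bochner_Integration.integrable_cong) (auto simp: that)
    ultimately show ?thesis using that(1) by (simp add: trig_approximable_def)
  qed
  have const: "trig_approximable T (\<lambda>t. c)" for c using T by (intro trig_approximable_const) auto
  consider "b < 0" | "b \<ge> T" | "0 \<le> b" "b < T" by linarith
  thus ?thesis
  proof cases
    case 1
    thus ?thesis by (intro cong[OF const[of 0]]) auto
  next
    case 2
    thus ?thesis by (intro cong[OF const[of 1]]) auto
  next
    case 3
    \<comment> \<open>As \<open>b < T\<close>, the arc traced out by \<open>[0, b]\<close> is compact and meets no other point of the period.\<close>
    define K where "K = trig T 1 ` {0..b}"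
    have "compact K" unfolding K_def trig_def by (intro compact_continuous_image continuous_intros) (use T in auto)
    hence K: "closed K" "K \<noteq> {}" using 3 by (auto simp: K_def compact_imp_closed)
    show ?thesis
    proof (rule cong[OF trig_approximable_indicator_circle[OF T K]])
      fix t assume t: "t \<in> {0..<T}"
      have "trig T 1 t \<in> K \<longleftrightarrow> t \<in> {0..b}"
        unfolding K_def by (rule inj_on_image_mem_iff[OF inj_on_trig_1[OF T] t]) (use 3 in auto)
      thus "complex_of_real (indicator {..b} t) = complex_of_real (indicator K (trig T 1 t))"
        using t by (simp add: indicator_def)
    qed
  qed
qed

text \<open>
  Half-lines generate the Borel sets and are closed under intersection, so Dynkin's lemma extends the
  approximation from half-lines to Borel sets.
\<close>

lemma trig_approximable_indicator:
  assumes T: "T > 0" and A: "A \<in> sets borel"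
  shows "trig_approximable T (\<lambda>t. complex_of_real (indicator A t))"
proof -
  let ?G = "range (\<lambda>b::real. {..b})"
  have int1: "integrable (interval_measure T) (\<lambda>t. 1 :: real)"
    using T by (intro integrable_interval_bounded[where B = 1]) auto
  have "sets (sigma UNIV ?G) = sigma_sets UNIV ?G" by (rule sets_measure_of) auto
  hence bor: "sigma_sets UNIV ?G = sets borel" by (metis borel_eq_atMost)
  have "Int_stable ?G" by (auto simp: Int_stable_def Int_atMost)
  moreover have "?G \<subseteq> Pow UNIV" by simp
  moreover have "A \<in> sigma_sets UNIV ?G" using A bor by simp
  ultimately show ?thesis
  proof (induction rule: sigma_sets_induct_disjoint)
    case (basic A)
    thus ?case using trig_approximable_indicator_atMost[OF T] by auto
  next
    case empty
    show ?case using trig_approximable_scale[OF _ trig_approximable_indicator_atMost[OF T], of 0] T by simp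
  next
    case (compl A)
    have "trig_approximable T (\<lambda>t. complex_of_real (indicator {..T} t) + (-1) * complex_of_real (indicator A t))"
      using T by (intro trig_approximable_add trig_approximable_scale trig_approximable_indicator_atMost compl) auto
    thus ?case
    proof (rule trig_approximable_dominated[rotated, where w = "\<lambda>_. 1"])
      show "(\<lambda>t. complex_of_real (indicator (UNIV - A) t)) \<in> borel_measurable (interval_measure T)"
      proof (rule measurable_interval_measure)
        have [measurable]: "A \<in> sets borel" using compl(1) bor by simp
        show "(\<lambda>t. complex_of_real (indicator (UNIV - A) t)) \<in> borel_measurable borel" by measurable
      qed
      show "(\<lambda>n::nat. complex_of_real (indicator {..T} t) + (-1) * complex_of_real (indicator A t))
          \<longlonglongrightarrow> complex_of_real (indicator (UNIV - A) t)" if "t \<in> {0..<T}" for t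
        using that by (auto simp: indicator_def)
    qed (use T int1 in \<open>auto simp: indicator_def\<close>)
  next
    case (union A)
    have Ab: "A i \<in> sets borel" for i using union bor by auto
    have eq: "(\<Sum>i<n. complex_of_real (indicator (A i) t)) = complex_of_real (indicator (\<Union>i<n. A i) t)" for n t
    proof -
      have "indicator (\<Union>i<n. A i) t = (\<Sum>i<n. indicator (A i) t :: real)"
        by (rule indicator_UN_disjoint) (use union.hyps in \<open>auto intro: disjoint_family_on_mono\<close>)
      thus ?thesis by simp
    qed
    show ?case
    proof (rule trig_approximable_dominated[where w = "\<lambda>_. 1"])
      show "trig_approximable T (\<lambda>t. \<Sum>i<n. complex_of_real (indicator (A i) t))" for n
        using T union by (auto intro!: trig_approximable_sum)
      show "(\<lambda>t. complex_of_real (indicator (\<Union>i. A i) t)) \<in> borel_measurable (interval_measure T)"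
      proof (rule measurable_interval_measure)
        note [measurable] = Ab
        show "(\<lambda>t. complex_of_real (indicator (\<Union>i. A i) t)) \<in> borel_measurable borel" by measurable
      qed
      show "(\<lambda>n. \<Sum>i<n. complex_of_real (indicator (A i) t)) \<longlonglongrightarrow> complex_of_real (indicator (\<Union>i. A i) t)" for t
        unfolding eq by (intro tendsto_of_real LIMSEQ_indicator_UN)
      show "norm (\<Sum>i<n. complex_of_real (indicator (A i) t)) \<le> 1" for n t
        unfolding eq by (simp add: indicator_def)
    qed (use T int1 in auto)
  qed
qed

lemma square_integrable_imp_trig_approximable:
  assumes T: "T > 0" and u: "square_integrable T u"
  shows "trig_approximable T u"
proof -
  let ?M = "interval_measure T"
  have um: "u \<in> borel_measurable ?M" using u by (rule square_integrable_measurable)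
  obtain s where s: "\<And>i. simple_function ?M (s i)" "\<And>t. t \<in> space ?M \<Longrightarrow> (\<lambda>i. s i t) \<longlonglongrightarrow> u t"
      "\<And>i t. t \<in> space ?M \<Longrightarrow> dist (s i t) 0 \<le> 2 * dist (u t) 0"
    using borel_measurable_implies_sequence_metric[OF um, of 0] by blast
  show ?thesis
  proof (rule trig_approximable_dominated[where w = "\<lambda>t. 2 * norm (u t)" and v = s])
    fix n
    have sm: "s n \<in> borel_measurable ?M" using s(1) by (rule borel_measurable_simple_function)
    have fin: "finite (s n ` {0..<T})" using simple_functionD(1)[OF s(1)[of n]] by simp
    have setA: "s n -` {y} \<inter> {0..<T} \<in> sets borel" for y
    proof -
      have "s n -` {y} \<inter> space ?M \<in> sets ?M" using s(1) by (rule simple_functionD(2))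
      thus ?thesis by (simp add: interval_measure_def sets_restrict_space_iff)
    qed
    have sum_eq: "(\<Sum>y\<in>s n ` {0..<T}. y * complex_of_real (indicator (s n -` {y} \<inter> {0..<T}) t)) = s n t"
      if t: "t \<in> {0..<T}" for t
    proof -
      have "(\<Sum>y\<in>s n ` {0..<T}. y * complex_of_real (indicator (s n -` {y} \<inter> {0..<T}) t)) =
          (\<Sum>y\<in>{s n t}. y * complex_of_real (indicator (s n -` {y} \<inter> {0..<T}) t))"
        by (rule sum.mono_neutral_right) (use fin t in \<open>auto simp: indicator_def\<close>)
      also have "\<dots> = s n t" using t by simp
      finally show ?thesis .
    qed
    have "trig_approximable T (\<lambda>t. \<Sum>y\<in>s n ` {0..<T}. y * complex_of_real (indicator (s n -` {y} \<inter> {0..<T}) t))"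
      using T by (intro trig_approximable_sum trig_approximable_scale trig_approximable_indicator setA) auto
    thus "trig_approximable T (s n)"
    proof (rule trig_approximable_dominated[rotated, where w = "\<lambda>t. norm (s n t)"])
      show "integrable ?M (\<lambda>t. (norm (s n t))\<^sup>2)"
      proof (rule Bochner_Integration.integrable_bound)
        show "integrable ?M (\<lambda>t. 4 * (norm (u t))\<^sup>2)" using u by (simp add: square_integrable_def)
        show "AE t in ?M. norm ((norm (s n t))\<^sup>2) \<le> norm (4 * (norm (u t))\<^sup>2)"
        proof (rule AE_I2)
          fix t assume "t \<in> space ?M"
          hence "(norm (s n t))\<^sup>2 \<le> (2 * norm (u t))\<^sup>2" using s(3) by (intro power_mono) auto
          thus "norm ((norm (s n t))\<^sup>2) \<le> norm (4 * (norm (u t))\<^sup>2)" by (simp add: power_mult_distrib)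
        qed
      qed (use sm in measurable)
    next
      show "T \<ge> 0" using T by simp
    qed (use sm in \<open>simp_all add: sum_eq\<close>)
  next
    show "integrable ?M (\<lambda>t. (2 * norm (u t))\<^sup>2)"
      using u by (simp add: square_integrable_def power_mult_distrib)
  next
    fix n t assume "t \<in> {0..<T}"
    thus "norm (s n t) \<le> 2 * norm (u t)" using s(3)[of t n] by simp
  next
    fix t assume "t \<in> {0..<T}"
    thus "(\<lambda>n. s n t) \<longlonglongrightarrow> u t" using s(2)[of t] by simp
  next
    show "T \<ge> 0" using T by simp
  qed (rule um)
qed


lemma integrable_times_trig:
  assumes T: "T \<ge> 0" and u: "square_integrable T u"
  shows "integrable (interval_measure T) (\<lambda>t. u t * trig T l t)"
proof (rule Bochner_Integration.integrable_bound)
  show "integrable (interval_measure T) (\<lambda>t. 1 + (norm (u t))\<^sup>2)"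
    using u T integrable_interval_bounded[of T "\<lambda>_. 1 :: real" 1] by (auto simp: square_integrable_def)
  show "(\<lambda>t. u t * trig T l t) \<in> borel_measurable (interval_measure T)"
    by (rule borel_measurable_times[OF square_integrable_measurable[OF u] measurable_interval_measure[OF measurable_trig]])
  have "x \<le> 1 + x\<^sup>2" if "x \<ge> 0" for x :: real
    using that sum_squares_bound[of x 1] by simp
  thus "AE t in interval_measure T. norm (u t * trig T l t) \<le> norm (1 + (norm (u t))\<^sup>2)"
    by (intro AE_I2) (simp add: norm_mult)
qed

lemma integral_norm_diff_trig_sum:
  fixes a :: "int \<Rightarrow> complex"
  assumes T: "T > 0" and u: "square_integrable T u" and F: "finite F"
  defines "c \<equiv> (\<lambda>l. \<integral>t. u t * trig T (- l) t \<partial>interval_measure T)"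
  shows "(\<integral>t. (norm (u t - (\<Sum>l\<in>F. a l * trig T l t)))\<^sup>2 \<partial>interval_measure T) =
    (\<integral>t. (norm (u t))\<^sup>2 \<partial>interval_measure T) + (\<Sum>l\<in>F. T * (norm (a l))\<^sup>2 - 2 * Re (cnj (a l) * c l))"
proof -
  let ?M = "interval_measure T"
  let ?I = "\<lambda>f. (\<integral>t. (f t :: complex) \<partial>?M)"
  have T0: "T \<ge> 0" using T by simp
  have int_u: "integrable ?M (\<lambda>t. complex_of_real ((norm (u t))\<^sup>2))"
    using u by (auto simp: square_integrable_def simp del: of_real_power)
  have int_ut: "integrable ?M (\<lambda>t. u t * trig T l t)" for l by (rule integrable_times_trig[OF T0 u])
  have int_cut: "integrable ?M (\<lambda>t. cnj (u t) * trig T l t)" for l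
    using integrable_cnj[OF int_ut[of "- l"]] by simp
  have int_t: "integrable ?M (trig T l)" for l
    using T0 by (intro integrable_interval_bounded[where B = 1]) (auto intro: measurable_interval_measure)
  have cnj_c: "?I (\<lambda>t. cnj (u t) * trig T l t) = cnj (c l)" for l
  proof -
    have "cnj (c l) = ?I (\<lambda>t. cnj (u t * trig T (- l) t))"
      unfolding c_def by (rule Bochner_Integration.integral_cnj[symmetric])
    thus ?thesis by (simp only: complex_cnj_mult cnj_trig minus_minus)
  qed
  have eq: "complex_of_real ((norm (u t - (\<Sum>l\<in>F. a l * trig T l t)))\<^sup>2) =
      complex_of_real ((norm (u t))\<^sup>2) - (\<Sum>l\<in>F. cnj (a l) * (u t * trig T (- l) t))
      - (\<Sum>l\<in>F. a l * (cnj (u t) * trig T l t)) + (\<Sum>l\<in>F. \<Sum>m\<in>F. a l * cnj (a m) * trig T (l - m) t)" for t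
  proof -
    have "complex_of_real ((norm (u t - (\<Sum>l\<in>F. a l * trig T l t)))\<^sup>2) =
        (u t - (\<Sum>l\<in>F. a l * trig T l t)) * (cnj (u t) - (\<Sum>l\<in>F. cnj (a l) * trig T (- l) t))"
      unfolding complex_norm_square by simp
    also have "\<dots> = u t * cnj (u t) - (\<Sum>l\<in>F. cnj (a l) * trig T (- l) t) * u t
        - (\<Sum>l\<in>F. a l * trig T l t) * cnj (u t)
        + (\<Sum>l\<in>F. a l * trig T l t) * (\<Sum>l\<in>F. cnj (a l) * trig T (- l) t)"
      by (simp add: algebra_simps)
    also have "(\<Sum>l\<in>F. a l * trig T l t) * (\<Sum>l\<in>F. cnj (a l) * trig T (- l) t) =
        (\<Sum>l\<in>F. \<Sum>m\<in>F. a l * cnj (a m) * trig T (l - m) t)"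
      unfolding sum_product
    proof (intro sum.cong refl)
      fix l m
      have "trig T (l - m) t = trig T l t * trig T (- m) t" by (simp add: trig_mult)
      thus "a l * trig T l t * (cnj (a m) * trig T (- m) t) = a l * cnj (a m) * trig T (l - m) t" by simp
    qed
    finally show ?thesis by (simp only: complex_norm_square sum_distrib_left mult_ac)
  qed
  have "complex_of_real (\<integral>t. (norm (u t - (\<Sum>l\<in>F. a l * trig T l t)))\<^sup>2 \<partial>?M) =
      ?I (\<lambda>t. complex_of_real ((norm (u t - (\<Sum>l\<in>F. a l * trig T l t)))\<^sup>2))"
    by (rule integral_complex_of_real[symmetric])
  also have "\<dots> = ?I (\<lambda>t. complex_of_real ((norm (u t))\<^sup>2)) - (\<Sum>l\<in>F. cnj (a l) * c l)
      - (\<Sum>l\<in>F. a l * cnj (c l)) + (\<Sum>l\<in>F. \<Sum>m\<in>F. a l * cnj (a m) * ?I (trig T (l - m)))"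
    unfolding eq
    by (simp add: int_u int_ut int_cut int_t cnj_c del: of_real_power) (simp add: c_def)
  also have "(\<Sum>l\<in>F. \<Sum>m\<in>F. a l * cnj (a m) * ?I (trig T (l - m))) = (\<Sum>l\<in>F. a l * cnj (a l) * of_real T)"
  proof (intro sum.cong refl)
    fix l assume l: "l \<in> F"
    have "(\<Sum>m\<in>F. a l * cnj (a m) * ?I (trig T (l - m))) = (\<Sum>m\<in>F. if m = l then a l * cnj (a m) * of_real T else 0)"
      by (intro sum.cong refl) (simp add: integral_trig[OF T])
    thus "(\<Sum>m\<in>F. a l * cnj (a m) * ?I (trig T (l - m))) = a l * cnj (a l) * of_real T"
      using F l by simp
  qed
  also have "?I (\<lambda>t. complex_of_real ((norm (u t))\<^sup>2)) = of_real (\<integral>t. (norm (u t))\<^sup>2 \<partial>?M)"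
    by (rule integral_complex_of_real)
  also have "of_real (\<integral>t. (norm (u t))\<^sup>2 \<partial>?M) - (\<Sum>l\<in>F. cnj (a l) * c l)
      - (\<Sum>l\<in>F. a l * cnj (c l)) + (\<Sum>l\<in>F. a l * cnj (a l) * of_real T) =
      of_real (\<integral>t. (norm (u t))\<^sup>2 \<partial>?M) +
      (\<Sum>l\<in>F. a l * cnj (a l) * of_real T - (cnj (a l) * c l + cnj (cnj (a l) * c l)))"
    by (simp add: sum_subtractf sum.distrib)
  also have "\<dots> = of_real ((\<integral>t. (norm (u t))\<^sup>2 \<partial>?M) + (\<Sum>l\<in>F. T * (norm (a l))\<^sup>2 - 2 * Re (cnj (a l) * c l)))"
    unfolding complex_add_cnj complex_norm_square[symmetric] by (simp add: mult.commute)
  finally show ?thesis by (simp only: of_real_eq_iff)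
qed

text \<open>
  Parseval's identity: one inequality is Bessel's, the other one follows from the density of the
  trigonometric polynomials, because the Fourier partial sum is the best approximation from its span.
\<close>

theorem parseval_interval:
  assumes T: "T > 0" and u: "square_integrable T u"
  shows "((\<lambda>l. (norm (\<integral>t. u t * trig T (- l) t \<partial>interval_measure T))\<^sup>2) has_sum
     (T * (\<integral>t. (norm (u t))\<^sup>2 \<partial>interval_measure T))) UNIV"
proof -
  define c where "c = (\<lambda>l. \<integral>t. u t * trig T (- l) t \<partial>interval_measure T)"
  define S where "S = (\<integral>t. (norm (u t))\<^sup>2 \<partial>interval_measure T)"
  have bessel: "(\<Sum>l\<in>F. (norm (c l))\<^sup>2) \<le> T * S" if "finite F" for F
  proof -
    have "0 \<le> (\<integral>t. (norm (u t - (\<Sum>l\<in>F. c l / of_real T * trig T l t)))\<^sup>2 \<partial>interval_measure T)"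
      by simp
    also have "\<dots> = S + (\<Sum>l\<in>F. T * (norm (c l / of_real T))\<^sup>2 - 2 * Re (cnj (c l / of_real T) * c l))"
      unfolding integral_norm_diff_trig_sum[OF T u that] by (simp only: S_def c_def)
    also have "(\<Sum>l\<in>F. T * (norm (c l / of_real T))\<^sup>2 - 2 * Re (cnj (c l / of_real T) * c l)) =
        (\<Sum>l\<in>F. - ((norm (c l))\<^sup>2 / T))"
    proof (intro sum.cong refl)
      fix l
      have "cnj (c l / of_real T) * c l = of_real ((norm (c l))\<^sup>2 / T)"
        by (simp only: of_real_divide complex_norm_square) (simp add: mult.commute)
      hence "Re (cnj (c l / of_real T) * c l) = (norm (c l))\<^sup>2 / T" by (simp only: Re_complex_of_real)
      thus "T * (norm (c l / of_real T))\<^sup>2 - 2 * Re (cnj (c l / of_real T) * c l) = - ((norm (c l))\<^sup>2 / T)"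
        using T by (simp add: norm_divide power_divide power2_eq_square)
    qed
    also have "S + \<dots> = S - (\<Sum>l\<in>F. (norm (c l))\<^sup>2) / T"
      by (simp add: sum_negf sum_divide_distrib)
    finally show ?thesis using T by (simp add: field_simps)
  qed
  have approx: "\<exists>F. finite F \<and> T * S - \<epsilon> < (\<Sum>l\<in>F. (norm (c l))\<^sup>2)" if \<epsilon>: "\<epsilon> > 0" for \<epsilon>
  proof -
    obtain p where p: "p \<in> trig_polys T" "(\<integral>t. (norm (u t - p t))\<^sup>2 \<partial>interval_measure T) < \<epsilon> / T"
      using square_integrable_imp_trig_approximable[OF T u] \<epsilon> T
      unfolding trig_approximable_def by (meson divide_pos_pos)
    obtain F a where F: "finite F" and p_eq: "p = (\<lambda>t. \<Sum>l\<in>F. a l * trig T l t)"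
      using trig_polys_eq_sum[OF p(1)] by blast
    have "S - (\<Sum>l\<in>F. (norm (c l))\<^sup>2) / T = S + (\<Sum>l\<in>F. - ((norm (c l))\<^sup>2 / T))"
      by (simp add: sum_negf sum_divide_distrib)
    also have "\<dots> \<le> S + (\<Sum>l\<in>F. T * (norm (a l))\<^sup>2 - 2 * Re (cnj (a l) * c l))"
    proof (intro add_left_mono sum_mono)
      fix l
      have "0 \<le> (T * norm (a l) - norm (c l))\<^sup>2" by simp
      hence "2 * T * (norm (a l) * norm (c l)) \<le> T * (T * (norm (a l))\<^sup>2) + (norm (c l))\<^sup>2"
        by (simp add: power2_eq_square algebra_simps)
      moreover have "Re (cnj (a l) * c l) \<le> norm (a l) * norm (c l)"
        using complex_Re_le_cmod[of "cnj (a l) * c l"] by (simp add: norm_mult)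
      hence "2 * T * Re (cnj (a l) * c l) \<le> 2 * T * (norm (a l) * norm (c l))"
        using T by (intro mult_left_mono) auto
      ultimately have "0 \<le> (T * (T * (norm (a l))\<^sup>2 - 2 * Re (cnj (a l) * c l)) + (norm (c l))\<^sup>2) / T"
        using T by (intro divide_nonneg_pos) (auto simp: algebra_simps)
      also have "\<dots> = T * (norm (a l))\<^sup>2 - 2 * Re (cnj (a l) * c l) + (norm (c l))\<^sup>2 / T"
        using T by (simp add: add_divide_distrib)
      finally show "- ((norm (c l))\<^sup>2 / T) \<le> T * (norm (a l))\<^sup>2 - 2 * Re (cnj (a l) * c l)" by linarith
    qed
    also have "\<dots> = (\<integral>t. (norm (u t - p t))\<^sup>2 \<partial>interval_measure T)"
      unfolding p_eq integral_norm_diff_trig_sum[OF T u F] by (simp add: S_def c_def)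
    finally have "S - (\<Sum>l\<in>F. (norm (c l))\<^sup>2) / T < \<epsilon> / T" using p(2) by simp
    hence "T * (S - (\<Sum>l\<in>F. (norm (c l))\<^sup>2) / T) < T * (\<epsilon> / T)" using T by (rule mult_strict_left_mono)
    hence "T * S - \<epsilon> < (\<Sum>l\<in>F. (norm (c l))\<^sup>2)" using T by (simp add: right_diff_distrib)
    thus ?thesis using F by blast
  qed
  have "((\<lambda>l. (norm (c l))\<^sup>2) has_sum (T * S)) UNIV"
    unfolding has_sum_def tendsto_iff
  proof safe
    fix \<epsilon> :: real assume "\<epsilon> > 0"
    then obtain F where F: "finite F" "T * S - \<epsilon> < (\<Sum>l\<in>F. (norm (c l))\<^sup>2)" using approx by blast
    show "\<forall>\<^sub>F G in finite_subsets_at_top UNIV. dist (\<Sum>l\<in>G. (norm (c l))\<^sup>2) (T * S) < \<epsilon>"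
      unfolding eventually_finite_subsets_at_top
    proof (intro exI[of _ F] conjI allI impI)
      fix G assume G: "finite G \<and> F \<subseteq> G \<and> G \<subseteq> UNIV"
      have "(\<Sum>l\<in>F. (norm (c l))\<^sup>2) \<le> (\<Sum>l\<in>G. (norm (c l))\<^sup>2)" using G by (intro sum_mono2) auto
      thus "dist (\<Sum>l\<in>G. (norm (c l))\<^sup>2) (T * S) < \<epsilon>"
        using bessel[of G] F(2) G by (simp add: dist_real_def)
    qed (use F in auto)
  qed
  thus ?thesis by (simp add: c_def S_def)
qed

section \<open>Integrals over tiles of the line\<close>

lemma integral_interval_measure:
  fixes f :: "real \<Rightarrow> 'a::{banach, second_countable_topology}"
  shows "(\<integral>t. f t \<partial>interval_measure T) = (\<integral>t. indicator {0..<T} t *\<^sub>R f t \<partial>lborel)"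
  unfolding interval_measure_def by (rule integral_restrict_space) auto

lemma integrable_interval_measure:
  fixes f :: "real \<Rightarrow> 'a::{banach, second_countable_topology}"
  shows "integrable (interval_measure T) f \<longleftrightarrow> integrable lborel (\<lambda>t. indicator {0..<T} t *\<^sub>R f t)"
  unfolding interval_measure_def by (rule integrable_restrict_space) auto

lemma floor_divide_add_multiple:
  fixes s T :: real assumes "T > 0"
  shows "\<lfloor>(s + of_int j * T) / T\<rfloor> = j \<longleftrightarrow> s \<in> {0..<T}"
proof -
  have "(s + of_int j * T) / T = s / T + of_int j" using assms by (simp add: field_simps)
  thus ?thesis using assms by (auto simp: floor_eq_iff field_simps)
qed

text \<open>
  The line is cut into the tiles \<open>[j T, (j + 1) T)\<close>. The tile of a point \<open>t\<close> has the index \<open>\<lfloor>t / T\<rfloor>\<close>.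
\<close>

lemma
  fixes f :: "real \<Rightarrow> 'a::{banach, second_countable_topology}"
  assumes T: "T > 0" and f: "integrable lborel f"
  shows integrable_tile: "integrable (interval_measure T) (\<lambda>t. f (t + of_int j * T))"
    and integral_tile: "(\<integral>t. f (t + of_int j * T) \<partial>interval_measure T) =
      (\<integral>t. indicator {t. \<lfloor>t / T\<rfloor> = j} t *\<^sub>R f t \<partial>lborel)"
proof -
  define g where "g = (\<lambda>t. indicator {t. \<lfloor>t / T\<rfloor> = j} t *\<^sub>R f t)"
  have g: "integrable lborel g" unfolding g_def by (rule integrable_mult_indicator[OF _ f]) simp
  have eq: "g (of_int j * T + 1 * t) = indicator {0..<T} t *\<^sub>R f (t + of_int j * T)" for t
    using floor_divide_add_multiple[OF T, of t j] by (simp add: g_def indicator_def add.commute)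
  show "integrable (interval_measure T) (\<lambda>t. f (t + of_int j * T))"
    using lborel_integrable_real_affine[OF g, of 1 "of_int j * T"]
    by (simp add: eq[simplified] integrable_interval_measure)
  have "(\<integral>t. g t \<partial>lborel) = \<bar>1\<bar> *\<^sub>R (\<integral>t. g (of_int j * T + 1 * t) \<partial>lborel)"
    by (rule lborel_integral_real_affine) simp
  also have "\<dots> = (\<integral>t. indicator {0..<T} t *\<^sub>R f (t + of_int j * T) \<partial>lborel)"
    unfolding eq by simp
  finally show "(\<integral>t. f (t + of_int j * T) \<partial>interval_measure T) =
      (\<integral>t. indicator {t. \<lfloor>t / T\<rfloor> = j} t *\<^sub>R f t \<partial>lborel)"
    by (simp only: integral_interval_measure g_def)
qed

lemma integral_tiles:
  fixes f :: "real \<Rightarrow> 'a::{banach, second_countable_topology}"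
  assumes T: "T > 0" and f: "integrable lborel f" and J: "finite J"
  shows "(\<Sum>j\<in>J. \<integral>t. f (t + of_int j * T) \<partial>interval_measure T) =
      (\<integral>t. indicator {t. \<lfloor>t / T\<rfloor> \<in> J} t *\<^sub>R f t \<partial>lborel)"
proof -
  have int: "integrable lborel (\<lambda>t. indicator {t. \<lfloor>t / T\<rfloor> = j} t *\<^sub>R f t)" for j
    by (rule integrable_mult_indicator[OF _ f]) simp
  have "(\<Sum>j\<in>J. \<integral>t. f (t + of_int j * T) \<partial>interval_measure T) =
      (\<integral>t. (\<Sum>j\<in>J. indicator {t. \<lfloor>t / T\<rfloor> = j} t *\<^sub>R f t) \<partial>lborel)"
    by (simp add: integral_tile[OF T f] int)
  also have "\<dots> = (\<integral>t. indicator {t. \<lfloor>t / T\<rfloor> \<in> J} t *\<^sub>R f t \<partial>lborel)"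
  proof (rule Bochner_Integration.integral_cong)
    fix t
    have "(\<Sum>j\<in>J. indicator {t. \<lfloor>t / T\<rfloor> = j} t *\<^sub>R f t) = (\<Sum>j\<in>J. if j = \<lfloor>t / T\<rfloor> then f t else 0)"
      by (intro sum.cong) (auto simp: indicator_def)
    thus "(\<Sum>j\<in>J. indicator {t. \<lfloor>t / T\<rfloor> = j} t *\<^sub>R f t) = indicator {t. \<lfloor>t / T\<rfloor> \<in> J} t *\<^sub>R f t"
      using J by (simp add: indicator_def)
  qed simp
  finally show ?thesis .
qed

lemma filterlim_int_intervals:
  "filterlim (\<lambda>N::nat. {- int N..int N}) (finite_subsets_at_top UNIV) sequentially"
  unfolding filterlim_finite_subsets_at_top
proof safe
  fix X :: "int set" assume X: "finite X"
  define B where "B = Max (insert 0 (abs ` X))"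
  have B: "\<bar>x\<bar> \<le> B" if "x \<in> X" for x
    unfolding B_def using X that by (intro Max_ge) auto
  show "\<forall>\<^sub>F N in sequentially. finite {- int N..int N} \<and> X \<subseteq> {- int N..int N} \<and> {- int N..int N} \<subseteq> UNIV"
    using eventually_ge_at_top[of "nat B"]
  proof eventually_elim
    case (elim N)
    thus ?case using B by fastforce
  qed
qed

lemma truncation_tendsto:
  fixes f :: "real \<Rightarrow> 'a::real_normed_vector"
  shows "(\<lambda>N. indicator {t. \<lfloor>t / T\<rfloor> \<in> {- int N..int N}} t *\<^sub>R f t) \<longlonglongrightarrow> f t"
proof (rule tendsto_eventually)
  show "\<forall>\<^sub>F N in sequentially. indicator {t. \<lfloor>t / T\<rfloor> \<in> {- int N..int N}} t *\<^sub>R f t = f t"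
    using eventually_ge_at_top[of "nat \<bar>\<lfloor>t / T\<rfloor>\<bar>"]
    by eventually_elim (auto simp: indicator_def)
qed

lemma integral_tiles_tendsto:
  fixes f :: "real \<Rightarrow> 'a::{banach, second_countable_topology}"
  assumes T: "T > 0" and f: "integrable lborel f"
  shows "(\<lambda>N. \<Sum>j\<in>{- int N..int N}. \<integral>t. f (t + of_int j * T) \<partial>interval_measure T) \<longlonglongrightarrow> (\<integral>t. f t \<partial>lborel)"
proof -
  have [measurable]: "f \<in> borel_measurable lborel" using f by simp
  have "(\<lambda>N. \<integral>t. indicator {t. \<lfloor>t / T\<rfloor> \<in> {- int N..int N}} t *\<^sub>R f t \<partial>lborel) \<longlonglongrightarrow> (\<integral>t. f t \<partial>lborel)"
  proof (rule integral_dominated_convergence[where w = "\<lambda>t. norm (f t)"])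
    show "integrable lborel (\<lambda>t. norm (f t))" using f by simp
    show "AE t in lborel. (\<lambda>N. indicator {t. \<lfloor>t / T\<rfloor> \<in> {- int N..int N}} t *\<^sub>R f t) \<longlonglongrightarrow> f t"
      by (intro AE_I2 truncation_tendsto)
  qed (auto simp: indicator_def)
  thus ?thesis by (simp add: integral_tiles[OF T f])
qed

text \<open>
  Exchange of an absolutely and uniformly convergent sum with the integral over one period.
\<close>

lemma has_sum_integral_interval:
  fixes f :: "'i \<Rightarrow> real \<Rightarrow> complex"
  assumes T: "T \<ge> 0" and f: "\<And>k. f k \<in> borel_measurable (interval_measure T)"
    and S: "S \<in> borel_measurable (interval_measure T)"
    and bound: "\<And>k t. t \<in> {0..<T} \<Longrightarrow> norm (f k t) \<le> B k" and B: "B summable_on UNIV"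
    and sum: "\<And>t. t \<in> {0..<T} \<Longrightarrow> ((\<lambda>k. f k t) has_sum S t) UNIV"
  shows "((\<lambda>k. \<integral>t. f k t \<partial>interval_measure T) has_sum (\<integral>t. S t \<partial>interval_measure T)) UNIV"
proof -
  let ?M = "interval_measure T"
  have lim: "uniform_limit {0..<T} (\<lambda>F t. \<Sum>k\<in>F. f k t) S (finite_subsets_at_top UNIV)"
    by (rule Weierstrass_m_test_general'[OF _ _ B]) (use bound sum in auto)
  have intf: "integrable ?M (f k)" for k
    using T f bound by (rule integrable_interval_bounded)
  have intS: "integrable ?M S"
  proof (rule integrable_interval_bounded[OF T S])
    fix t assume t: "t \<in> {0..<T}"
    have "norm (S t) \<le> (\<Sum>\<^sub>\<infinity>k. B k)"
    proof (rule tendsto_upperbound)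
      show "((\<lambda>F. norm (\<Sum>k\<in>F. f k t)) \<longlongrightarrow> norm (S t)) (finite_subsets_at_top UNIV)"
        using sum[OF t] unfolding has_sum_def by (rule tendsto_norm)
      show "\<forall>\<^sub>F F in finite_subsets_at_top UNIV. norm (\<Sum>k\<in>F. f k t) \<le> (\<Sum>\<^sub>\<infinity>k. B k)"
      proof (rule eventually_finite_subsets_at_top_weakI)
        fix F :: "'i set" assume F: "finite F"
        have B0: "B k \<ge> 0" for k using order_trans[OF norm_ge_zero bound[OF t]] .
        have "norm (\<Sum>k\<in>F. f k t) \<le> (\<Sum>k\<in>F. B k)" by (rule sum_norm_le) (rule bound[OF t])
        also have "\<dots> \<le> (\<Sum>\<^sub>\<infinity>k. B k)" by (rule finite_sum_le_infsum[OF B F]) (use B0 in auto)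
        finally show "norm (\<Sum>k\<in>F. f k t) \<le> (\<Sum>\<^sub>\<infinity>k. B k)" .
      qed
    qed simp
    thus "norm (S t) \<le> (\<Sum>\<^sub>\<infinity>k. B k)" .
  qed
  show ?thesis unfolding has_sum_def tendsto_iff
  proof safe
    fix \<epsilon> :: real assume \<epsilon>: "\<epsilon> > 0"
    define \<delta> where "\<delta> = \<epsilon> / (T + 1)"
    have \<delta>: "\<delta> > 0" "T * \<delta> < \<epsilon>" using \<epsilon> T by (auto simp: \<delta>_def field_simps)
    show "\<forall>\<^sub>F F in finite_subsets_at_top UNIV. dist (\<Sum>k\<in>F. \<integral>t. f k t \<partial>?M) (\<integral>t. S t \<partial>?M) < \<epsilon>"
      using uniform_limitD[OF lim \<delta>(1)]
    proof eventually_elim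
      case (elim F)
      have "(\<Sum>k\<in>F. \<integral>t. f k t \<partial>?M) - (\<integral>t. S t \<partial>?M) = (\<integral>t. (\<Sum>k\<in>F. f k t) - S t \<partial>?M)"
        using intf intS by simp
      also have "norm \<dots> \<le> (\<integral>t. \<delta> \<partial>?M)"
      proof (rule Bochner_Integration.integral_norm_bound_integral)
        show "integrable ?M (\<lambda>t. \<delta>)"
          using T by (intro integrable_interval_bounded[where B = "\<delta>"]) (use \<delta> in auto)
      qed (use elim intf intS in \<open>auto simp: dist_norm less_imp_le\<close>)
      also have "\<dots> = T * \<delta>"
        using T emeasure_interval_measure[of T] by (simp add: measure_def)
      finally show ?case using \<delta>(2) by (simp add: dist_norm)
    qed
  qed
qed

section \<open>Lattice sums and Poisson summation\<close>

lemma summable_on_int: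
  fixes f :: "int \<Rightarrow> real"
  assumes "(\<lambda>n::nat. f (int n)) summable_on UNIV" "(\<lambda>n::nat. f (- int n)) summable_on UNIV"
  shows "f summable_on UNIV"
proof -
  have "f summable_on range int" using assms(1) by (subst summable_on_reindex) (auto simp: o_def)
  moreover have "f summable_on range (\<lambda>n. - int n)"
    using assms(2) by (subst summable_on_reindex) (auto simp: o_def inj_on_def)
  ultimately have "f summable_on (range int \<union> range (\<lambda>n. - int n))" by (rule summable_on_union)
  moreover have "range int \<union> range (\<lambda>n. - int n) = UNIV"
  proof (safe; simp)
    fix x :: int assume x: "x \<notin> range (\<lambda>n. - int n)"
    have "x \<ge> 0"
    proof (rule ccontr)
      assume "\<not> x \<ge> 0"
      hence "x = - int (nat (- x))" by simp
      thus False using x by blast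
    qed
    thus "x \<in> range int" by (metis nonneg_int_cases rangeI)
  qed
  ultimately show ?thesis by simp
qed

lemma summable_on_int_inverse_squares:
  fixes \<alpha> :: real assumes "\<alpha> > 0"
  shows "(\<lambda>k::int. 1 / (1 + (of_int k * \<alpha>)\<^sup>2)) summable_on UNIV"
proof -
  have "summable (\<lambda>n. 1 / (1 + (real n * \<alpha>)\<^sup>2))"
  proof (rule summable_comparison_test')
    show "summable (\<lambda>n. 1 / \<alpha>\<^sup>2 * inverse (real n ^ 2))"
      by (intro summable_mult inverse_power_summable) auto
    fix n :: nat assume "n \<ge> 1"
    hence "1 / (1 + (real n * \<alpha>)\<^sup>2) \<le> 1 / (real n * \<alpha>)\<^sup>2"
      using assms by (intro divide_left_mono mult_pos_pos) (auto simp: add_nonneg_pos add_pos_nonneg)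
    thus "norm (1 / (1 + (real n * \<alpha>)\<^sup>2)) \<le> 1 / \<alpha>\<^sup>2 * inverse (real n ^ 2)"
      by (simp add: field_simps power_mult_distrib)
  qed
  hence *: "(\<lambda>n::nat. 1 / (1 + (real n * \<alpha>)\<^sup>2)) summable_on UNIV"
    by (subst summable_on_UNIV_nonneg_real_iff) auto
  show ?thesis by (rule summable_on_int) (use * in simp_all)
qed

text \<open>
  Peetre's inequality: quadratic decay survives a translation up to a constant.
\<close>

lemma peetre_inequality: "1 / (1 + (a + b)\<^sup>2) \<le> 2 * (1 + a\<^sup>2) / (1 + (b::real)\<^sup>2)"
proof -
  have "b\<^sup>2 = (norm ((a + b) - a))\<^sup>2" by simp
  also have "\<dots> \<le> 2 * (norm (a + b - 0))\<^sup>2 + 2 * (norm (0 - a))\<^sup>2" by (rule norm_diff_squared_le)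
  finally have "b\<^sup>2 \<le> 2 * (a + b)\<^sup>2 + 2 * a\<^sup>2" by simp
  moreover have "0 \<le> a\<^sup>2 * (a + b)\<^sup>2" by simp
  moreover have "2 * (1 + a\<^sup>2) * (1 + (a + b)\<^sup>2) = 2 + 2 * a\<^sup>2 + 2 * (a + b)\<^sup>2 + 2 * (a\<^sup>2 * (a + b)\<^sup>2)"
    by (simp only: ring_distribs mult_1_right mult_1_left mult.assoc)
  ultimately have "1 + b\<^sup>2 \<le> 2 * (1 + a\<^sup>2) * (1 + (a + b)\<^sup>2)" by linarith
  thus ?thesis by (simp add: divide_simps add_nonneg_pos add_pos_nonneg)
qed

lemma integrable_inverse_one_plus_square: "integrable lborel (\<lambda>t::real. 1 / (1 + t\<^sup>2))"
proof -
  define f where "f = (\<lambda>t::real. indicator {0<..} t *\<^sub>R (1 / (1 + t\<^sup>2)))"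
  have f: "integrable lborel f"
    using integrable_I0i_1_div_plus_square by (simp add: f_def interval_lebesgue_integrable_def set_integrable_def einterval_def greaterThan_def)
  have g: "integrable lborel (\<lambda>t. f (0 + (-1) * t))" by (rule lborel_integrable_real_affine[OF f]) simp
  have "integrable lborel (\<lambda>t. f t + f (0 + (-1) * t))" by (intro Bochner_Integration.integrable_add f g)
  moreover have "AE t in lborel. f t + f (0 + (-1) * t) = 1 / (1 + t\<^sup>2)"
    using AE_lborel_singleton[of "0::real"] by eventually_elim (auto simp: f_def indicator_def)
  ultimately show ?thesis by (subst integrable_cong_AE[symmetric]) (auto simp: f_def)
qed

lemma continuous_zero_of_integral_zero:
  fixes u :: "real \<Rightarrow> complex"
  assumes T: "T > 0" and u: "continuous_on UNIV u" and z: "(\<integral>t. (norm (u t))\<^sup>2 \<partial>interval_measure T) = 0"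
    and t: "t \<in> {0..<T}"
  shows "u t = 0"
proof -
  let ?f = "\<lambda>t. (norm (u t))\<^sup>2"
  have cont: "continuous_on {0..T} ?f"
    by (intro continuous_intros continuous_on_subset[OF u]) auto
  have int: "set_integrable lborel {0..T} ?f" by (rule borel_integrable_atLeastAtMost') (rule cont)
  have "(\<integral>t. ?f t \<partial>interval_measure T) = (LINT t:{0..T}|lborel. ?f t)"
    unfolding integral_interval_measure set_lebesgue_integral_def
  proof (rule integral_cong_AE)
    have "AE t in lborel. t \<noteq> T" by (rule AE_lborel_singleton)
    thus "AE t in lborel. indicator {0..<T} t *\<^sub>R ?f t = indicator {0..T} t *\<^sub>R ?f t"
      by eventually_elim (auto simp: indicator_def)
  qed (use borel_measurable_continuous_onI[OF u] in measurable)
  hence "(?f has_integral 0) (cbox 0 T)"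
    using set_borel_integral_eq_integral[OF int] z
    by (simp add: has_integral_integrable_integral)
  hence "?f t = 0"
    using cont T t by (intro has_integral_0_cbox_imp_0[of 0 T ?f]) auto
  thus ?thesis by simp
qed

lemma decay_lattice_bound:
  fixes h :: "real \<Rightarrow> 'a::real_normed_vector"
  assumes decay: "\<And>t. norm (h t) \<le> C / (1 + t\<^sup>2)" and x: "\<bar>x\<bar> \<le> R"
  shows "norm (h (x + y)) \<le> C * (2 * (1 + R\<^sup>2)) * (1 / (1 + y\<^sup>2))"
proof -
  have C: "C \<ge> 0" using order_trans[OF norm_ge_zero decay[of 0]] by simp
  have "x\<^sup>2 \<le> R\<^sup>2" using power_mono[OF x, of 2] by simp
  have "norm (h (x + y)) \<le> C * (1 / (1 + (x + y)\<^sup>2))" using decay by simp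
  also have "\<dots> \<le> C * (2 * (1 + x\<^sup>2) / (1 + y\<^sup>2))"
    by (intro mult_left_mono peetre_inequality C)
  also have "\<dots> \<le> C * (2 * (1 + R\<^sup>2) / (1 + y\<^sup>2))"
    using \<open>x\<^sup>2 \<le> R\<^sup>2\<close> C by (intro mult_left_mono divide_right_mono) auto
  finally show ?thesis by simp
qed

lemma decay_lattice_summable:
  fixes h :: "real \<Rightarrow> 'a::real_normed_vector"
  assumes \<alpha>: "\<alpha> > 0" and decay: "\<And>t. norm (h t) \<le> C / (1 + t\<^sup>2)"
  shows "(\<lambda>k::int. norm (h (x + of_int k * \<alpha>))) summable_on UNIV"
proof (rule summable_on_comparison_test)
  show "(\<lambda>k::int. C * (2 * (1 + \<bar>x\<bar>\<^sup>2)) * (1 / (1 + (of_int k * \<alpha>)\<^sup>2))) summable_on UNIV"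
    by (intro summable_on_cmult_right summable_on_int_inverse_squares \<alpha>)
qed (auto intro!: decay_lattice_bound[OF decay, of x "\<bar>x\<bar>", simplified])

text \<open>
  The Fourier transform, which has the value 0 where the integrand is not integrable.
\<close>

definition fourier_integral :: "(real \<Rightarrow> complex) \<Rightarrow> real \<Rightarrow> complex" where
  "fourier_integral h \<omega> = (\<integral>t. h t * cis (- (2 * pi * \<omega> * t)) \<partial>lborel)"

lemma trig_add_period: "T \<noteq> 0 \<Longrightarrow> trig T l (t + of_int j * T) = trig T l t"
proof -
  assume T: "T \<noteq> 0"
  have "trig T l (t + of_int j * T) = cis (2 * pi * of_int l * t / T + 2 * pi * of_int (l * j))"
    using T by (simp add: trig_def field_simps)
  also have "\<dots> = trig T l t" by (simp add: trig_def cis_mult[symmetric] cis_multiple_2pi)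
  finally show ?thesis .
qed

lemma has_sum_shift_int:
  fixes f :: "int \<Rightarrow> 'a::{comm_monoid_add, topological_space}"
  shows "((\<lambda>k. f (k + j)) has_sum S) UNIV \<longleftrightarrow> (f has_sum S) UNIV"
  by (rule has_sum_reindex_bij_witness[of _ "\<lambda>k. k - j" "\<lambda>k. k + j"]) auto

text \<open>
  Both sides are continuous and \<open>\<alpha>\<close>-periodic in \<open>x\<close> and have the same Fourier coefficients. By Parseval's
  identity their difference vanishes almost everywhere, and by continuity everywhere.
\<close>

theorem poisson_summation:
  fixes h :: "real \<Rightarrow> complex"
  assumes \<alpha>: "\<alpha> > 0" and cont: "continuous_on UNIV h"
    and decay: "\<And>t. norm (h t) \<le> C / (1 + t\<^sup>2)"
    and summ: "(\<lambda>n::int. norm (fourier_integral h (of_int n / \<alpha>))) summable_on UNIV"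
  shows "((\<lambda>n. fourier_integral h (of_int n / \<alpha>) * trig \<alpha> n x) has_sum
      (of_real \<alpha> * (\<Sum>\<^sub>\<infinity>k::int. h (x + of_int k * \<alpha>)))) UNIV"
proof -
  let ?M = "interval_measure \<alpha>"
  define c where "c = (\<lambda>n::int. fourier_integral h (of_int n / \<alpha>))"
  define P where "P = (\<lambda>x. \<Sum>\<^sub>\<infinity>k::int. h (x + of_int k * \<alpha>))"
  define Q where "Q = (\<lambda>x. \<Sum>\<^sub>\<infinity>n::int. c n * trig \<alpha> n x)"
  define B where "B = (\<lambda>R k. C * (2 * (1 + R\<^sup>2)) * (1 / (1 + (of_int k * \<alpha>)\<^sup>2)))" for R :: real and k :: int
  have C: "C \<ge> 0" using order_trans[OF norm_ge_zero decay[of 0]] by simp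
  have hB: "norm (h (x + of_int k * \<alpha>)) \<le> B R k" if "\<bar>x\<bar> \<le> R" for x R k
    unfolding B_def by (rule decay_lattice_bound[OF decay that])
  have B: "B R summable_on UNIV" for R
    unfolding B_def by (intro summable_on_cmult_right summable_on_int_inverse_squares \<alpha>)
  have hmeas [measurable]: "h \<in> borel_measurable borel" using cont by (rule borel_measurable_continuous_onI)
  have P_lim: "uniform_limit {-R..R} (\<lambda>F x. \<Sum>k\<in>F. h (x + of_int k * \<alpha>)) P (finite_subsets_at_top UNIV)" for R
    unfolding P_def by (rule Weierstrass_m_test_general[OF _ B[of R]]) (auto intro!: hB)
  have contP: "continuous_on UNIV P"
  proof -
    have "continuous_on {-R..R} P" for R
    proof (rule uniform_limit_theorem[OF _ P_lim])
      show "\<forall>\<^sub>F F in finite_subsets_at_top UNIV. continuous_on {- R..R} (\<lambda>x. \<Sum>k\<in>F. h (x + of_int k * \<alpha>))"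
        by (intro always_eventually allI continuous_intros continuous_on_compose2[OF cont]) auto
    qed simp
    hence "isCont P x" for x
      by (rule continuous_on_interior[of "{-(\<bar>x\<bar>+1)..\<bar>x\<bar>+1}"]) (simp, linarith)
    thus ?thesis by (simp add: continuous_at_imp_continuous_on)
  qed
  have P_sum: "((\<lambda>k. h (x + of_int k * \<alpha>)) has_sum P x) UNIV" for x
    unfolding P_def using decay_lattice_summable[OF \<alpha> decay] by (intro has_sum_infsum) (rule abs_summable_summable)
  have contQ: "continuous_on UNIV Q"
  proof (rule uniform_limit_theorem)
    show "uniform_limit UNIV (\<lambda>F x. \<Sum>n\<in>F. c n * trig \<alpha> n x) Q (finite_subsets_at_top UNIV)"
      unfolding Q_def by (rule Weierstrass_m_test_general[OF _ summ]) (simp add: norm_mult c_def)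
    show "\<forall>\<^sub>F F in finite_subsets_at_top UNIV. continuous_on UNIV (\<lambda>x. \<Sum>n\<in>F. c n * trig \<alpha> n x)"
      unfolding trig_def using \<alpha> by (intro always_eventually allI continuous_intros) auto
  qed simp
  have Q_sum: "((\<lambda>n. c n * trig \<alpha> n x) has_sum Q x) UNIV" for x
  proof -
    have "(\<lambda>n. norm (c n * trig \<alpha> n x)) summable_on UNIV" using summ by (simp add: norm_mult c_def)
    thus ?thesis unfolding Q_def by (intro has_sum_infsum) (rule abs_summable_summable)
  qed
  have measP [measurable]: "P \<in> borel_measurable borel" and measQ [measurable]: "Q \<in> borel_measurable borel"
    using contP contQ by (auto intro: borel_measurable_continuous_onI)
  have P_bound: "norm (P x) \<le> (\<Sum>\<^sub>\<infinity>k. B \<alpha> k)" if "x \<in> {0..<\<alpha>}" for x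
  proof -
    have a: "(\<lambda>k. norm (h (x + of_int k * \<alpha>))) summable_on UNIV"
      by (rule decay_lattice_summable[OF \<alpha> decay])
    have "norm (P x) \<le> (\<Sum>\<^sub>\<infinity>k. norm (h (x + of_int k * \<alpha>)))"
      unfolding P_def by (rule norm_infsum_bound) (use a in auto)
    also have "\<dots> \<le> (\<Sum>\<^sub>\<infinity>k. B \<alpha> k)"
      by (rule infsum_mono[OF a B]) (use that in \<open>auto intro!: hB\<close>)
    finally show ?thesis .
  qed
  have Q_bound: "norm (Q x) \<le> (\<Sum>\<^sub>\<infinity>n. norm (c n))" for x
  proof -
    have "norm (Q x) \<le> (\<Sum>\<^sub>\<infinity>n. norm (c n * trig \<alpha> n x))"
      unfolding Q_def by (rule norm_infsum_bound) (use summ in \<open>simp add: norm_mult c_def\<close>)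
    thus ?thesis by (simp add: norm_mult)
  qed
  have h_int: "integrable lborel h"
  proof (rule Bochner_Integration.integrable_bound)
    show "integrable lborel (\<lambda>t. C * (1 / (1 + t\<^sup>2)))"
      by (intro integrable_mult_right integrable_inverse_one_plus_square)
    show "AE t in lborel. norm (h t) \<le> norm (C * (1 / (1 + t\<^sup>2)))"
      using decay C by (intro AE_I2) (auto simp: add_nonneg_nonneg)
  qed simp
  have coeffP: "(\<integral>t. P t * trig \<alpha> (- n) t \<partial>?M) = c n" for n
  proof -
    define f where "f = (\<lambda>t. h t * trig \<alpha> (- n) t)"
    have f_int: "integrable lborel f"
      unfolding f_def by (rule Bochner_Integration.integrable_bound[OF h_int]) (auto simp: norm_mult)
    have f_eq: "f (t + of_int k * \<alpha>) = h (t + of_int k * \<alpha>) * trig \<alpha> (- n) t" for t k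
      using \<alpha> by (simp add: f_def trig_add_period)
    have "((\<lambda>k. \<integral>t. f (t + of_int k * \<alpha>) \<partial>?M) has_sum (\<integral>t. P t * trig \<alpha> (- n) t \<partial>?M)) UNIV"
    proof (rule has_sum_integral_interval[where B = "B \<alpha>"])
      show "norm (f (t + of_int k * \<alpha>)) \<le> B \<alpha> k" if "t \<in> {0..<\<alpha>}" for k t
        using that hB[of t \<alpha> k] by (simp add: f_eq norm_mult)
      show "((\<lambda>k. f (t + of_int k * \<alpha>)) has_sum P t * trig \<alpha> (- n) t) UNIV" for t
        unfolding f_eq by (intro has_sum_cmult_left P_sum)
      show "(\<lambda>t. f (t + of_int k * \<alpha>)) \<in> borel_measurable ?M" for k
        unfolding f_def by (rule measurable_interval_measure) measurable
      show "(\<lambda>t. P t * trig \<alpha> (- n) t) \<in> borel_measurable ?M"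
        by (rule measurable_interval_measure) measurable
    qed (use \<alpha> B in auto)
    hence "(\<lambda>N. \<Sum>k\<in>{- int N..int N}. \<integral>t. f (t + of_int k * \<alpha>) \<partial>?M) \<longlonglongrightarrow> (\<integral>t. P t * trig \<alpha> (- n) t \<partial>?M)"
      unfolding has_sum_def by (rule filterlim_compose[OF _ filterlim_int_intervals])
    from LIMSEQ_unique[OF this integral_tiles_tendsto[OF \<alpha> f_int]]
    show ?thesis by (simp add: f_def c_def fourier_integral_def trig_def)
  qed
  have coeffQ: "(\<integral>t. Q t * trig \<alpha> (- n) t \<partial>?M) = of_real \<alpha> * c n" for n
  proof -
    have "((\<lambda>m. \<integral>t. c m * trig \<alpha> m t * trig \<alpha> (- n) t \<partial>?M) has_sum (\<integral>t. Q t * trig \<alpha> (- n) t \<partial>?M)) UNIV"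
    proof (rule has_sum_integral_interval[where B = "\<lambda>n. norm (c n)"])
      show "((\<lambda>m. c m * trig \<alpha> m t * trig \<alpha> (- n) t) has_sum Q t * trig \<alpha> (- n) t) UNIV" for t
        by (intro has_sum_cmult_left Q_sum)
      show "(\<lambda>t. c m * trig \<alpha> m t * trig \<alpha> (- n) t) \<in> borel_measurable ?M" for m
        by (rule measurable_interval_measure) measurable
      show "(\<lambda>t. Q t * trig \<alpha> (- n) t) \<in> borel_measurable ?M"
        by (rule measurable_interval_measure) measurable
    qed (use \<alpha> summ in \<open>auto simp: norm_mult c_def\<close>)
    also have "(\<lambda>m. \<integral>t. c m * trig \<alpha> m t * trig \<alpha> (- n) t \<partial>?M) = (\<lambda>m. if m = n then of_real \<alpha> * c n else 0)"
      by (auto simp: mult.assoc trig_mult integral_trig[OF \<alpha>])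
    finally have "((\<lambda>m. if m = n then of_real \<alpha> * c n else 0) has_sum (\<integral>t. Q t * trig \<alpha> (- n) t \<partial>?M)) UNIV" .
    moreover have "((\<lambda>m. if m = n then of_real \<alpha> * c n else 0) has_sum (of_real \<alpha> * c n)) UNIV"
      by (rule has_sum_finite_neutralI[of "{n}"]) auto
    ultimately show ?thesis by (rule has_sum_unique)
  qed
  define u where "u = (\<lambda>x. of_real \<alpha> * P x - Q x)"
  have sqP: "square_integrable \<alpha> (\<lambda>x. of_real \<alpha> * P x)"
    by (rule square_integrable_scale, rule square_integrable_bounded[OF _ _ P_bound])
       (use \<alpha> in \<open>auto intro!: measurable_interval_measure\<close>)
  have sqQ: "square_integrable \<alpha> Q"
    by (rule square_integrable_bounded[OF _ _ Q_bound]) (use \<alpha> in \<open>auto intro!: measurable_interval_measure\<close>)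
  have squ: "square_integrable \<alpha> u"
    unfolding u_def by (rule square_integrable_diff[OF sqP sqQ])
  have coeffu: "(\<integral>t. u t * trig \<alpha> (- n) t \<partial>?M) = 0" for n
  proof -
    have "(\<integral>t. u t * trig \<alpha> (- n) t \<partial>?M) =
        (\<integral>t. of_real \<alpha> * P t * trig \<alpha> (- n) t \<partial>?M) - (\<integral>t. Q t * trig \<alpha> (- n) t \<partial>?M)"
      unfolding u_def left_diff_distrib
      by (rule Bochner_Integration.integral_diff) (use \<alpha> in \<open>auto intro!: integrable_times_trig sqP sqQ\<close>)
    also have "\<dots> = 0" by (simp add: mult.assoc coeffP coeffQ)
    finally show ?thesis .
  qed
  have "((\<lambda>n. (norm (\<integral>t. u t * trig \<alpha> (- n) t \<partial>?M))\<^sup>2) has_sum 0) UNIV"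
    by (rule has_sum_0) (simp add: coeffu)
  hence "\<alpha> * (\<integral>t. (norm (u t))\<^sup>2 \<partial>?M) = 0"
    by (rule has_sum_unique[OF parseval_interval[OF \<alpha> squ]])
  hence u0: "u t = 0" if "t \<in> {0..<\<alpha>}" for t
    using \<alpha> that contP contQ by (intro continuous_zero_of_integral_zero[OF \<alpha>, of u]) (auto simp: u_def intro!: continuous_intros)
  define j where "j = \<lfloor>x / \<alpha>\<rfloor>"
  define y where "y = x - of_int j * \<alpha>"
  have y: "y \<in> {0..<\<alpha>}" using \<alpha> floor_divide_add_multiple[OF \<alpha>, of y j] by (simp add: y_def j_def)
  have x: "x = y + of_int j * \<alpha>" by (simp add: y_def)
  have "((\<lambda>k. h (y + of_int (k + j) * \<alpha>)) has_sum P x) UNIV"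
    using P_sum[of x] by (simp add: x algebra_simps)
  hence "((\<lambda>k. h (y + of_int k * \<alpha>)) has_sum P x) UNIV"
    by (simp only: has_sum_shift_int[of "\<lambda>k. h (y + of_int k * \<alpha>)"])
  hence "P x = P y" using P_sum[of y] by (rule has_sum_unique)
  moreover have "Q x = Q y" unfolding Q_def x using \<alpha> by (simp add: trig_add_period)
  ultimately have "of_real \<alpha> * P x = Q x" using u0[OF y] by (simp add: u_def)
  thus ?thesis using Q_sum[of x] by (simp add: P_def c_def)
qed

section \<open>Ambiguity functions and Gram sums\<close>

text \<open>
  The ambiguity function of \<open>g\<close>, i.e. its inner products with its own time-frequency shifts. The sign of
  the time shift and the phase factor are chosen for convenience; only the absolute value is used.
\<close>

definition ambiguity :: "(real \<Rightarrow> complex) \<Rightarrow> real \<Rightarrow> real \<Rightarrow> complex" where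
  "ambiguity g x \<omega> = fourier_integral (\<lambda>t. g t * cnj (g (t + x))) \<omega>"

text \<open>
  Continuity and quadratic decay of the window are all that the frame criterion below needs for the
  convergence of lattice sums.
\<close>

definition admissible_window :: "(real \<Rightarrow> complex) \<Rightarrow> bool" where
  "admissible_window g \<longleftrightarrow> continuous_on UNIV g \<and> (\<exists>C. \<forall>t. norm (g t) \<le> C / (1 + t\<^sup>2))"

lemma admissible_window_measurable: "admissible_window g \<Longrightarrow> g \<in> borel_measurable borel"
  by (auto simp: admissible_window_def intro: borel_measurable_continuous_onI)

lemma admissible_window_bounded:
  assumes "admissible_window g" obtains C where "\<And>t. norm (g t) \<le> C"
proof -
  obtain C where C: "\<And>t. norm (g t) \<le> C / (1 + t\<^sup>2)" using assms by (auto simp: admissible_window_def)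
  have "C \<ge> 0" using order_trans[OF norm_ge_zero C[of 0]] by simp
  have "norm (g t) \<le> C" for t
  proof -
    have "C / (1 + t\<^sup>2) \<le> C / 1" using \<open>C \<ge> 0\<close> by (intro divide_left_mono) (auto simp: add_pos_nonneg)
    thus ?thesis using C[of t] by simp
  qed
  thus ?thesis using that by blast
qed

lemma correlation_decay:
  assumes "admissible_window g"
  obtains C where "\<And>t. norm (cnj (g (t + a)) * g (t + b)) \<le> C / (1 + t\<^sup>2)"
proof -
  obtain C where C: "\<And>t. norm (g t) \<le> C / (1 + t\<^sup>2)" using assms by (auto simp: admissible_window_def)
  obtain C' where C': "\<And>t. norm (g t) \<le> C'" using admissible_window_bounded[OF assms] by blast
  have "C' \<ge> 0" using order_trans[OF norm_ge_zero C'] .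
  have "norm (cnj (g (t + a)) * g (t + b)) \<le> (C * (2 * (1 + \<bar>a\<bar>\<^sup>2)) * (1 / (1 + t\<^sup>2))) * C'" for t
    unfolding norm_mult complex_mod_cnj using \<open>C' \<ge> 0\<close> decay_lattice_bound[OF C, of a "\<bar>a\<bar>" t] C'[of "t + b"]
    by (intro mult_mono') (auto simp: add.commute)
  thus ?thesis using that[of "C * (2 * (1 + \<bar>a\<bar>\<^sup>2)) * C'"] by (simp add: mult_ac)
qed

lemma correlation_continuous:
  assumes "admissible_window g"
  shows "continuous_on UNIV (\<lambda>t. cnj (g (t + a)) * g (t + b))"
proof -
  have g: "continuous_on UNIV g" using assms by (simp add: admissible_window_def)
  show ?thesis by (intro continuous_intros continuous_on_compose2[OF g]) auto
qed

lemma fourier_integral_correlation: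
  "fourier_integral (\<lambda>t. cnj (g (t + a)) * g (t + b)) \<omega> = cis (2 * pi * \<omega> * b) * ambiguity g (a - b) \<omega>"
proof -
  let ?f = "\<lambda>t. cnj (g (t + a)) * g (t + b) * cis (- (2 * pi * \<omega> * t))"
  have "fourier_integral (\<lambda>t. cnj (g (t + a)) * g (t + b)) \<omega> = \<bar>1\<bar> *\<^sub>R (\<integral>t. ?f (- b + 1 * t) \<partial>lborel)"
    unfolding fourier_integral_def by (rule lborel_integral_real_affine) simp
  also have "\<dots> = (\<integral>t. cis (2 * pi * \<omega> * b) * (g t * cnj (g (t + (a - b))) * cis (- (2 * pi * \<omega> * t))) \<partial>lborel)"
    unfolding abs_one scaleR_one
  proof (rule Bochner_Integration.integral_cong[OF refl])
    fix t
    have "cis (- (2 * pi * \<omega> * (- b + 1 * t))) = cis (2 * pi * \<omega> * b) * cis (- (2 * pi * \<omega> * t))"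
      by (simp add: cis_mult algebra_simps)
    thus "?f (- b + 1 * t) = cis (2 * pi * \<omega> * b) * (g t * cnj (g (t + (a - b))) * cis (- (2 * pi * \<omega> * t)))"
      by (simp add: algebra_simps)
  qed
  finally show ?thesis by (simp add: ambiguity_def fourier_integral_def)
qed

lemma ambiguity_0_0: "ambiguity g 0 0 = of_real (norm (ambiguity g 0 0))"
proof -
  have "ambiguity g 0 0 = (\<integral>t. complex_of_real ((norm (g t))\<^sup>2) \<partial>lborel)"
    by (simp add: ambiguity_def fourier_integral_def complex_norm_square del: of_real_power)
  also have "\<dots> = of_real (\<integral>t. (norm (g t))\<^sup>2 \<partial>lborel)" by (rule integral_complex_of_real)
  finally show ?thesis by (simp add: abs_of_nonneg)
qed

lemma has_sum_diff:
  fixes f g :: "'a \<Rightarrow> 'b::real_normed_vector"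
  assumes "(f has_sum a) A" "(g has_sum b) A"
  shows "((\<lambda>x. f x - g x) has_sum (a - b)) A"
proof -
  have "((\<lambda>x. - g x) has_sum (- b)) A" using assms(2) by (simp add: has_sum_uminus)
  from has_sum_add[OF assms(1) this] show ?thesis by simp
qed

text \<open>
  The Gram sums \<open>G\<close> of two translates of the window along the lattice \<open>\<alpha> \<int>\<close>. By Poisson summation
  they are Fourier series whose coefficients are values of the ambiguity function; on the diagonal the constant
  term is the energy of the window.
\<close>

lemma
  fixes \<alpha> a b x :: real
  assumes \<alpha>: "\<alpha> > 0" and g: "admissible_window g"
    and summ: "(\<lambda>n::int. norm (ambiguity g (a - b) (of_int n / \<alpha>))) summable_on UNIV"
  defines "G \<equiv> \<Sum>\<^sub>\<infinity>k::int. cnj (g (x + of_int k * \<alpha> + a)) * g (x + of_int k * \<alpha> + b)"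
    and "R \<equiv> \<Sum>\<^sub>\<infinity>n::int. norm (ambiguity g (a - b) (of_int n / \<alpha>))"
  shows norm_gram_le: "norm (of_real \<alpha> * G) \<le> R"
    and norm_gram_diag_le: "a = b \<Longrightarrow> norm (of_real \<alpha> * G - norm (ambiguity g 0 0)) \<le> R - norm (ambiguity g 0 0)"
proof -
  define h where "h = (\<lambda>t. cnj (g (t + a)) * g (t + b))"
  obtain C where C: "\<And>t. norm (h t) \<le> C / (1 + t\<^sup>2)"
    unfolding h_def using correlation_decay[OF g, of a b] by blast
  define f where "f = (\<lambda>n. fourier_integral h (of_int n / \<alpha>) * trig \<alpha> n x)"
  have norm_h: "norm (fourier_integral h \<omega>) = norm (ambiguity g (a - b) \<omega>)" for \<omega>
    unfolding h_def by (simp add: fourier_integral_correlation norm_mult)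
  have norm_f: "norm (f n) = norm (ambiguity g (a - b) (of_int n / \<alpha>))" for n
    by (simp add: f_def norm_mult norm_h)
  have f: "(f has_sum (of_real \<alpha> * G)) UNIV"
  proof -
    have "continuous_on UNIV h" unfolding h_def by (rule correlation_continuous[OF g])
    moreover have "(\<lambda>n::int. norm (fourier_integral h (of_int n / \<alpha>))) summable_on UNIV"
      using summ by (simp only: norm_h)
    ultimately show ?thesis
      using poisson_summation[OF \<alpha> _ C, of x] by (simp add: f_def G_def h_def)
  qed
  have R: "((\<lambda>n. norm (f n)) has_sum R) UNIV"
    unfolding norm_f R_def by (rule has_sum_infsum[OF summ])
  show "norm (of_real \<alpha> * G) \<le> R"
    by (rule norm_has_sum_bound[OF R f])
  show "norm (of_real \<alpha> * G - norm (ambiguity g 0 0)) \<le> R - norm (ambiguity g 0 0)" if "a = b"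
  proof -
    have f0: "f 0 = of_real (norm (ambiguity g 0 0))"
      using that by (simp add: f_def h_def fourier_integral_correlation ambiguity_0_0[symmetric])
    define f' where "f' = (\<lambda>n. f n - (if n = 0 then f 0 else 0))"
    have "((\<lambda>n. if n = 0 then f 0 else 0) has_sum f 0) (UNIV :: int set)"
      by (rule has_sum_finite_neutralI[of "{0}"]) auto
    hence f': "(f' has_sum (of_real \<alpha> * G - f 0)) UNIV"
      unfolding f'_def by (intro has_sum_diff f)
    have "((\<lambda>n. if n = 0 then norm (f 0) else 0) has_sum norm (f 0)) (UNIV :: int set)"
      by (rule has_sum_finite_neutralI[of "{0}"]) auto
    hence "((\<lambda>n. norm (f n) - (if n = 0 then norm (f 0) else 0)) has_sum (R - norm (f 0))) UNIV"
      by (intro has_sum_diff R)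
    also have "(\<lambda>n. norm (f n) - (if n = 0 then norm (f 0) else 0)) = (\<lambda>n. norm (f' n))"
      by (auto simp: f'_def)
    finally have "((\<lambda>n. norm (f' n)) has_sum (R - norm (f 0))) UNIV" .
    hence "norm (of_real \<alpha> * G - f 0) \<le> R - norm (f 0)"
      using f' by (rule norm_has_sum_bound)
    thus ?thesis by (simp add: f0)
  qed
qed

text \<open>
  Schur's test for a matrix that is dominated by a summable convolution kernel.
\<close>

lemma schur_test:
  fixes E :: "int \<Rightarrow> int \<Rightarrow> complex"
  assumes J: "finite J" and E: "\<And>i j. norm (E i j) \<le> \<epsilon> (i - j)" and sum: "(\<epsilon> has_sum \<delta>) UNIV"
  shows "norm (\<Sum>i\<in>J. \<Sum>j\<in>J. a i * cnj (a j) * E i j) \<le> \<delta> * (\<Sum>j\<in>J. (norm (a j))\<^sup>2)"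
proof -
  have \<epsilon>0: "\<epsilon> m \<ge> 0" for m using order_trans[OF norm_ge_zero E[of m 0]] by simp
  have fin: "(\<Sum>m\<in>F. \<epsilon> m) \<le> \<delta>" if "finite F" for F
    using finite_sum_le_infsum[OF has_sum_imp_summable[OF sum] that] sum \<epsilon>0 by (auto simp: has_sum_iff)
  have row: "(\<Sum>j\<in>J. \<epsilon> (i - j)) \<le> \<delta>" for i
  proof -
    have "(\<Sum>j\<in>J. \<epsilon> (i - j)) = (\<Sum>m\<in>(\<lambda>j. i - j) ` J. \<epsilon> m)"
      by (subst sum.reindex) (auto simp: inj_on_def)
    thus ?thesis using fin[of "(\<lambda>j. i - j) ` J"] J by simp
  qed
  have col: "(\<Sum>i\<in>J. \<epsilon> (i - j)) \<le> \<delta>" for j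
  proof -
    have "(\<Sum>i\<in>J. \<epsilon> (i - j)) = (\<Sum>m\<in>(\<lambda>i. i - j) ` J. \<epsilon> m)"
      by (subst sum.reindex) (auto simp: inj_on_def)
    thus ?thesis using fin[of "(\<lambda>i. i - j) ` J"] J by simp
  qed
  have "norm (\<Sum>i\<in>J. \<Sum>j\<in>J. a i * cnj (a j) * E i j) \<le>
      (\<Sum>i\<in>J. \<Sum>j\<in>J. (norm (a i))\<^sup>2 / 2 * \<epsilon> (i - j) + (norm (a j))\<^sup>2 / 2 * \<epsilon> (i - j))"
  proof (intro sum_norm_le)
    fix i j
    have "norm (a i * cnj (a j) * E i j) \<le> (norm (a i) * norm (a j)) * \<epsilon> (i - j)"
      unfolding norm_mult complex_mod_cnj by (intro mult_left_mono E) auto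
    also have "\<dots> \<le> ((norm (a i))\<^sup>2 / 2 + (norm (a j))\<^sup>2 / 2) * \<epsilon> (i - j)"
      using sum_squares_bound[of "norm (a i)" "norm (a j)"] by (intro mult_right_mono \<epsilon>0) (simp add: field_simps)
    finally show "norm (a i * cnj (a j) * E i j) \<le> (norm (a i))\<^sup>2 / 2 * \<epsilon> (i - j) + (norm (a j))\<^sup>2 / 2 * \<epsilon> (i - j)"
      by (simp add: ring_distribs)
  qed
  also have "\<dots> = (\<Sum>i\<in>J. (norm (a i))\<^sup>2 / 2 * (\<Sum>j\<in>J. \<epsilon> (i - j))) + (\<Sum>j\<in>J. (norm (a j))\<^sup>2 / 2 * (\<Sum>i\<in>J. \<epsilon> (i - j)))"
  proof -
    have "(\<Sum>i\<in>J. \<Sum>j\<in>J. (norm (a j))\<^sup>2 / 2 * \<epsilon> (i - j)) = (\<Sum>j\<in>J. \<Sum>i\<in>J. (norm (a j))\<^sup>2 / 2 * \<epsilon> (i - j))"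
      by (rule sum.swap)
    thus ?thesis by (simp only: sum.distrib sum_distrib_left)
  qed
  also have "\<dots> \<le> (\<Sum>i\<in>J. (norm (a i))\<^sup>2 / 2 * \<delta>) + (\<Sum>j\<in>J. (norm (a j))\<^sup>2 / 2 * \<delta>)"
    by (intro add_mono sum_mono mult_left_mono row col) auto
  also have "\<dots> = \<delta> * (\<Sum>j\<in>J. (norm (a j))\<^sup>2)"
    by (simp add: sum.distrib[symmetric] sum_distrib_left mult.commute)
  finally show ?thesis .
qed

lemma has_sum_finite_sum:
  fixes f :: "'a \<Rightarrow> 'b \<Rightarrow> 'c::topological_comm_monoid_add"
  assumes "\<And>i. i \<in> I \<Longrightarrow> (f i has_sum S i) A"
  shows "((\<lambda>x. \<Sum>i\<in>I. f i x) has_sum (\<Sum>i\<in>I. S i)) A"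
  using assms by (induction I rule: infinite_finite_induct) (auto intro!: has_sum_add)

text \<open>
  \<open>S\<close> is the sum of the absolute values of the ambiguity function over the lattice
  \<open>T \<int> \<times> \<alpha>\<^sup>-\<^sup>1 \<int>\<close>. For \<open>T = 1 / \<beta>\<close> this is the adjoint lattice of
  \<open>\<alpha> \<int> \<times> \<beta> \<int>\<close>. The sum includes the origin.
\<close>

definition janssen_sum :: "(real \<Rightarrow> complex) \<Rightarrow> real \<Rightarrow> real \<Rightarrow> real \<Rightarrow> bool" where
  "janssen_sum g \<alpha> T S \<longleftrightarrow>
     ((\<lambda>(m, n). norm (ambiguity g (of_int m * T) (of_int n / \<alpha>))) has_sum S) (UNIV :: (int \<times> int) set)"

text \<open>
  At each point \<open>x\<close> the infinite matrix with entries \<open>g (x + j T + k \<alpha>)\<close> has a Gram matrix that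
  differs from the multiple \<open>A / \<alpha>\<close> of the identity by an operator of norm at most \<open>(S - A) / \<alpha>\<close>.
\<close>

lemma gram_bounds:
  fixes a :: "int \<Rightarrow> complex"
  assumes \<alpha>: "\<alpha> > 0" and g: "admissible_window g" and S: "janssen_sum g \<alpha> T S" and J: "finite J"
  defines "A \<equiv> norm (ambiguity g 0 0)"
  obtains Q where "((\<lambda>k::int. (norm (\<Sum>j\<in>J. a j * cnj (g (x + of_int j * T + of_int k * \<alpha>))))\<^sup>2) has_sum Q) UNIV"
    and "(2 * A - S) * (\<Sum>j\<in>J. (norm (a j))\<^sup>2) \<le> \<alpha> * Q" and "\<alpha> * Q \<le> S * (\<Sum>j\<in>J. (norm (a j))\<^sup>2)"
proof -
  define \<sigma> where "\<sigma> = (\<lambda>m::int. \<Sum>\<^sub>\<infinity>n::int. norm (ambiguity g (of_int m * T) (of_int n / \<alpha>)))"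
  have S': "((\<lambda>(m, n). norm (ambiguity g (of_int m * T) (of_int n / \<alpha>))) has_sum S) (Sigma (UNIV :: int set) (\<lambda>_. UNIV :: int set))"
    using S unfolding janssen_sum_def by (simp add: UNIV_Times_UNIV)
  have summ: "(\<lambda>n::int. norm (ambiguity g (of_int m * T) (of_int n / \<alpha>))) summable_on UNIV" for m :: int
    using summable_on_SigmaD1[OF has_sum_imp_summable[OF S'], of m] by simp
  have \<sigma>: "(\<sigma> has_sum S) UNIV"
    by (rule has_sum_SigmaD[OF S']) (auto simp: \<sigma>_def intro!: has_sum_infsum summ)
  define \<epsilon> where "\<epsilon> = (\<lambda>m. \<sigma> m - (if m = 0 then A else 0))"
  have "((\<lambda>m. if m = 0 then A else 0) has_sum A) (UNIV :: int set)"
    by (rule has_sum_finite_neutralI[of "{0}"]) auto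
  hence \<epsilon>: "(\<epsilon> has_sum (S - A)) UNIV"
    unfolding \<epsilon>_def by (intro has_sum_diff \<sigma>)
  define G where "G = (\<lambda>i j. \<Sum>\<^sub>\<infinity>k::int. cnj (g (x + of_int k * \<alpha> + of_int i * T)) * g (x + of_int k * \<alpha> + of_int j * T))"
  define E where "E = (\<lambda>i j. of_real \<alpha> * G i j - (if i = j then of_real A else 0))"
  have norm_E: "norm (E i j) \<le> \<epsilon> (i - j)" for i j
  proof -
    have eq: "of_int i * T - of_int j * T = of_int (i - j) * T" by (simp add: algebra_simps)
    note summ' = summ[of "i - j", folded eq]
    show ?thesis
    proof (cases "i = j")
      case True
      thus ?thesis using norm_gram_diag_le[OF \<alpha> g summ', of x]
        by (simp add: E_def \<epsilon>_def G_def \<sigma>_def A_def)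
    next
      case False
      thus ?thesis using norm_gram_le[OF \<alpha> g summ', of x]
        by (simp add: E_def \<epsilon>_def G_def \<sigma>_def eq)
    qed
  qed
  have G: "((\<lambda>k::int. cnj (g (x + of_int k * \<alpha> + of_int i * T)) * g (x + of_int k * \<alpha> + of_int j * T)) has_sum G i j) UNIV" for i j
  proof -
    obtain C where "\<And>t. norm (cnj (g (t + of_int i * T)) * g (t + of_int j * T)) \<le> C / (1 + t\<^sup>2)"
      using correlation_decay[OF g, of "of_int i * T" "of_int j * T"] by blast
    from decay_lattice_summable[OF \<alpha> this, of x] show ?thesis
      unfolding G_def by (intro has_sum_infsum) (rule abs_summable_summable)
  qed
  define N where "N = (\<Sum>j\<in>J. (norm (a j))\<^sup>2)"
  define q where "q = (\<Sum>i\<in>J. \<Sum>j\<in>J. a i * cnj (a j) * G i j)"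
  have "((\<lambda>k. \<Sum>i\<in>J. \<Sum>j\<in>J. a i * cnj (a j) * (cnj (g (x + of_int k * \<alpha> + of_int i * T)) * g (x + of_int k * \<alpha> + of_int j * T)))
      has_sum q) UNIV"
    unfolding q_def by (intro has_sum_finite_sum has_sum_cmult_right G)
  also have "(\<lambda>k. \<Sum>i\<in>J. \<Sum>j\<in>J. a i * cnj (a j) * (cnj (g (x + of_int k * \<alpha> + of_int i * T)) * g (x + of_int k * \<alpha> + of_int j * T))) =
      (\<lambda>k. of_real ((norm (\<Sum>j\<in>J. a j * cnj (g (x + of_int j * T + of_int k * \<alpha>))))\<^sup>2))"
  proof
    fix k
    have "complex_of_real ((norm (\<Sum>j\<in>J. a j * cnj (g (x + of_int j * T + of_int k * \<alpha>))))\<^sup>2) =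
      (\<Sum>i\<in>J. a i * cnj (g (x + of_int i * T + of_int k * \<alpha>))) * (\<Sum>j\<in>J. cnj (a j) * g (x + of_int j * T + of_int k * \<alpha>))"
      unfolding complex_norm_square by simp
    also have "\<dots> = (\<Sum>i\<in>J. \<Sum>j\<in>J. a i * cnj (a j) * (cnj (g (x + of_int k * \<alpha> + of_int i * T)) * g (x + of_int k * \<alpha> + of_int j * T)))"
      unfolding sum_product by (intro sum.cong refl) (simp add: add.commute add.left_commute)
    finally show "(\<Sum>i\<in>J. \<Sum>j\<in>J. a i * cnj (a j) * (cnj (g (x + of_int k * \<alpha> + of_int i * T)) * g (x + of_int k * \<alpha> + of_int j * T))) =
      complex_of_real ((norm (\<Sum>j\<in>J. a j * cnj (g (x + of_int j * T + of_int k * \<alpha>))))\<^sup>2)" by simp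
  qed
  finally have "((\<lambda>k. complex_of_real ((norm (\<Sum>j\<in>J. a j * cnj (g (x + of_int j * T + of_int k * \<alpha>))))\<^sup>2)) has_sum q) UNIV" .
  from has_sum_Re[OF this]
  have Q: "((\<lambda>k. (norm (\<Sum>j\<in>J. a j * cnj (g (x + of_int j * T + of_int k * \<alpha>))))\<^sup>2) has_sum Re q) UNIV"
    by (simp only: Re_complex_of_real)
  have "of_real \<alpha> * q - of_real (A * N) = (\<Sum>i\<in>J. \<Sum>j\<in>J. a i * cnj (a j) * E i j)"
  proof -
    have "(\<Sum>i\<in>J. \<Sum>j\<in>J. a i * cnj (a j) * E i j) =
       (\<Sum>i\<in>J. \<Sum>j\<in>J. of_real \<alpha> * (a i * cnj (a j) * G i j)) - (\<Sum>i\<in>J. \<Sum>j\<in>J. if j = i then of_real A * (a i * cnj (a j)) else 0)"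
      unfolding sum_subtractf[symmetric] by (intro sum.cong refl) (simp add: E_def algebra_simps)
    also have "(\<Sum>i\<in>J. \<Sum>j\<in>J. if j = i then of_real A * (a i * cnj (a j)) else 0) = (\<Sum>i\<in>J. of_real A * (a i * cnj (a i)))"
      using J by (intro sum.cong refl) simp
    also have "\<dots> = of_real (A * N)"
      by (simp only: complex_norm_square[symmetric] N_def of_real_mult of_real_sum sum_distrib_left)
    finally show ?thesis by (simp add: q_def sum_distrib_left)
  qed
  hence "norm (of_real \<alpha> * q - of_real (A * N)) \<le> (S - A) * N"
    using schur_test[OF J norm_E \<epsilon>, of a] by (simp add: N_def)
  hence "\<bar>\<alpha> * Re q - A * N\<bar> \<le> (S - A) * N"
    using abs_Re_le_cmod[of "of_real \<alpha> * q - of_real (A * N)"] by simp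
  hence "(2 * A - S) * N \<le> \<alpha> * Re q" "\<alpha> * Re q \<le> S * N"
    by (auto simp: abs_le_iff algebra_simps)
  thus ?thesis using that[OF Q] by (simp add: N_def)
qed

section \<open>A sufficient condition for Gabor frames\<close>

lemma borel_measurable_cnj [measurable (raw)]:
  "f \<in> borel_measurable M \<Longrightarrow> (\<lambda>x. cnj (f x)) \<in> borel_measurable M"
  by (rule measurable_compose[OF _ borel_measurable_continuous_onI]) (auto intro: continuous_intros)

lemma borel_measurable_truncation:
  fixes f :: "real \<Rightarrow> complex"
  assumes "f \<in> borel_measurable borel"
  shows "(\<lambda>t. indicator {t. \<lfloor>t / T\<rfloor> \<in> J} t *\<^sub>R f t) \<in> borel_measurable borel"
proof (rule borel_measurable_scaleR[OF borel_measurable_indicator assms])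
  have "(\<lambda>t::real. \<lfloor>t / T\<rfloor>) \<in> borel \<rightarrow>\<^sub>M count_space UNIV" by measurable
  from measurable_sets[OF this, of J] show "{t. \<lfloor>t / T\<rfloor> \<in> J} \<in> sets borel" by (simp add: vimage_def)
qed

text \<open>
  The inner product of \<open>f\<close> with the shift of \<open>g\<close> by \<open>- k \<alpha>\<close> in time and \<open>l / T\<close> in
  frequency.
\<close>

definition gabor_coeff :: "(real \<Rightarrow> complex) \<Rightarrow> real \<Rightarrow> real \<Rightarrow> (real \<Rightarrow> complex) \<Rightarrow> int \<times> int \<Rightarrow> complex" where
  "gabor_coeff g \<alpha> T f = (\<lambda>(k, l). \<integral>t. f t * cnj (g (t + of_int k * \<alpha>)) * trig T (- l) t \<partial>lborel)"

lemma integrable_product_of_squares: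
  fixes f g :: "'a \<Rightarrow> complex"
  assumes [measurable]: "f \<in> borel_measurable M" "g \<in> borel_measurable M"
    and "integrable M (\<lambda>t. (norm (f t))\<^sup>2)" "integrable M (\<lambda>t. (norm (g t))\<^sup>2)"
  shows "integrable M (\<lambda>t. f t * g t)"
proof (rule Bochner_Integration.integrable_bound)
  show "integrable M (\<lambda>t. (norm (f t))\<^sup>2 + (norm (g t))\<^sup>2)" using assms by simp
  have "norm (f t * g t) \<le> (norm (f t))\<^sup>2 + (norm (g t))\<^sup>2" for t
    using sum_squares_bound[of "norm (f t)" "norm (g t)"] mult_nonneg_nonneg[OF norm_ge_zero norm_ge_zero, of "f t" "g t"]
    unfolding norm_mult by linarith
  thus "AE t in M. norm (f t * g t) \<le> norm ((norm (f t))\<^sup>2 + (norm (g t))\<^sup>2)"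
    by (intro AE_I2) simp
qed measurable

lemma window_square_integrable:
  assumes "admissible_window g"
  shows "integrable lborel (\<lambda>t. (norm (g (t + a)))\<^sup>2)"
proof -
  note [measurable] = admissible_window_measurable[OF assms]
  obtain C where C: "\<And>t. norm (cnj (g (t + a)) * g (t + a)) \<le> C / (1 + t\<^sup>2)"
    using correlation_decay[OF assms, of a a] by blast
  show ?thesis
  proof (rule Bochner_Integration.integrable_bound)
    show "integrable lborel (\<lambda>t. C * (1 / (1 + t\<^sup>2)))"
      by (intro integrable_mult_right integrable_inverse_one_plus_square)
    show "AE t in lborel. norm ((norm (g (t + a)))\<^sup>2) \<le> norm (C * (1 / (1 + t\<^sup>2)))"
    proof (rule AE_I2)
      fix t
      have "(norm (g (t + a)))\<^sup>2 \<le> C / (1 + t\<^sup>2)" using C[of t] by (simp add: norm_mult power2_eq_square)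
      thus "norm ((norm (g (t + a)))\<^sup>2) \<le> norm (C * (1 / (1 + t\<^sup>2)))"
        using abs_ge_self[of "C / (1 + t\<^sup>2)"] by simp
    qed
  qed measurable
qed

lemma gabor_coeff_integrable:
  assumes g: "admissible_window g" and f: "f \<in> borel_measurable borel" "integrable lborel (\<lambda>t. (norm (f t))\<^sup>2)"
  shows "integrable lborel (\<lambda>t. f t * cnj (g (t + a)) * trig T l t)"
proof -
  note [measurable] = admissible_window_measurable[OF g] f(1)
  have "integrable lborel (\<lambda>t. f t * (cnj (g (t + a)) * trig T l t))"
    by (rule integrable_product_of_squares) (use f(2) window_square_integrable[OF g, of a] in \<open>simp_all add: norm_mult\<close>)
  thus ?thesis by (simp add: mult.assoc)
qed

text \<open>
  For a function that lives on finitely many tiles, the coefficients with fixed \<open>k\<close> are the Fourier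
  coefficients of the periodisation of \<open>f\<close> times the translated window. Parseval's identity turns their square
  sum into an integral over one period, and the sum over \<open>k\<close> can then be bounded pointwise by the Gram
  estimate, with the values of \<open>f\<close> on the tiles as vector.
\<close>

lemma gabor_bounds_compact_support:
  assumes \<alpha>: "\<alpha> > 0" and T: "T > 0" and g: "admissible_window g" and S: "janssen_sum g \<alpha> T S"
    and f: "f \<in> borel_measurable borel" "integrable lborel (\<lambda>t. (norm (f t))\<^sup>2)"
    and J: "finite J" and supp: "\<And>t. \<lfloor>t / T\<rfloor> \<notin> J \<Longrightarrow> f t = 0"
  defines "A \<equiv> norm (ambiguity g 0 0)" and "N \<equiv> (\<integral>t. (norm (f t))\<^sup>2 \<partial>lborel)"
  obtains Q where "((\<lambda>p. (norm (gabor_coeff g \<alpha> T f p))\<^sup>2) has_sum Q) UNIV"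
    and "T * (2 * A - S) / \<alpha> * N \<le> Q" and "Q \<le> T * S / \<alpha> * N"
proof -
  let ?M = "interval_measure T"
  note [measurable] = admissible_window_measurable[OF g] f(1)
  define u where "u = (\<lambda>k t. \<Sum>j\<in>J. f (t + of_int j * T) * cnj (g (t + of_int j * T + of_int k * \<alpha>)))" for k :: int
  define w where "w = (\<lambda>t. \<Sum>j\<in>J. (norm (f (t + of_int j * T)))\<^sup>2)"
  define q where "q = (\<lambda>t. \<Sum>\<^sub>\<infinity>k. (norm (u k t))\<^sup>2)"
  have gram: "((\<lambda>k. (norm (u k t))\<^sup>2) has_sum q t) UNIV"
      "(2 * A - S) / \<alpha> * w t \<le> q t" "q t \<le> S / \<alpha> * w t" for t
  proof -
    obtain Q where Q: "((\<lambda>k. (norm (u k t))\<^sup>2) has_sum Q) UNIV" "(2 * A - S) * w t \<le> \<alpha> * Q" "\<alpha> * Q \<le> S * w t"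
      using gram_bounds[OF \<alpha> g S J, of "\<lambda>j. f (t + of_int j * T)" t] unfolding u_def w_def A_def by blast
    have "q t = Q" unfolding q_def using Q(1) by (rule infsumI)
    thus "((\<lambda>k. (norm (u k t))\<^sup>2) has_sum q t) UNIV"
      "(2 * A - S) / \<alpha> * w t \<le> q t" "q t \<le> S / \<alpha> * w t" using Q \<alpha> by (auto simp: field_simps)
  qed
  have u_le: "(norm (u k t))\<^sup>2 \<le> S / \<alpha> * w t" for k t
    using finite_sum_le_has_sum[OF gram(1), of "{k}" t] gram(3)[of t] by simp
  have w_int: "integrable ?M w" and w_eq: "(\<integral>t. w t \<partial>?M) = N"
  proof -
    show "integrable ?M w" unfolding w_def
      by (intro Bochner_Integration.integrable_sum) (rule integrable_tile[OF T f(2)])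
    have "(\<integral>t. w t \<partial>?M) = (\<Sum>j\<in>J. \<integral>t. (norm (f (t + of_int j * T)))\<^sup>2 \<partial>?M)"
      unfolding w_def by (intro Bochner_Integration.integral_sum integrable_tile[OF T f(2)])
    also have "\<dots> = (\<integral>t. indicator {t. \<lfloor>t / T\<rfloor> \<in> J} t *\<^sub>R (norm (f t))\<^sup>2 \<partial>lborel)"
      by (rule integral_tiles[OF T f(2) J])
    also have "\<dots> = N"
      unfolding N_def using supp by (intro Bochner_Integration.integral_cong) (auto simp: indicator_def)
    finally show "(\<integral>t. w t \<partial>?M) = N" .
  qed
  have u_meas [measurable]: "u k \<in> borel_measurable ?M" for k
    unfolding u_def by (rule measurable_interval_measure) measurable
  have u_int: "integrable ?M (\<lambda>t. (norm (u k t))\<^sup>2)" for k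
  proof (rule Bochner_Integration.integrable_bound)
    show "integrable ?M (\<lambda>t. S / \<alpha> * w t)" using w_int by simp
    show "AE t in ?M. norm ((norm (u k t))\<^sup>2) \<le> norm (S / \<alpha> * w t)"
      unfolding real_norm_def abs_of_nonneg[OF zero_le_power2] by (intro AE_I2 order_trans[OF u_le abs_ge_self])
  qed measurable
  have u_sq: "square_integrable T (u k)" for k
    using u_int by (simp add: square_integrable_def)
  have coeff: "(\<integral>t. u k t * trig T (- l) t \<partial>?M) = gabor_coeff g \<alpha> T f (k, l)" for k l
  proof -
    define F where "F = (\<lambda>t. f t * cnj (g (t + of_int k * \<alpha>)) * trig T (- l) t)"
    have F: "integrable lborel F" unfolding F_def by (rule gabor_coeff_integrable[OF g f])
    have "(\<integral>t. u k t * trig T (- l) t \<partial>?M) = (\<integral>t. (\<Sum>j\<in>J. F (t + of_int j * T)) \<partial>?M)"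
      unfolding u_def F_def using T by (simp add: trig_add_period sum_distrib_right)
    also have "\<dots> = (\<Sum>j\<in>J. \<integral>t. F (t + of_int j * T) \<partial>?M)"
      by (intro Bochner_Integration.integral_sum integrable_tile[OF T F])
    also have "\<dots> = (\<integral>t. indicator {t. \<lfloor>t / T\<rfloor> \<in> J} t *\<^sub>R F t \<partial>lborel)"
      by (rule integral_tiles[OF T F J])
    also have "\<dots> = (\<integral>t. F t \<partial>lborel)"
      using supp by (intro Bochner_Integration.integral_cong) (auto simp: indicator_def F_def)
    finally show ?thesis by (simp add: gabor_coeff_def F_def)
  qed
  define v where "v = (\<lambda>k. \<integral>t. (norm (u k t))\<^sup>2 \<partial>?M)"
  have rows: "((\<lambda>l. (norm (gabor_coeff g \<alpha> T f (k, l)))\<^sup>2) has_sum (T * v k)) UNIV" for k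
    using parseval_interval[OF T u_sq[of k]] by (simp add: coeff v_def)
  have v_sum: "(\<Sum>k\<in>K. v k) = (\<integral>t. (\<Sum>k\<in>K. (norm (u k t))\<^sup>2) \<partial>?M)" for K
    unfolding v_def by (subst Bochner_Integration.integral_sum) (auto intro: u_int)
  have fin_le: "(\<Sum>k\<in>K. (norm (u k t))\<^sup>2) \<le> S / \<alpha> * w t" if "finite K" for K t
    using finite_sum_le_has_sum[OF gram(1) that, of t] gram(3)[of t] by simp
  have "v summable_on UNIV"
  proof (rule nonneg_bdd_above_summable_on)
    show "bdd_above (sum v ` {F. F \<subseteq> UNIV \<and> finite F})"
    proof (rule bdd_aboveI2)
      fix K :: "int set" assume "K \<in> {F. F \<subseteq> UNIV \<and> finite F}"
      hence "sum v K \<le> (\<integral>t. S / \<alpha> * w t \<partial>?M)"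
        unfolding v_sum by (intro integral_mono fin_le Bochner_Integration.integrable_sum u_int integrable_mult_right w_int) auto
      thus "sum v K \<le> S / \<alpha> * N" by (simp add: w_eq)
    qed
  qed (simp add: v_def)
  then obtain V where V: "(v has_sum V) UNIV" by (auto simp: summable_on_def)
  have conv: "(\<lambda>n. \<Sum>k\<in>{- int n..int n}. (norm (u k t))\<^sup>2) \<longlonglongrightarrow> q t" for t
    using gram(1)[of t] unfolding has_sum_def by (rule filterlim_compose[OF _ filterlim_int_intervals])
  have q_meas [measurable]: "q \<in> borel_measurable ?M"
    by (rule borel_measurable_LIMSEQ_real[OF conv]) measurable
  have q_int: "integrable ?M q"
  proof (rule Bochner_Integration.integrable_bound)
    show "integrable ?M (\<lambda>t. S / \<alpha> * w t)" using w_int by simp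
    have "0 \<le> q t" for t using gram(1)[of t] by (rule has_sum_nonneg) simp
    hence "norm (q t) \<le> norm (S / \<alpha> * w t)" for t
      using order_trans[OF gram(3) abs_ge_self, of t] by (simp only: real_norm_def abs_of_nonneg)
    thus "AE t in ?M. norm (q t) \<le> norm (S / \<alpha> * w t)"
      by (intro AE_I2)
  qed measurable
  have "(\<lambda>n. \<integral>t. (\<Sum>k\<in>{- int n..int n}. (norm (u k t))\<^sup>2) \<partial>?M) \<longlonglongrightarrow> (\<integral>t. q t \<partial>?M)"
  proof (rule integral_dominated_convergence[where w = "\<lambda>t. S / \<alpha> * w t"])
    show "AE t in ?M. norm (\<Sum>k\<in>{- int n..int n}. (norm (u k t))\<^sup>2) \<le> S / \<alpha> * w t" for n
      using fin_le[of "{- int n..int n}"] by (intro AE_I2) (simp add: sum_nonneg abs_of_nonneg)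
  qed (use conv w_int in auto)
  moreover have "(\<lambda>n. \<Sum>k\<in>{- int n..int n}. v k) \<longlonglongrightarrow> V"
    using V unfolding has_sum_def by (rule filterlim_compose[OF _ filterlim_int_intervals])
  ultimately have V_eq: "V = (\<integral>t. q t \<partial>?M)"
    by (simp only: v_sum) (rule LIMSEQ_unique)
  have upper: "V \<le> S / \<alpha> * N"
  proof -
    have "V \<le> (\<integral>t. S / \<alpha> * w t \<partial>?M)"
      unfolding V_eq by (intro integral_mono q_int integrable_mult_right w_int gram(3))
    thus ?thesis by (simp add: w_eq)
  qed
  have lower: "(2 * A - S) / \<alpha> * N \<le> V"
  proof -
    have "(\<integral>t. (2 * A - S) / \<alpha> * w t \<partial>?M) \<le> V"
      unfolding V_eq by (intro integral_mono q_int integrable_mult_right w_int gram(2))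
    thus ?thesis by (simp add: w_eq)
  qed
  have TV: "((\<lambda>k. T * v k) has_sum (T * V)) UNIV" by (intro has_sum_cmult_right V)
  have "(\<lambda>p. (norm (gabor_coeff g \<alpha> T f p))\<^sup>2) summable_on Sigma UNIV (\<lambda>_. UNIV)"
    by (rule summable_on_SigmaI[OF rows has_sum_imp_summable[OF TV]]) auto
  from has_sum_SigmaI[OF rows TV this]
  have "((\<lambda>p. (norm (gabor_coeff g \<alpha> T f p))\<^sup>2) has_sum (T * V)) UNIV" by simp
  thus ?thesis
  proof (rule that)
    show "T * (2 * A - S) / \<alpha> * N \<le> T * V"
      using mult_left_mono[OF lower, of T] T by (simp add: mult.assoc)
    show "T * V \<le> T * S / \<alpha> * N"
      using mult_left_mono[OF upper, of T] T by (simp add: mult.assoc)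
  qed
qed

text \<open>
  The passage to general \<open>f\<close> is by truncation. The upper bound survives the limit. In the lower bound a factor 2 is
  given away, so that \<open>\<bar>a + b\<bar>\<^sup>2 \<le> 2 \<bar>a\<bar>\<^sup>2 + 2 \<bar>b\<bar>\<^sup>2\<close> and the upper bound for the tail
  suffice.
\<close>

theorem janssen_frame_bounds:
  assumes \<alpha>: "\<alpha> > 0" and T: "T > 0" and g: "admissible_window g" and S: "janssen_sum g \<alpha> T S"
    and f: "f \<in> borel_measurable borel" "integrable lborel (\<lambda>t. (norm (f t))\<^sup>2)"
  defines "A \<equiv> norm (ambiguity g 0 0)" and "N \<equiv> (\<integral>t. (norm (f t))\<^sup>2 \<partial>lborel)"
  shows "(\<lambda>p. (norm (gabor_coeff g \<alpha> T f p))\<^sup>2) summable_on UNIV"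
    and "T * (2 * A - S) / (2 * \<alpha>) * N \<le> (\<Sum>\<^sub>\<infinity>p. (norm (gabor_coeff g \<alpha> T f p))\<^sup>2)"
    and "(\<Sum>\<^sub>\<infinity>p. (norm (gabor_coeff g \<alpha> T f p))\<^sup>2) \<le> T * S / \<alpha> * N"
proof -
  note [measurable] = admissible_window_measurable[OF g] f(1)
  let ?c = "gabor_coeff g \<alpha> T"
  define B where "B = T * S / \<alpha>"
  have S0: "S \<ge> 0" using S unfolding janssen_sum_def by (rule has_sum_nonneg) auto
  have B0: "B \<ge> 0" using S0 T \<alpha> by (simp add: B_def)
  define tr where "tr = (\<lambda>n t. indicator {t. \<lfloor>t / T\<rfloor> \<in> {- int n..int n}} t *\<^sub>R f t)"
  have tr_meas [measurable]: "tr n \<in> borel_measurable borel" for n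
    unfolding tr_def by (rule borel_measurable_truncation[OF f(1)])
  have tr_le: "norm (tr n t) \<le> norm (f t)" for n t by (simp add: tr_def indicator_def)
  have tr_int: "integrable lborel (\<lambda>t. (norm (tr n t))\<^sup>2)" for n
    by (rule Bochner_Integration.integrable_bound[OF f(2)]) (auto intro!: AE_I2 power_mono tr_le)
  have tr_lim: "(\<lambda>n. tr n t) \<longlonglongrightarrow> f t" for t unfolding tr_def by (rule truncation_tendsto)
  have tr_bounds: "\<exists>Q. ((\<lambda>p. (norm (?c (tr n) p))\<^sup>2) has_sum Q) UNIV \<and>
      T * (2 * A - S) / \<alpha> * (\<integral>t. (norm (tr n t))\<^sup>2 \<partial>lborel) \<le> Q \<and> Q \<le> B * (\<integral>t. (norm (tr n t))\<^sup>2 \<partial>lborel)" for n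
    unfolding A_def B_def
    by (rule gabor_bounds_compact_support[OF \<alpha> T g S tr_meas tr_int, of "{- int n..int n}" n]) (auto simp: tr_def)
  have bessel: "(\<Sum>p\<in>F. (norm (?c h p))\<^sup>2) \<le> B * (\<integral>t. (norm (h t))\<^sup>2 \<partial>lborel)"
    if F: "finite F" and h: "h \<in> borel_measurable borel" "integrable lborel (\<lambda>t. (norm (h t))\<^sup>2)" for F h
  proof (rule LIMSEQ_le_const2)
    define trh where "trh = (\<lambda>n t. indicator {t. \<lfloor>t / T\<rfloor> \<in> {- int n..int n}} t *\<^sub>R h t)"
    note [measurable] = h(1)
    have trh_meas [measurable]: "trh n \<in> borel_measurable borel" for n
      unfolding trh_def by (rule borel_measurable_truncation[OF h(1)])
    have trh_le: "norm (trh n t) \<le> norm (h t)" for n t by (simp add: trh_def indicator_def)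
    have trh_int: "integrable lborel (\<lambda>t. (norm (trh n t))\<^sup>2)" for n
      by (rule Bochner_Integration.integrable_bound[OF h(2)]) (auto intro!: AE_I2 power_mono trh_le)
    have "(\<lambda>n. ?c (trh n) p) \<longlonglongrightarrow> ?c h p" for p
    proof -
      obtain k l where p: "p = (k, l)" by (cases p)
      show ?thesis unfolding p gabor_coeff_def prod.case
      proof (rule integral_dominated_convergence)
        show "integrable lborel (\<lambda>t. norm (h t * cnj (g (t + of_int k * \<alpha>)) * trig T (- l) t))"
          by (intro integrable_norm gabor_coeff_integrable g h)
        show "AE t in lborel. (\<lambda>n. trh n t * cnj (g (t + of_int k * \<alpha>)) * trig T (- l) t) \<longlonglongrightarrow>
            h t * cnj (g (t + of_int k * \<alpha>)) * trig T (- l) t"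
          unfolding trh_def by (intro AE_I2 tendsto_intros truncation_tendsto)
        show "AE t in lborel. norm (trh n t * cnj (g (t + of_int k * \<alpha>)) * trig T (- l) t) \<le>
            norm (h t * cnj (g (t + of_int k * \<alpha>)) * trig T (- l) t)" for n
          by (intro AE_I2) (auto simp: norm_mult intro!: mult_right_mono trh_le)
      qed measurable
    qed
    thus "(\<lambda>n. \<Sum>p\<in>F. (norm (?c (trh n) p))\<^sup>2) \<longlonglongrightarrow> (\<Sum>p\<in>F. (norm (?c h p))\<^sup>2)"
      by (intro tendsto_intros)
    have "(\<Sum>p\<in>F. (norm (?c (trh n) p))\<^sup>2) \<le> B * (\<integral>t. (norm (h t))\<^sup>2 \<partial>lborel)" for n
    proof (rule gabor_bounds_compact_support[OF \<alpha> T g S trh_meas trh_int, of "{- int n..int n}" n])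
      fix Q assume Q: "((\<lambda>p. (norm (?c (trh n) p))\<^sup>2) has_sum Q) UNIV"
        and le: "Q \<le> T * S / \<alpha> * (\<integral>t. (norm (trh n t))\<^sup>2 \<partial>lborel)"
      have "(\<Sum>p\<in>F. (norm (?c (trh n) p))\<^sup>2) \<le> Q" by (rule finite_sum_le_has_sum[OF Q F]) auto
      also note le
      also have "T * S / \<alpha> * (\<integral>t. (norm (trh n t))\<^sup>2 \<partial>lborel) \<le> B * (\<integral>t. (norm (h t))\<^sup>2 \<partial>lborel)"
        unfolding B_def[symmetric]
        by (intro mult_left_mono B0 integral_mono trh_int h power_mono trh_le) auto
      finally show ?thesis .
    qed (auto simp: trh_def)
    thus "\<exists>N. \<forall>n\<ge>N. (\<Sum>p\<in>F. (norm (?c (trh n) p))\<^sup>2) \<le> B * (\<integral>t. (norm (h t))\<^sup>2 \<partial>lborel)" by blast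
  qed
  have summ: "(\<lambda>p. (norm (?c h p))\<^sup>2) summable_on UNIV" and
       upper: "(\<Sum>\<^sub>\<infinity>p. (norm (?c h p))\<^sup>2) \<le> B * (\<integral>t. (norm (h t))\<^sup>2 \<partial>lborel)"
    if h: "h \<in> borel_measurable borel" "integrable lborel (\<lambda>t. (norm (h t))\<^sup>2)" for h
  proof -
    show s: "(\<lambda>p. (norm (?c h p))\<^sup>2) summable_on UNIV"
      by (rule nonneg_bdd_above_summable_on) (auto intro!: bdd_aboveI2 bessel h)
    show "(\<Sum>\<^sub>\<infinity>p. (norm (?c h p))\<^sup>2) \<le> B * (\<integral>t. (norm (h t))\<^sup>2 \<partial>lborel)"
      by (rule infsum_le_finite_sums[OF s]) (auto intro!: bessel h)
  qed
  show "(\<lambda>p. (norm (?c f p))\<^sup>2) summable_on UNIV" by (rule summ[OF f])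
  show "(\<Sum>\<^sub>\<infinity>p. (norm (?c f p))\<^sup>2) \<le> T * S / \<alpha> * N"
    using upper[OF f] by (simp add: B_def N_def)
  define R where "R = (\<Sum>\<^sub>\<infinity>p. (norm (?c f p))\<^sup>2)"
  have ineq: "T * (2 * A - S) / \<alpha> * (\<integral>t. (norm (tr n t))\<^sup>2 \<partial>lborel) \<le>
      2 * R + 2 * (B * (\<integral>t. (norm (tr n t - f t))\<^sup>2 \<partial>lborel))" for n
  proof -
    have d: "(\<lambda>t. tr n t - f t) \<in> borel_measurable borel" "integrable lborel (\<lambda>t. (norm (tr n t - f t))\<^sup>2)"
    proof -
      show "integrable lborel (\<lambda>t. (norm (tr n t - f t))\<^sup>2)"
        by (rule Bochner_Integration.integrable_bound[OF f(2)])
           (auto intro!: AE_I2 power_mono simp: tr_def indicator_def)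
    qed measurable
    have lin: "?c (tr n) p = ?c f p + ?c (\<lambda>t. tr n t - f t) p" for p
    proof -
      obtain k l where p: "p = (k, l)" by (cases p)
      have "?c f p + ?c (\<lambda>t. tr n t - f t) p =
          (\<integral>t. f t * cnj (g (t + of_int k * \<alpha>)) * trig T (- l) t +
               (tr n t - f t) * cnj (g (t + of_int k * \<alpha>)) * trig T (- l) t \<partial>lborel)"
        unfolding p gabor_coeff_def prod.case
        by (rule Bochner_Integration.integral_add[symmetric]) (intro gabor_coeff_integrable g f d)+
      thus ?thesis unfolding p gabor_coeff_def prod.case by (simp add: algebra_simps)
    qed
    obtain Q where Q: "((\<lambda>p. (norm (?c (tr n) p))\<^sup>2) has_sum Q) UNIV"
      "T * (2 * A - S) / \<alpha> * (\<integral>t. (norm (tr n t))\<^sup>2 \<partial>lborel) \<le> Q" using tr_bounds by blast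
    have "((\<lambda>p. 2 * (norm (?c f p))\<^sup>2 + 2 * (norm (?c (\<lambda>t. tr n t - f t) p))\<^sup>2) has_sum
        (2 * R + 2 * (\<Sum>\<^sub>\<infinity>p. (norm (?c (\<lambda>t. tr n t - f t) p))\<^sup>2))) UNIV"
      unfolding R_def by (intro has_sum_add has_sum_cmult_right has_sum_infsum summ f d)
    with Q(1) have "Q \<le> 2 * R + 2 * (\<Sum>\<^sub>\<infinity>p. (norm (?c (\<lambda>t. tr n t - f t) p))\<^sup>2)"
      by (rule has_sum_mono) (simp add: lin norm_add_squared_le)
    also have "\<dots> \<le> 2 * R + 2 * (B * (\<integral>t. (norm (tr n t - f t))\<^sup>2 \<partial>lborel))"
      using upper[OF d] by simp
    finally show ?thesis using Q(2) by linarith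
  qed
  have lim1: "(\<lambda>n. \<integral>t. (norm (tr n t))\<^sup>2 \<partial>lborel) \<longlonglongrightarrow> N"
    unfolding N_def
  proof (rule integral_dominated_convergence[OF _ _ f(2)])
    show "AE t in lborel. (\<lambda>n. (norm (tr n t))\<^sup>2) \<longlonglongrightarrow> (norm (f t))\<^sup>2"
      by (intro AE_I2 tendsto_intros tr_lim)
    show "AE t in lborel. norm ((norm (tr n t))\<^sup>2) \<le> (norm (f t))\<^sup>2" for n
      by (intro AE_I2) (auto intro!: power_mono tr_le)
  qed measurable
  have lim2: "(\<lambda>n. \<integral>t. (norm (tr n t - f t))\<^sup>2 \<partial>lborel) \<longlonglongrightarrow> integral\<^sup>L lborel (\<lambda>t::real. 0)"
  proof (rule integral_dominated_convergence[where w = "\<lambda>t. (norm (f t))\<^sup>2"])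
    show "integrable lborel (\<lambda>t. (norm (f t))\<^sup>2)" by (rule f(2))
    have "(\<lambda>n. (norm (tr n t - f t))\<^sup>2) \<longlonglongrightarrow> (norm (f t - f t))\<^sup>2" for t
      by (intro tendsto_intros tr_lim)
    thus "AE t in lborel. (\<lambda>n. (norm (tr n t - f t))\<^sup>2) \<longlonglongrightarrow> 0" by simp
    show "AE t in lborel. norm ((norm (tr n t - f t))\<^sup>2) \<le> (norm (f t))\<^sup>2" for n
      by (intro AE_I2) (auto intro!: power_mono simp: tr_def indicator_def)
  qed measurable
  have "T * (2 * A - S) / \<alpha> * N \<le> 2 * R + 2 * (B * 0)"
  proof (rule LIMSEQ_le)
    show "(\<lambda>n. T * (2 * A - S) / \<alpha> * (\<integral>t. (norm (tr n t))\<^sup>2 \<partial>lborel)) \<longlonglongrightarrow> T * (2 * A - S) / \<alpha> * N"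
      by (intro tendsto_intros lim1)
    show "(\<lambda>n. 2 * R + 2 * (B * (\<integral>t. (norm (tr n t - f t))\<^sup>2 \<partial>lborel))) \<longlonglongrightarrow> 2 * R + 2 * (B * 0)"
      using lim2 by (intro tendsto_intros) simp
  qed (use ineq in blast)
  thus "T * (2 * A - S) / (2 * \<alpha>) * N \<le> (\<Sum>\<^sub>\<infinity>p. (norm (?c f p))\<^sup>2)"
    using \<alpha> by (simp add: R_def field_simps)
qed

lemma lebesgue_measurable_eq_borel:
  fixes f :: "real \<Rightarrow> complex"
  assumes "f \<in> borel_measurable lebesgue"
  obtains f' where "f' \<in> borel_measurable borel" "AE t in lebesgue. f t = f' t"
proof -
  have "(\<lambda>t. Re (f t)) \<in> borel_measurable lebesgue" "(\<lambda>t. Im (f t)) \<in> borel_measurable lebesgue"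
    using assms by auto
  then obtain a b where a: "a \<in> borel_measurable lborel" "AE t in lborel. Re (f t) = a t"
      and b: "b \<in> borel_measurable lborel" "AE t in lborel. Im (f t) = b t"
    using completion_ex_borel_measurable_real[of "\<lambda>t. Re (f t)" lborel]
      completion_ex_borel_measurable_real[of "\<lambda>t. Im (f t)" lborel] by blast
  show ?thesis
  proof (rule that)
    show "(\<lambda>t. Complex (a t) (b t)) \<in> borel_measurable borel"
      using a(1) b(1) unfolding borel_measurable_complex_iff by simp
    have "AE t in lborel. f t = Complex (a t) (b t)"
      using a(2) b(2) by eventually_elim (simp add: complex_eq_iff)
    thus "AE t in lebesgue. f t = Complex (a t) (b t)" by (rule AE_completion)
  qed
qed

text \<open>
  A Gabor system is a frame if on the adjoint lattice the value of the ambiguity function at the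
  origin outweighs all the other values together (a criterion of Tolimieri, Orr and Janssen).
\<close>

theorem janssen_criterion:
  assumes \<alpha>: "\<alpha> > 0" and \<beta>: "\<beta> > 0" and g: "admissible_window g"
    and S: "janssen_sum g \<alpha> (1 / \<beta>) S" and less: "S < 2 * norm (ambiguity g 0 0)"
  shows "gabor_frame g (range (\<lambda>(k::int, l::int). (of_int k * \<alpha>, of_int l * \<beta>)))"
proof -
  let ?\<Lambda> = "range (\<lambda>(k::int, l::int). (of_int k * \<alpha>, of_int l * \<beta>))"
  define T where "T = 1 / \<beta>"
  have T: "T > 0" using \<beta> by (simp add: T_def)
  note S = S[folded T_def]
  note [measurable] = admissible_window_measurable[OF g]
  define A where "A = norm (ambiguity g 0 0)"
  \<comment> \<open>The sign of \<open>k\<close> is reversed to match the coefficients, which translate the window to the left.\<close>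
  define z where "z = (\<lambda>(k::int, l::int). (of_int (- k) * \<alpha>, of_int l * \<beta>))"
  have A_le: "A \<le> S"
    using finite_sum_le_has_sum[OF S[unfolded janssen_sum_def], of "{(0, 0)}"] by (auto simp: A_def)
  have Apos: "A > 0" using less A_le unfolding A_def by linarith
  have z_inj: "inj z" using \<alpha> \<beta> by (auto simp: inj_on_def z_def)
  have z_range: "range z = ?\<Lambda>"
  proof (intro equalityI subsetI)
    fix p assume "p \<in> range z"
    then obtain k l where "p = z (k, l)" by force
    thus "p \<in> ?\<Lambda>" by (auto simp: z_def intro!: image_eqI[of _ _ "(- k, l)"])
  next
    fix p assume "p \<in> ?\<Lambda>"
    then obtain k l where "p = (of_int k * \<alpha>, of_int l * \<beta>)" by force
    thus "p \<in> range z" by (auto simp: z_def intro!: image_eqI[of _ _ "(- k, l)"])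
  qed
  have sys: "gabor_system g (z (k, l)) = (\<lambda>t. trig T l t * g (t + of_int k * \<alpha>))" for k l
    using \<beta> by (auto simp: gabor_system_def tf_shift_def z_def trig_def cis_conv_exp T_def fun_eq_iff mult_ac)
  have coeff: "L2_inner f (gabor_system g (z p)) = gabor_coeff g \<alpha> T f' p"
    if f: "f \<in> borel_measurable lebesgue" and f': "f' \<in> borel_measurable borel" and eq: "AE t in lebesgue. f t = f' t" for f f' p
  proof -
    obtain k l where p: "p = (k, l)" by (cases p)
    note [measurable] = f'
    have F: "(\<lambda>t. f' t * cnj (g (t + of_int k * \<alpha>)) * trig T (- l) t) \<in> borel_measurable borel"
      and w: "(\<lambda>t. cnj (trig T l t * g (t + of_int k * \<alpha>))) \<in> borel_measurable borel" by measurable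
    have F': "(\<lambda>t. f' t * cnj (g (t + of_int k * \<alpha>)) * trig T (- l) t) \<in> borel_measurable lborel"
      using F by simp
    have w': "(\<lambda>t. cnj (trig T l t * g (t + of_int k * \<alpha>))) \<in> borel_measurable lebesgue"
      by (rule measurable_completion) (use w in simp)
    have "L2_inner f (gabor_system g (z p)) = (LINT t|lebesgue. f' t * cnj (g (t + of_int k * \<alpha>)) * trig T (- l) t)"
      unfolding L2_inner_def p sys
    proof (rule integral_cong_AE)
      show "AE t in lebesgue. f t * cnj (trig T l t * g (t + of_int k * \<alpha>)) = f' t * cnj (g (t + of_int k * \<alpha>)) * trig T (- l) t"
        using eq by eventually_elim simp
      show "(\<lambda>t. f t * cnj (trig T l t * g (t + of_int k * \<alpha>))) \<in> borel_measurable lebesgue"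
        by (rule borel_measurable_times[OF f w'])
      show "(\<lambda>t. f' t * cnj (g (t + of_int k * \<alpha>)) * trig T (- l) t) \<in> borel_measurable lebesgue"
        by (rule measurable_completion[OF F'])
    qed
    also have "\<dots> = gabor_coeff g \<alpha> T f' p"
      unfolding p gabor_coeff_def prod.case by (rule integral_completion[OF F'])
    finally show ?thesis .
  qed
  define a where "a = T * (2 * A - S) / (2 * \<alpha>)"
  define b where "b = T * S / \<alpha>"
  have "0 < a" using T \<alpha> less by (simp add: a_def A_def)
  moreover have "a \<le> b"
  proof -
    have "T * (2 * A - S) / (2 * \<alpha>) \<le> T * (2 * S) / (2 * \<alpha>)"
      using T \<alpha> A_le Apos by (intro divide_right_mono mult_left_mono) auto
    thus ?thesis using \<alpha> by (simp add: a_def b_def)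
  qed
  moreover have "gabor_system g (z p) \<in> L2" for p
  proof -
    obtain k l where p: "p = (k, l)" by (cases p)
    have "(\<lambda>t. trig T l t * g (t + of_int k * \<alpha>)) \<in> borel_measurable lebesgue"
      by (intro measurable_completion) measurable
    moreover have "integrable lebesgue (\<lambda>t. (norm (g (t + of_int k * \<alpha>)))\<^sup>2)"
      by (subst integrable_completion) (use window_square_integrable[OF g, of "of_int k * \<alpha>"] in auto)
    ultimately show ?thesis by (simp add: L2_def p sys norm_mult)
  qed
  moreover have "(\<lambda>i. (norm (L2_inner f (gabor_system g i)))\<^sup>2) summable_on ?\<Lambda> \<and>
           a * (L2_norm f)\<^sup>2 \<le> (\<Sum>\<^sub>\<infinity>i\<in>?\<Lambda>. (norm (L2_inner f (gabor_system g i)))\<^sup>2) \<and>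
           (\<Sum>\<^sub>\<infinity>i\<in>?\<Lambda>. (norm (L2_inner f (gabor_system g i)))\<^sup>2) \<le> b * (L2_norm f)\<^sup>2" if "f \<in> L2" for f
  proof -
    have f: "f \<in> borel_measurable lebesgue" "integrable lebesgue (\<lambda>t. (norm (f t))\<^sup>2)"
      using that by (auto simp: L2_def)
    obtain f' where f': "f' \<in> borel_measurable borel" "AE t in lebesgue. f t = f' t"
      using lebesgue_measurable_eq_borel[OF f(1)] by blast
    note [measurable] = f'(1)
    have f'_leb: "(\<lambda>t. (norm (f' t))\<^sup>2) \<in> borel_measurable lebesgue"
      by (intro measurable_completion) measurable
    have f_leb: "(\<lambda>t. (norm (f t))\<^sup>2) \<in> borel_measurable lebesgue" using f(1) by measurable
    have eq: "AE t in lebesgue. (norm (f t))\<^sup>2 = (norm (f' t))\<^sup>2" using f'(2) by eventually_elim simp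
    have "integrable lebesgue (\<lambda>t. (norm (f' t))\<^sup>2)"
      using f(2) integrable_cong_AE[OF f_leb f'_leb eq] by simp
    hence int: "integrable lborel (\<lambda>t. (norm (f' t))\<^sup>2)"
      by (subst (asm) integrable_completion) measurable
    have norm: "(L2_norm f)\<^sup>2 = (\<integral>t. (norm (f' t))\<^sup>2 \<partial>lborel)"
    proof -
      have "(L2_norm f)\<^sup>2 = (LINT t|lebesgue. (norm (f t))\<^sup>2)"
        unfolding L2_norm_def by (rule real_sqrt_pow2) simp
      also have "\<dots> = (LINT t|lebesgue. (norm (f' t))\<^sup>2)" by (rule integral_cong_AE[OF f_leb f'_leb eq])
      also have "\<dots> = (\<integral>t. (norm (f' t))\<^sup>2 \<partial>lborel)" by (rule integral_completion) measurable
      finally show ?thesis .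
    qed
    have comp: "(\<lambda>i. (norm (L2_inner f (gabor_system g i)))\<^sup>2) \<circ> z = (\<lambda>p. (norm (gabor_coeff g \<alpha> T f' p))\<^sup>2)"
      by (auto simp: coeff[OF f(1) f'])
    show ?thesis
      unfolding z_range[symmetric] summable_on_reindex[OF z_inj] infsum_reindex[OF z_inj] comp norm a_def b_def A_def
      using janssen_frame_bounds[OF \<alpha> T g S f'(1) int] by blast
  qed
  ultimately show ?thesis
    unfolding gabor_frame_def is_L2_frame_def z_range[symmetric]
    by (intro conjI exI[of _ a] exI[of _ b] ballI) auto
qed

section \<open>Hermite functions\<close>

text \<open>
  Hermite polynomials in the normalisation for which the \<open>n\<close>-th derivative of $e^{-2 \pi t^2}$ is
  \<open>hermite_poly n t\<close> times $e^{-2 \pi t^2}$.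
\<close>

fun hermite_poly :: "nat \<Rightarrow> real \<Rightarrow> real" where
  "hermite_poly 0 t = 1"
| "hermite_poly (Suc 0) t = - 4 * pi * t"
| "hermite_poly (Suc (Suc n)) t = - 4 * pi * t * hermite_poly (Suc n) t - 4 * pi * real (Suc n) * hermite_poly n t"

lemma hermite_poly_Suc:
  "hermite_poly (Suc n) t = - 4 * pi * t * hermite_poly n t - 4 * pi * real n * hermite_poly (n - 1) t"
  by (cases n) simp_all

lemma hermite_poly_has_derivative:
  "(hermite_poly n has_real_derivative (- 4 * pi * real n * hermite_poly (n - 1) t)) (at t)"
proof (induction n t rule: hermite_poly.induct)
  case (3 n t)
  have "((\<lambda>t. - 4 * pi * t * hermite_poly (Suc n) t - 4 * pi * real (Suc n) * hermite_poly n t) has_real_derivative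
      (- 4 * pi * real (Suc (Suc n)) * hermite_poly (Suc n) t)) (at t)"
  proof -
    have d1: "(hermite_poly (Suc n) has_real_derivative (- 4 * pi * real (Suc n) * hermite_poly n t)) (at t)"
      using 3(1) by simp
    show ?thesis
      by (rule derivative_eq_intros d1 3(2) refl)+ (simp add: hermite_poly_Suc[of n t] algebra_simps)
  qed
  thus ?case by simp
qed (auto intro!: derivative_eq_intros)

lemma iterated_deriv_gaussian:
  "(deriv ^^ n) (\<lambda>s. exp (- 2 * pi * s\<^sup>2)) = (\<lambda>t. hermite_poly n t * exp (- 2 * pi * t\<^sup>2))"
proof (induction n)
  case (Suc n)
  have "((\<lambda>t. hermite_poly n t * exp (- 2 * pi * t\<^sup>2)) has_real_derivative
      hermite_poly (Suc n) t * exp (- 2 * pi * t\<^sup>2)) (at t)" for t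
    by (auto intro!: derivative_eq_intros hermite_poly_has_derivative simp: hermite_poly_Suc algebra_simps)
  thus ?case using Suc by (auto intro: DERIV_imp_deriv)
qed simp

text \<open>
  The Hermite functions without the sign and the normalising constant.
\<close>

definition hermite_gauss :: "nat \<Rightarrow> real \<Rightarrow> real" where
  "hermite_gauss n t = hermite_poly n t * exp (- pi * t\<^sup>2)"

lemma hermite_fun_eq:
  "hermite_fun n t = complex_of_real (hermite_const n * (-1) ^ n * hermite_gauss n t)"
proof -
  have "exp (pi * t\<^sup>2) * exp (- 2 * pi * t\<^sup>2) = exp (- pi * t\<^sup>2)"
    by (simp add: exp_add[symmetric])
  moreover have "hermite_const n * (-1) ^ n * exp (pi * t\<^sup>2) * (hermite_poly n t * exp (- 2 * pi * t\<^sup>2)) =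
      hermite_const n * (-1) ^ n * (hermite_poly n t * (exp (pi * t\<^sup>2) * exp (- 2 * pi * t\<^sup>2)))"
    by (simp only: mult_ac)
  ultimately show ?thesis
    by (simp only: hermite_fun_def iterated_deriv_gaussian hermite_gauss_def)
qed

lemma hermite_gauss_Suc:
  "hermite_gauss (Suc n) t = - 4 * pi * t * hermite_gauss n t - 4 * pi * real n * hermite_gauss (n - 1) t"
  by (simp add: hermite_gauss_def hermite_poly_Suc algebra_simps)

lemma hermite_gauss_has_derivative:
  "(hermite_gauss n has_real_derivative (hermite_gauss (Suc n) t - 4 * pi * real n * hermite_gauss (n - 1) t) / 2) (at t)"
proof -
  have "((\<lambda>t. hermite_poly n t * exp (- pi * t\<^sup>2)) has_real_derivative
     (hermite_gauss (Suc n) t - 4 * pi * real n * hermite_gauss (n - 1) t) / 2) (at t)"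
    by (auto intro!: derivative_eq_intros hermite_poly_has_derivative
             simp: hermite_gauss_def hermite_poly_Suc algebra_simps)
  thus ?thesis by (simp add: hermite_gauss_def[abs_def])
qed

lemma hermite_gauss_continuous: "continuous_on A (hermite_gauss n)"
  using hermite_gauss_has_derivative by (intro continuous_at_imp_continuous_on ballI) (rule DERIV_isCont)

lemma hermite_poly_bound: "\<exists>C\<ge>0. \<forall>t. \<bar>hermite_poly n t\<bar> \<le> C * (1 + t\<^sup>2) ^ n"
proof (induction n rule: less_induct)
  case (less n)
  have t_le: "\<bar>t\<bar> \<le> 1 + t\<^sup>2" for t :: real
    using sum_squares_bound[of "\<bar>t\<bar>" 1] by (simp add: power2_eq_square)
  show ?case
  proof (cases n)
    case 0
    thus ?thesis by (intro exI[of _ 1]) auto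
  next
    case (Suc m)
    obtain C where C: "C \<ge> 0" "\<And>t. \<bar>hermite_poly m t\<bar> \<le> C * (1 + t\<^sup>2) ^ m" using less[of m] Suc by auto
    obtain D where D: "D \<ge> 0" "\<And>t. \<bar>hermite_poly (m - 1) t\<bar> \<le> D * (1 + t\<^sup>2) ^ (m - 1)"
    proof -
      have "m - 1 < n" using Suc by simp
      from less[OF this] show ?thesis using that by blast
    qed
    have "\<bar>hermite_poly n t\<bar> \<le> (4 * pi * C + 4 * pi * real m * D) * (1 + t\<^sup>2) ^ n" for t
    proof -
      have "\<bar>hermite_poly n t\<bar> \<le> 4 * pi * (\<bar>t\<bar> * \<bar>hermite_poly m t\<bar>) + 4 * pi * real m * \<bar>hermite_poly (m - 1) t\<bar>"
        unfolding Suc hermite_poly_Suc by (rule order_trans[OF abs_triangle_ineq4]) (simp add: abs_mult)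
      also have "\<dots> \<le> 4 * pi * ((1 + t\<^sup>2) * (C * (1 + t\<^sup>2) ^ m)) + 4 * pi * real m * (D * (1 + t\<^sup>2) ^ n)"
      proof (intro add_mono mult_left_mono mult_mono t_le C)
        have "(1 + t\<^sup>2) ^ (m - 1) \<le> (1 + t\<^sup>2) ^ n" using Suc by (intro power_increasing) auto
        hence "D * (1 + t\<^sup>2) ^ (m - 1) \<le> D * (1 + t\<^sup>2) ^ n" using D(1) by (intro mult_left_mono)
        thus "\<bar>hermite_poly (m - 1) t\<bar> \<le> D * (1 + t\<^sup>2) ^ n" using D(2)[of t] by linarith
      qed auto
      also have "\<dots> = (4 * pi * C + 4 * pi * real m * D) * (1 + t\<^sup>2) ^ n"
        by (simp add: Suc algebra_simps)
      finally show ?thesis .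
    qed
    moreover have "4 * pi * C + 4 * pi * real m * D \<ge> 0" using C D by simp
    ultimately show ?thesis by blast
  qed
qed

lemma hermite_gauss_decay: "\<exists>C. \<forall>t. \<bar>hermite_gauss n t\<bar> \<le> C / (1 + t\<^sup>2)"
proof -
  obtain C where C: "C \<ge> 0" "\<And>t. \<bar>hermite_poly n t\<bar> \<le> C * (1 + t\<^sup>2) ^ n" using hermite_poly_bound by blast
  define D where "D = C * (real (Suc n) ^ Suc n * exp 1)"
  have "\<bar>hermite_gauss n t\<bar> \<le> D / (1 + t\<^sup>2)" for t
  proof -
    have pos: "1 + t\<^sup>2 > 0" by (simp add: add_pos_nonneg)
    have "(1 + t\<^sup>2) / real (Suc n) \<le> exp ((1 + t\<^sup>2) / real (Suc n))"
      using exp_ge_add_one_self[of "(1 + t\<^sup>2) / real (Suc n)"] by linarith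
    hence "((1 + t\<^sup>2) / real (Suc n)) ^ Suc n \<le> exp ((1 + t\<^sup>2) / real (Suc n)) ^ Suc n"
      by (intro power_mono) (auto intro!: divide_nonneg_nonneg)
    also have "\<dots> = exp (1 + t\<^sup>2)"
      by (subst exp_of_nat_mult[symmetric]) simp
    finally have *: "(1 + t\<^sup>2) ^ Suc n \<le> real (Suc n) ^ Suc n * exp (1 + t\<^sup>2)"
      by (simp add: power_divide divide_le_eq mult.commute del: power_Suc of_nat_Suc)
    have "\<bar>hermite_gauss n t\<bar> * (1 + t\<^sup>2) = \<bar>hermite_poly n t\<bar> * exp (- pi * t\<^sup>2) * (1 + t\<^sup>2)"
      by (simp add: hermite_gauss_def abs_mult)
    also have "\<dots> \<le> (C * (1 + t\<^sup>2) ^ n) * exp (- (t\<^sup>2)) * (1 + t\<^sup>2)"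
    proof (intro mult_mono C)
      have "1 * t\<^sup>2 \<le> pi * t\<^sup>2" using pi_gt3 by (intro mult_right_mono) auto
      thus "exp (- pi * t\<^sup>2) \<le> exp (- (t\<^sup>2))" by simp
    qed (use pos C in auto)
    also have "\<dots> = C * ((1 + t\<^sup>2) ^ Suc n * exp (- (t\<^sup>2)))" by simp
    also have "\<dots> \<le> C * (real (Suc n) ^ Suc n * exp (1 + t\<^sup>2) * exp (- (t\<^sup>2)))"
      by (intro mult_left_mono mult_right_mono * C) auto
    also have "\<dots> = D" by (simp add: D_def exp_add[symmetric] mult.assoc del: power_Suc)
    finally show ?thesis using pos by (simp add: field_simps)
  qed
  thus ?thesis by blast
qed

lemma hermite_product_decay:
  "\<exists>C. \<forall>t. \<bar>hermite_gauss n t * hermite_gauss m (t + a)\<bar> \<le> C / (1 + t\<^sup>2)"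
proof -
  obtain C where C: "\<And>t. \<bar>hermite_gauss n t\<bar> \<le> C / (1 + t\<^sup>2)" using hermite_gauss_decay by blast
  obtain D where D: "\<And>t. \<bar>hermite_gauss m t\<bar> \<le> D / (1 + t\<^sup>2)" using hermite_gauss_decay by blast
  have D0: "D \<ge> 0" using order_trans[OF abs_ge_zero D[of 0]] by simp
  have "D / (1 + t\<^sup>2) \<le> D / 1" for t using D0 by (intro divide_left_mono) (auto simp: add_pos_nonneg)
  hence "\<bar>hermite_gauss n t * hermite_gauss m (t + a)\<bar> \<le> C / (1 + t\<^sup>2) * D" for t
    unfolding abs_mult by (intro mult_mono C order_trans[OF abs_ge_zero C]) (use D[of "t + a"] in \<open>force intro: order_trans\<close>)+
  thus ?thesis by (intro exI[of _ "C * D"]) simp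
qed

section \<open>The ambiguity function of Hermite functions\<close>

text \<open>
  The integrand of the cross-ambiguity function of two unnormalised Hermite functions.
\<close>

definition hermite_cross :: "real \<Rightarrow> real \<Rightarrow> nat \<Rightarrow> nat \<Rightarrow> real \<Rightarrow> complex" where
  "hermite_cross a b n m t = of_real (hermite_gauss n t * hermite_gauss m (t + a)) * cis (- (2 * pi * b * t))"

lemma hermite_cross_continuous: "continuous_on UNIV (hermite_cross a b n m)"
  unfolding hermite_cross_def
  by (intro continuous_intros hermite_gauss_continuous continuous_on_compose2[OF hermite_gauss_continuous]) auto

lemma hermite_cross_integrable: "integrable lborel (hermite_cross a b n m)"
proof -
  obtain C where C: "\<And>t. \<bar>hermite_gauss n t * hermite_gauss m (t + a)\<bar> \<le> C / (1 + t\<^sup>2)"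
    using hermite_product_decay by blast
  show ?thesis
  proof (rule Bochner_Integration.integrable_bound)
    show "integrable lborel (\<lambda>t. C * (1 / (1 + t\<^sup>2)))"
      by (intro integrable_mult_right integrable_inverse_one_plus_square)
    show "hermite_cross a b n m \<in> borel_measurable lborel"
      using borel_measurable_continuous_onI[OF hermite_cross_continuous] by simp
    show "AE t in lborel. norm (hermite_cross a b n m t) \<le> norm (C * (1 / (1 + t\<^sup>2)))"
    proof (rule AE_I2)
      fix t
      have "norm (hermite_cross a b n m t) \<le> C / (1 + t\<^sup>2)"
        unfolding hermite_cross_def norm_mult norm_cis norm_of_real using C[of t] by simp
      thus "norm (hermite_cross a b n m t) \<le> norm (C * (1 / (1 + t\<^sup>2)))"
        using abs_ge_self[of "C / (1 + t\<^sup>2)"] by simp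
    qed
  qed
qed

lemma hermite_cross_tendsto_0:
  "(hermite_cross a b n m \<longlongrightarrow> 0) at_top" "(hermite_cross a b n m \<longlongrightarrow> 0) at_bot"
proof -
  obtain C where C: "\<And>t. \<bar>hermite_gauss n t * hermite_gauss m (t + a)\<bar> \<le> C / (1 + t\<^sup>2)"
    using hermite_product_decay by blast
  have le: "norm (hermite_cross a b n m t) \<le> C / (1 + t\<^sup>2)" for t
    unfolding hermite_cross_def norm_mult norm_cis norm_of_real using C[of t] by simp
  have "((\<lambda>t::real. C / (1 + t\<^sup>2)) \<longlongrightarrow> 0) at_top" by real_asymp
  thus "(hermite_cross a b n m \<longlongrightarrow> 0) at_top"
    by (rule Lim_null_comparison[rotated]) (intro always_eventually allI le)
  have "((\<lambda>t::real. C / (1 + t\<^sup>2)) \<longlongrightarrow> 0) at_bot" by real_asymp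
  thus "(hermite_cross a b n m \<longlongrightarrow> 0) at_bot"
    by (rule Lim_null_comparison[rotated]) (intro always_eventually allI le)
qed

text \<open>
  The derivative can be written in two ways with a single raised index, because the three-term recurrence expresses
  multiplication by \<open>t\<close> through neighbouring Hermite functions. The integral of each
  version vanishes, which gives the two recurrences for the cross-ambiguity function.
\<close>

lemma hermite_cross_has_derivative:
  "(hermite_cross a b n m has_vector_derivative
     (hermite_cross a b (Suc n) m t - of_real (4 * pi * real m) * hermite_cross a b n (m - 1) t
       - 2 * of_real pi * Complex a b * hermite_cross a b n m t)) (at t)" (is ?A)
  "(hermite_cross a b n m has_vector_derivative
     (hermite_cross a b n (Suc m) t - of_real (4 * pi * real n) * hermite_cross a b (n - 1) m t
       + 2 * of_real pi * cnj (Complex a b) * hermite_cross a b n m t)) (at t)" (is ?B)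
proof -
  define p where "p = hermite_gauss n t"
  define p1 where "p1 = hermite_gauss (Suc n) t"
  define p0 where "p0 = hermite_gauss (n - 1) t"
  define q where "q = hermite_gauss m (t + a)"
  define q1 where "q1 = hermite_gauss (Suc m) (t + a)"
  define q0 where "q0 = hermite_gauss (m - 1) (t + a)"
  define e where "e = cis (- (2 * pi * b * t))"
  note defs = p_def p1_def p0_def q_def q1_def q0_def e_def
  have p1: "p1 = - 4 * pi * t * p - 4 * pi * real n * p0" by (simp add: defs hermite_gauss_Suc)
  have q1: "q1 = - 4 * pi * (t + a) * q - 4 * pi * real m * q0" by (simp add: defs hermite_gauss_Suc)
  have "((\<lambda>t. hermite_gauss n t * hermite_gauss m (t + a)) has_real_derivative
      (p1 - 4 * pi * real n * p0) / 2 * q + p * ((q1 - 4 * pi * real m * q0) / 2)) (at t)"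
    unfolding defs
    by (auto intro!: derivative_eq_intros hermite_gauss_has_derivative
          DERIV_shift[THEN iffD1, OF hermite_gauss_has_derivative])
  hence 1: "((\<lambda>t. complex_of_real (hermite_gauss n t * hermite_gauss m (t + a))) has_vector_derivative
      of_real ((p1 - 4 * pi * real n * p0) / 2 * q + p * ((q1 - 4 * pi * real m * q0) / 2))) (at t)"
    by (intro has_vector_derivative_of_real) (simp add: has_real_derivative_iff_has_vector_derivative)
  have 2: "((\<lambda>t. cis (- (2 * pi * b * t))) has_vector_derivative - 2 * of_real pi * \<i> * of_real b * e) (at t)"
    unfolding cis_conv_exp defs
    by (auto intro!: derivative_eq_intros has_vector_derivative_real_field simp: mult_ac)
  have 3: "(hermite_cross a b n m has_vector_derivative
      (of_real (p * q) * (- 2 * of_real pi * \<i> * of_real b * e) +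
       of_real ((p1 - 4 * pi * real n * p0) / 2 * q + p * ((q1 - 4 * pi * real m * q0) / 2)) * e)) (at t)"
    unfolding hermite_cross_def[abs_def] using has_vector_derivative_mult[OF 1 2] by (simp only: defs)
  have w: "Complex a b = of_real a + \<i> * of_real b" "cnj (Complex a b) = of_real a - \<i> * of_real b"
    by (simp_all add: complex_eq_iff)
  have "(p1 - 4 * pi * real n * p0) / 2 * q + p * ((q1 - 4 * pi * real m * q0) / 2) =
      p1 * q - 4 * pi * real m * (p * q0) - 2 * pi * a * (p * q)"
    unfolding p1 q1 by (simp add: field_simps)
  note r1 = arg_cong[OF this, of complex_of_real]
  have "(p1 - 4 * pi * real n * p0) / 2 * q + p * ((q1 - 4 * pi * real m * q0) / 2) =
      p * q1 - 4 * pi * real n * (p0 * q) + 2 * pi * a * (p * q)"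
    unfolding p1 q1 by (simp add: field_simps)
  note r2 = arg_cong[OF this, of complex_of_real]
  have c: "hermite_cross a b n m t = of_real (p * q) * e"
    "hermite_cross a b (Suc n) m t = of_real (p1 * q) * e" "hermite_cross a b n (Suc m) t = of_real (p * q1) * e"
    "hermite_cross a b (n - 1) m t = of_real (p0 * q) * e" "hermite_cross a b n (m - 1) t = of_real (p * q0) * e"
    by (simp_all only: hermite_cross_def defs)
  show ?A using 3 unfolding r1
    by (rule has_vector_derivative_eq_rhs) (simp only: w c, simp add: algebra_simps)
  show ?B using 3 unfolding r2
    by (rule has_vector_derivative_eq_rhs) (simp only: w c, simp add: algebra_simps)
qed

text \<open>
  The cross-ambiguity function of two unnormalised Hermite functions at time \<open>a\<close> and frequency \<open>b\<close>.
\<close>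

definition hermite_ambiguity :: "real \<Rightarrow> real \<Rightarrow> nat \<Rightarrow> nat \<Rightarrow> complex" where
  "hermite_ambiguity a b n m = (\<integral>t. hermite_cross a b n m t \<partial>lborel)"

lemma integral_derivative_zero:
  fixes F f :: "real \<Rightarrow> complex"
  assumes F: "\<And>t. (F has_vector_derivative f t) (at t)" and f: "continuous_on UNIV f" "integrable lborel f"
    and lim: "(F \<longlongrightarrow> 0) at_top" "(F \<longlongrightarrow> 0) at_bot"
  shows "(\<integral>t. f t \<partial>lborel) = 0"
proof -
  have "(LBINT t=-\<infinity>..\<infinity>. f t) = 0 - 0"
  proof (rule interval_integral_FTC_integrable)
    show "set_integrable lborel (einterval (-\<infinity>) \<infinity>) f" using f(2) by (simp add: set_integrable_def)
    show "isCont f x" for x using f(1) by (simp add: continuous_on_eq_continuous_at)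
    show "((F \<circ> real_of_ereal) \<longlongrightarrow> 0) (at_right (-\<infinity>))" "((F \<circ> real_of_ereal) \<longlongrightarrow> 0) (at_left \<infinity>)"
      using lim by (simp_all add: ereal_tendsto_simps)
  qed (use F in auto)
  thus ?thesis by (simp add: interval_integral_to_infinity_eq interval_lebesgue_integral_def set_lebesgue_integral_def)
qed

lemma hermite_ambiguity_Suc_left:
  "hermite_ambiguity a b (Suc n) m = of_real (4 * pi * real m) * hermite_ambiguity a b n (m - 1)
     + 2 * of_real pi * Complex a b * hermite_ambiguity a b n m"
proof -
  have "(\<integral>t. hermite_cross a b (Suc n) m t - of_real (4 * pi * real m) * hermite_cross a b n (m - 1) t
       - 2 * of_real pi * Complex a b * hermite_cross a b n m t \<partial>lborel) = 0"
    by (rule integral_derivative_zero[OF hermite_cross_has_derivative(1) _ _ hermite_cross_tendsto_0])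
       (intro continuous_intros hermite_cross_continuous Bochner_Integration.integrable_diff
          integrable_mult_right hermite_cross_integrable)+
  thus ?thesis
    by (simp add: hermite_ambiguity_def hermite_cross_integrable del: of_real_mult)
       (simp add: algebra_simps)
qed

lemma hermite_ambiguity_Suc_right:
  "hermite_ambiguity a b n (Suc m) = of_real (4 * pi * real n) * hermite_ambiguity a b (n - 1) m
     - 2 * of_real pi * cnj (Complex a b) * hermite_ambiguity a b n m"
proof -
  have "(\<integral>t. hermite_cross a b n (Suc m) t - of_real (4 * pi * real n) * hermite_cross a b (n - 1) m t
       + 2 * of_real pi * cnj (Complex a b) * hermite_cross a b n m t \<partial>lborel) = 0"
    by (rule integral_derivative_zero[OF hermite_cross_has_derivative(2) _ _ hermite_cross_tendsto_0])
       (intro continuous_intros hermite_cross_continuous Bochner_Integration.integrable_diff Bochner_Integration.integrable_add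
          integrable_mult_right hermite_cross_integrable)+
  thus ?thesis
    by (simp add: hermite_ambiguity_def hermite_cross_integrable del: of_real_mult complex_cnj)
       (simp add: algebra_simps)
qed


lemma hermite_ambiguity_0_0:
  "hermite_ambiguity a b 0 0 = cis (pi * a * b) * of_real (exp (- pi * (a\<^sup>2 + b\<^sup>2) / 2) / sqrt 2)"
proof -
  \<comment> \<open>The substitution \<open>t = - a / 2 + c x\<close> turns the product of the two Gaussians into a standard normal density.\<close>
  define c where "c = 1 / (2 * sqrt pi)"
  have c: "c > 0" "c\<^sup>2 = 1 / (4 * pi)" by (simp_all add: c_def power_divide power_mult_distrib)
  define s where "s = - sqrt pi * b"
  have char: "(\<integral>x. std_normal_density x *\<^sub>R cis (s * x) \<partial>lborel) = of_real (exp (- (s\<^sup>2) / 2))"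
  proof -
    have "char std_normal_distribution s = of_real (exp (- (s\<^sup>2) / 2))"
      by (simp add: char_std_normal_distribution)
    moreover have "char std_normal_distribution s = (\<integral>x. std_normal_density x *\<^sub>R cis (s * x) \<partial>lborel)"
      unfolding char_def by (subst integral_density) (auto simp: cis_conv_exp mult_ac)
    ultimately show ?thesis by simp
  qed
  have "hermite_ambiguity a b 0 0 = \<bar>c\<bar> *\<^sub>R (\<integral>x. hermite_cross a b 0 0 (- a / 2 + c * x) \<partial>lborel)"
    unfolding hermite_ambiguity_def by (rule lborel_integral_real_affine) (use c in auto)
  also have "(\<lambda>x. hermite_cross a b 0 0 (- a / 2 + c * x)) =
      (\<lambda>x. cis (pi * a * b) * of_real (exp (- pi * a\<^sup>2 / 2) * sqrt (2 * pi)) * (std_normal_density x *\<^sub>R cis (s * x)))"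
  proof
    fix x
    have "exp (- pi * (- a / 2 + c * x)\<^sup>2) * exp (- pi * (- a / 2 + c * x + a)\<^sup>2) = exp (- pi * a\<^sup>2 / 2) * exp (- x\<^sup>2 / 2)"
    proof -
      have "- pi * (- a / 2 + c * x)\<^sup>2 + - pi * (- a / 2 + c * x + a)\<^sup>2 = - pi * a\<^sup>2 / 2 - 2 * pi * c\<^sup>2 * x\<^sup>2"
        by (simp add: power2_eq_square field_simps)
      also have "\<dots> = - pi * a\<^sup>2 / 2 + - x\<^sup>2 / 2" by (simp add: c(2))
      finally show ?thesis by (simp only: exp_add[symmetric])
    qed
    hence 1: "hermite_gauss 0 (- a / 2 + c * x) * hermite_gauss 0 (- a / 2 + c * x + a) =
        exp (- pi * a\<^sup>2 / 2) * sqrt (2 * pi) * std_normal_density x"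
      by (simp add: hermite_gauss_def std_normal_density_def)
    have "2 * pi * c = sqrt pi" by (simp add: c_def real_div_sqrt)
    hence "2 * pi * b * (c * x) = sqrt pi * b * x" by (metis mult.assoc mult.commute)
    moreover have "- (2 * pi * b * (- a / 2 + c * x)) = pi * a * b - 2 * pi * b * (c * x)"
      by (simp add: algebra_simps)
    ultimately have "- (2 * pi * b * (- a / 2 + c * x)) = pi * a * b + s * x"
      by (simp add: s_def)
    hence 2: "cis (- (2 * pi * b * (- a / 2 + c * x))) = cis (pi * a * b) * cis (s * x)"
      by (simp only: cis_mult)
    show "hermite_cross a b 0 0 (- a / 2 + c * x) =
      cis (pi * a * b) * of_real (exp (- pi * a\<^sup>2 / 2) * sqrt (2 * pi)) * (std_normal_density x *\<^sub>R cis (s * x))"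
      unfolding hermite_cross_def 1 2 scaleR_conv_of_real of_real_mult by (simp only: mult_ac)
  qed
  also have "(\<integral>x. cis (pi * a * b) * of_real (exp (- pi * a\<^sup>2 / 2) * sqrt (2 * pi)) * (std_normal_density x *\<^sub>R cis (s * x)) \<partial>lborel) =
      cis (pi * a * b) * of_real (exp (- pi * a\<^sup>2 / 2) * sqrt (2 * pi)) * of_real (exp (- (s\<^sup>2) / 2))"
    by (subst integral_mult_right_zero) (simp only: char)
  finally have "hermite_ambiguity a b 0 0 =
      cis (pi * a * b) * of_real (c * sqrt (2 * pi) * (exp (- pi * a\<^sup>2 / 2) * exp (- (s\<^sup>2) / 2)))"
    using c by (simp add: scaleR_conv_of_real mult_ac)
  also have "exp (- pi * a\<^sup>2 / 2) * exp (- (s\<^sup>2) / 2) = exp (- pi * (a\<^sup>2 + b\<^sup>2) / 2)"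
    by (simp add: s_def power_mult_distrib exp_add[symmetric] field_simps)
  also have "c * sqrt (2 * pi) = 1 / sqrt 2"
    by (simp add: c_def real_sqrt_mult field_simps)
  finally show ?thesis by simp
qed

lemma hermite_ambiguity_eq_sum:
  fixes a b :: real
  defines "u \<equiv> 2 * of_real pi * Complex a b" and "v \<equiv> - 2 * of_real pi * cnj (Complex a b)"
  shows "hermite_ambiguity a b n m =
    (\<Sum>k\<le>n. of_nat (n choose k) * of_nat (fact k * (m choose k)) * of_real (4 * pi) ^ k * u ^ (n - k) * v ^ (m - k))
      * hermite_ambiguity a b 0 0"
proof (induction n arbitrary: m)
  case 0
  show ?case
  proof (induction m)
    case (Suc m)
    thus ?case unfolding hermite_ambiguity_Suc_right by (simp add: v_def algebra_simps)
  qed simp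
next
  case (Suc n)
  let ?P = "of_real (4 * pi) :: complex"
  define t where "t = (\<lambda>k. of_nat (fact k * (m choose k)) * ?P ^ k * u ^ (Suc n - k) * v ^ (m - k))"
  have absorb: "of_nat m * of_nat (fact k * ((m - 1) choose k)) = (of_nat (fact (Suc k) * (m choose Suc k)) :: complex)" for k
  proof -
    have "m * (fact k * ((m - 1) choose k)) = fact (Suc k) * (m choose Suc k)"
    proof (cases m)
      case (Suc m')
      have "m * (fact k * ((m - 1) choose k)) = fact k * (Suc m' * (m' choose k))"
        unfolding Suc diff_Suc_1 by (rule mult.left_commute)
      also have "\<dots> = fact k * (Suc k * (m choose Suc k))" by (simp only: Suc_times_binomial Suc)
      also have "\<dots> = fact (Suc k) * (m choose Suc k)" by (simp only: fact_Suc of_nat_id mult_ac)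
      finally show ?thesis .
    qed simp
    thus ?thesis by (metis of_nat_mult)
  qed
  have 1: "of_real (4 * pi * real m) *
      (\<Sum>k\<le>n. of_nat (n choose k) * of_nat (fact k * ((m - 1) choose k)) * ?P ^ k * u ^ (n - k) * v ^ (m - 1 - k)) =
      (\<Sum>k\<le>n. of_nat (n choose k) * t (Suc k))"
    unfolding sum_distrib_left
  proof (intro sum.cong refl)
    fix k
    have "of_real (4 * pi * real m) * (of_nat (n choose k) * of_nat (fact k * ((m - 1) choose k)) * ?P ^ k * u ^ (n - k) * v ^ (m - 1 - k)) =
       of_nat (n choose k) * (of_nat m * of_nat (fact k * ((m - 1) choose k))) * ?P ^ Suc k * u ^ (n - k) * v ^ (m - 1 - k)"
      by simp
    also have "\<dots> = of_nat (n choose k) * t (Suc k)"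
      unfolding absorb t_def by (simp only: diff_Suc_Suc diff_diff_left plus_1_eq_Suc mult.assoc)
    finally show "of_real (4 * pi * real m) * (of_nat (n choose k) * of_nat (fact k * ((m - 1) choose k)) * ?P ^ k * u ^ (n - k) * v ^ (m - 1 - k)) =
       of_nat (n choose k) * t (Suc k)" .
  qed
  have 2: "u * (\<Sum>k\<le>n. of_nat (n choose k) * of_nat (fact k * (m choose k)) * ?P ^ k * u ^ (n - k) * v ^ (m - k)) =
      t 0 + (\<Sum>k\<le>n. of_nat (n choose Suc k) * t (Suc k))"
  proof -
    have "u * (\<Sum>k\<le>n. of_nat (n choose k) * of_nat (fact k * (m choose k)) * ?P ^ k * u ^ (n - k) * v ^ (m - k)) =
        (\<Sum>k\<le>n. of_nat (n choose k) * t k)"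
      unfolding sum_distrib_left by (intro sum.cong refl) (simp add: t_def Suc_diff_le)
    also have "\<dots> = (\<Sum>k\<le>Suc n. of_nat (n choose k) * t k)" by simp
    also have "\<dots> = t 0 + (\<Sum>k\<le>n. of_nat (n choose Suc k) * t (Suc k))"
      by (subst sum.atMost_Suc_shift) simp
    finally show ?thesis .
  qed
  have "(\<Sum>k\<le>Suc n. of_nat (Suc n choose k) * of_nat (fact k * (m choose k)) * ?P ^ k * u ^ (Suc n - k) * v ^ (m - k)) =
      (\<Sum>k\<le>Suc n. of_nat (Suc n choose k) * t k)"
    by (simp only: t_def mult.assoc)
  also have "\<dots> = t 0 + (\<Sum>k\<le>n. of_nat (Suc n choose Suc k) * t (Suc k))"
    by (subst sum.atMost_Suc_shift) simp
  also have "\<dots> = (\<Sum>k\<le>n. of_nat (n choose k) * t (Suc k)) + (t 0 + (\<Sum>k\<le>n. of_nat (n choose Suc k) * t (Suc k)))"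
    by (simp add: ring_distribs sum.distrib)
  finally show ?case
    unfolding hermite_ambiguity_Suc_left Suc u_def[symmetric] 1[symmetric] 2[symmetric]
    by (simp only: ring_distribs mult.assoc)
qed

text \<open>
  The Laguerre polynomials, normalised to the value 1 at the origin.
\<close>

definition laguerre :: "nat \<Rightarrow> real \<Rightarrow> real" where
  "laguerre n x = (\<Sum>j\<le>n. real (n choose j) * (- x) ^ j / fact j)"

lemma hermite_ambiguity_diag:
  "hermite_ambiguity a b n n =
     of_real (fact n * (4 * pi) ^ n * laguerre n (pi * (a\<^sup>2 + b\<^sup>2))) * hermite_ambiguity a b 0 0"
proof -
  define u where "u = 2 * of_real pi * Complex a b"
  define v where "v = - 2 * of_real pi * cnj (Complex a b)"
  have uv: "u * v = of_real ((4 * pi) * (- (pi * (a\<^sup>2 + b\<^sup>2))))"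
  proof -
    define z where "z = Complex a b"
    have z: "z * cnj z = of_real (a\<^sup>2 + b\<^sup>2)"
      by (simp add: z_def complex_eq_iff power2_eq_square)
    have "u * v = - 4 * of_real pi * (of_real pi * (z * cnj z))"
      by (simp add: u_def v_def z_def[symmetric])
    thus ?thesis unfolding z by simp
  qed
  have "(\<Sum>k\<le>n. of_nat (n choose k) * of_nat (fact k * (n choose k)) * of_real (4 * pi) ^ k * u ^ (n - k) * v ^ (n - k)) =
      (\<Sum>k\<le>n. of_real (real (n choose k) * (fact k * real (n choose k)) * (4 * pi) ^ k * ((4 * pi) * (- (pi * (a\<^sup>2 + b\<^sup>2)))) ^ (n - k)))"
    by (intro sum.cong refl)
       (simp only: of_real_mult of_real_power of_real_of_nat_eq of_nat_mult of_nat_fact of_real_fact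
          mult.assoc power_mult_distrib[symmetric] uv)
  also have "\<dots> = of_real (\<Sum>k\<le>n. real (n choose k) * (fact k * real (n choose k)) * (4 * pi) ^ k * ((4 * pi) * (- (pi * (a\<^sup>2 + b\<^sup>2)))) ^ (n - k))"
    by (simp only: of_real_sum)
  also have "(\<Sum>k\<le>n. real (n choose k) * (fact k * real (n choose k)) * (4 * pi) ^ k * ((4 * pi) * (- (pi * (a\<^sup>2 + b\<^sup>2)))) ^ (n - k)) =
      (\<Sum>k\<le>n. fact n * (4 * pi) ^ n * (real (n choose (n - k)) * (- (pi * (a\<^sup>2 + b\<^sup>2))) ^ (n - k) / fact (n - k)))"
  proof (intro sum.cong refl)
    fix k assume "k \<in> {..n}"
    hence k: "k \<le> n" by simp
    have "fact k * real (n choose k) = fact n / fact (n - k)"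
      using binomial_fact[OF k, where 'a = real] by simp
    moreover have "(4 * pi) ^ n = (4 * pi) ^ k * (4 * pi) ^ (n - k)"
      by (simp only: power_add[symmetric] le_add_diff_inverse k)
    moreover have "n choose k = n choose (n - k)" using k by (rule binomial_symmetric)
    ultimately show "real (n choose k) * (fact k * real (n choose k)) * (4 * pi) ^ k * ((4 * pi) * (- (pi * (a\<^sup>2 + b\<^sup>2)))) ^ (n - k) =
       fact n * (4 * pi) ^ n * (real (n choose (n - k)) * (- (pi * (a\<^sup>2 + b\<^sup>2))) ^ (n - k) / fact (n - k))"
      by (simp only: power_mult_distrib) simp
  qed
  also have "\<dots> = (\<Sum>j\<le>n. fact n * (4 * pi) ^ n * (real (n choose j) * (- (pi * (a\<^sup>2 + b\<^sup>2))) ^ j / fact j))"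
    by (rule sum.reindex_bij_witness[of _ "\<lambda>j. n - j" "\<lambda>k. n - k"]) auto
  also have "\<dots> = fact n * (4 * pi) ^ n * laguerre n (pi * (a\<^sup>2 + b\<^sup>2))"
    by (simp only: laguerre_def sum_distrib_left)
  finally show ?thesis
    unfolding hermite_ambiguity_eq_sum[of a b n n] u_def v_def by (simp only:)
qed

text \<open>
  The ambiguity function of a Hermite function is, up to phase, a Laguerre function of the squared radius.
\<close>

theorem norm_ambiguity_hermite_fun:
  "norm (ambiguity (hermite_fun n) x \<omega>) =
     \<bar>laguerre n (pi * (x\<^sup>2 + \<omega>\<^sup>2))\<bar> * exp (- pi * (x\<^sup>2 + \<omega>\<^sup>2) / 2)"
proof -
  have c2: "(hermite_const n)\<^sup>2 = sqrt 2 / (fact n * (4 * pi) ^ n)"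
  proof -
    have "(2 powr (1/4) :: real)\<^sup>2 = sqrt 2"
      by (simp add: powr_power powr_half_sqrt)
    moreover have "fact n * (2 * pi) ^ n * 2 ^ n = fact n * (4 * pi) ^ n"
    proof -
      have "(2 * pi) ^ n * 2 ^ n = (2 * pi * 2) ^ n" by (rule power_mult_distrib[symmetric])
      also have "2 * pi * 2 = 4 * pi" by simp
      finally show ?thesis by (simp only: mult.assoc)
    qed
    moreover have "(sqrt (fact n * (4 * pi) ^ n))\<^sup>2 = fact n * (4 * pi) ^ n" by simp
    ultimately show ?thesis
      by (simp only: hermite_const_def power_divide)
  qed
  have "ambiguity (hermite_fun n) x \<omega> = (\<integral>t. of_real ((hermite_const n)\<^sup>2) * hermite_cross x \<omega> n n t \<partial>lborel)"
    unfolding ambiguity_def fourier_integral_def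
  proof (rule Bochner_Integration.integral_cong[OF refl])
    fix t
    have "((-1) ^ n * (-1) ^ n :: complex) = ((-1) * (-1)) ^ n" by (rule power_mult_distrib[symmetric])
    hence "((-1) ^ n * (-1) ^ n :: complex) = 1" by simp
    thus "hermite_fun n t * cnj (hermite_fun n (t + x)) * cis (- (2 * pi * \<omega> * t)) =
        of_real ((hermite_const n)\<^sup>2) * hermite_cross x \<omega> n n t"
      by (simp add: hermite_fun_eq hermite_cross_def power2_eq_square mult_ac)
  qed
  also have "\<dots> = of_real ((hermite_const n)\<^sup>2) * hermite_ambiguity x \<omega> n n"
    by (simp add: hermite_ambiguity_def del: of_real_power)
  finally have "norm (ambiguity (hermite_fun n) x \<omega>) = (hermite_const n)\<^sup>2 * norm (hermite_ambiguity x \<omega> n n)"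
    by (simp add: norm_mult norm_power)
  also have "norm (hermite_ambiguity x \<omega> n n) =
      fact n * (4 * pi) ^ n * \<bar>laguerre n (pi * (x\<^sup>2 + \<omega>\<^sup>2))\<bar> * (exp (- pi * (x\<^sup>2 + \<omega>\<^sup>2) / 2) / sqrt 2)"
    unfolding hermite_ambiguity_diag[of x \<omega> n] hermite_ambiguity_0_0 norm_mult norm_cis norm_of_real
    by (simp add: abs_mult)
  also have "(hermite_const n)\<^sup>2 * \<dots> = \<bar>laguerre n (pi * (x\<^sup>2 + \<omega>\<^sup>2))\<bar> * exp (- pi * (x\<^sup>2 + \<omega>\<^sup>2) / 2)"
  proof -
    have "s / F * (F * L * (E / s)) = L * E" if "F \<noteq> 0" "s \<noteq> 0" for F L E s :: real
      using that by (simp add: field_simps)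
    from this[of "fact n * (4 * pi) ^ n" "sqrt 2"] show ?thesis unfolding c2 by simp
  qed
  finally show ?thesis .
qed

lemma admissible_hermite_fun: "admissible_window (hermite_fun n)"
proof -
  obtain C where C: "\<And>t. \<bar>hermite_gauss n t\<bar> \<le> C / (1 + t\<^sup>2)" using hermite_gauss_decay by blast
  have "continuous_on UNIV (\<lambda>t. complex_of_real (hermite_const n * (-1) ^ n * hermite_gauss n t))"
    by (intro continuous_intros hermite_gauss_continuous)
  hence "continuous_on UNIV (hermite_fun n)" by (simp add: hermite_fun_eq[abs_def])
  moreover have "norm (hermite_fun n t) \<le> (\<bar>hermite_const n\<bar> * C) / (1 + t\<^sup>2)" for t
  proof -
    have "norm (hermite_fun n t) = \<bar>hermite_const n\<bar> * \<bar>hermite_gauss n t\<bar>"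
      unfolding hermite_fun_eq norm_of_real by (simp add: abs_mult power_abs)
    also have "\<dots> \<le> \<bar>hermite_const n\<bar> * (C / (1 + t\<^sup>2))" by (intro mult_left_mono C) auto
    finally show ?thesis by simp
  qed
  ultimately show ?thesis unfolding admissible_window_def by blast
qed

section \<open>Laguerre polynomials and the weights of the adjoint lattice\<close>

lemma power_over_fact_le_exp: "0 \<le> y \<Longrightarrow> y ^ j / fact j \<le> exp (y::real)"
proof -
  assume y: "0 \<le> y"
  have "(\<Sum>i\<in>{j}. inverse (fact i) *\<^sub>R y ^ i) \<le> (\<Sum>i. inverse (fact i) *\<^sub>R y ^ i)"
    by (rule sum_le_suminf[OF summable_exp_generic]) (use y in auto)
  thus ?thesis by (simp add: exp_def divide_inverse mult.commute)
qed

text \<open>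
  A crude bound, used for large arguments only: of the available decay \<open>exp (- x / 2)\<close> it costs one half,
  and a factor that does not matter there.
\<close>

lemma laguerre_bound:
  assumes "x \<ge> 0"
  shows "\<bar>laguerre n x\<bar> \<le> 5 ^ n * exp (x / 4)"
proof -
  have "\<bar>laguerre n x\<bar> \<le> (\<Sum>j\<le>n. real (n choose j) * 4 ^ j * exp (x / 4))"
    unfolding laguerre_def
  proof (rule order_trans[OF sum_abs], rule sum_mono)
    fix j
    have "\<bar>real (n choose j) * (- x) ^ j / fact j\<bar> = real (n choose j) * 4 ^ j * ((x / 4) ^ j / fact j)"
      using assms by (simp add: abs_mult power_abs power_divide)
    also have "\<dots> \<le> real (n choose j) * 4 ^ j * exp (x / 4)"
      using assms by (intro mult_left_mono power_over_fact_le_exp) auto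
    finally show "\<bar>real (n choose j) * (- x) ^ j / fact j\<bar> \<le> real (n choose j) * 4 ^ j * exp (x / 4)" .
  qed
  also have "\<dots> = (\<Sum>j\<le>n. real (n choose j) * 4 ^ j * 1 ^ (n - j)) * exp (x / 4)"
    by (simp add: sum_distrib_right)
  also have "(\<Sum>j\<le>n. real (n choose j) * 4 ^ j * 1 ^ (n - j)) = (4 + 1) ^ n"
    by (rule binomial_ring[symmetric])
  finally show ?thesis by simp
qed

lemma exp_3_pi_half: "exp (3 * pi / 2) \<ge> 110"
proof -
  \<comment> \<open>\<open>4.712 < 3 \<pi> / 2\<close>; the exponential is raised to the power 64 from its quadratic Taylor polynomial.
  The number \<open>z\<close> is this polynomial at \<open>y\<close>, rounded down, and is squared six times.\<close>
  define y :: real where "y = 4.712 / 64"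
  define z :: real where "z = 10763 / 10000"
  have square: "a \<le> z ^ (2 * n)" if "b \<le> z ^ n" "0 \<le> b" "a \<le> b\<^sup>2" for a b n
    using power_mono[OF that(1,2), of 2] that(3) by (simp add: power_mult[symmetric] mult.commute)
  have "11584 / 10000 \<le> z ^ 2" by (simp add: z_def power2_eq_square)
  hence "13418 / 10000 \<le> z ^ (2 * 2)" by (rule square) (simp_all add: power2_eq_square)
  hence "18004 / 10000 \<le> z ^ (2 * (2 * 2))" by (rule square) (simp_all add: power2_eq_square)
  hence "32414 / 10000 \<le> z ^ (2 * (2 * (2 * 2)))" by (rule square) (simp_all add: power2_eq_square)
  hence "105 / 10 \<le> z ^ (2 * (2 * (2 * (2 * 2))))" by (rule square) (simp_all add: power2_eq_square)
  hence "110 \<le> z ^ (2 * (2 * (2 * (2 * (2 * 2)))))" by (rule square) (simp_all add: power2_eq_square)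
  hence "110 \<le> z ^ 64" by simp
  also have "\<dots> \<le> (1 + y + y\<^sup>2 / 2) ^ 64"
    by (intro power_mono) (simp_all add: y_def z_def power2_eq_square)
  also have "\<dots> \<le> exp y ^ 64"
    by (intro power_mono exp_lower_Taylor_quadratic) (simp_all add: y_def power2_eq_square)
  also have "\<dots> = exp 4.712"
    by (subst exp_of_nat_mult[symmetric]) (simp add: y_def)
  also have "\<dots> \<le> exp (3 * pi / 2)" using pi_approx(1) by simp
  finally show ?thesis .
qed

lemma exp_3_pi_quarter: "exp (3 * pi / 4) \<ge> 10"
proof (rule power2_le_imp_le)
  have "(exp (3 * pi / 4))\<^sup>2 = exp (3 * pi / 2)" by (simp add: exp_double[symmetric])
  thus "10\<^sup>2 \<le> (exp (3 * pi / 4))\<^sup>2" using exp_3_pi_half by simp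
qed simp

text \<open>
  The absolute value of the ambiguity function of \<open>h\<^sub>9\<close> at a point \<open>\<surd>3 (m, n)\<close> with
  \<open>m\<^sup>2 + n\<^sup>2 = r\<close>.
\<close>

definition lattice_weight :: "nat \<Rightarrow> real" where
  "lattice_weight r = \<bar>laguerre 9 (3 * pi * real r)\<bar> * exp (- (3 * pi / 2) * real r)"

lemma lattice_weight_0: "lattice_weight 0 = 1"
proof -
  have "laguerre 9 0 = (\<Sum>j\<le>(9::nat). if j = 0 then 1 else 0)"
    unfolding laguerre_def by (intro sum.cong) auto
  thus ?thesis by (simp add: lattice_weight_def)
qed

lemma lattice_weight_le_tail: "lattice_weight r \<le> 5 ^ 9 / 10 ^ r"
proof -
  have "lattice_weight r \<le> 5 ^ 9 * exp (3 * pi * real r / 4) * exp (- (3 * pi / 2) * real r)"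
    unfolding lattice_weight_def by (intro mult_right_mono laguerre_bound) auto
  also have "\<dots> = 5 ^ 9 * exp (real r * (- (3 * pi / 4)))"
    by (simp add: mult.assoc exp_add[symmetric] algebra_simps)
  also have "\<dots> = 5 ^ 9 * (inverse (exp (3 * pi / 4))) ^ r"
    by (simp only: exp_of_nat_mult exp_minus)
  also have "\<dots> \<le> 5 ^ 9 * (inverse 10) ^ r"
    by (intro mult_left_mono power_mono le_imp_inverse_le exp_3_pi_quarter) auto
  finally show ?thesis by (simp only: divide_inverse power_inverse)
qed

lemma lattice_weight_le:
  assumes "\<bar>laguerre 9 (3 * pi * real r)\<bar> \<le> c * 110 ^ r" "c \<ge> 0"
  shows "lattice_weight r \<le> c"
proof -
  have "exp (- (3 * pi / 2) * real r) = exp (real r * (- (3 * pi / 2)))" by (simp only: mult.commute)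
  also have "\<dots> = (inverse (exp (3 * pi / 2))) ^ r"
    by (simp only: exp_of_nat_mult exp_minus)
  also have "\<dots> \<le> (inverse 110) ^ r"
    by (intro power_mono le_imp_inverse_le exp_3_pi_half) auto
  finally have "lattice_weight r \<le> c * 110 ^ r * (inverse 110) ^ r"
    unfolding lattice_weight_def using assms by (intro mult_mono) auto
  also have "\<dots> = c" by (simp add: mult.assoc power_mult_distrib[symmetric])
  finally show ?thesis .
qed

lemma laguerre_9:
  "laguerre 9 x = 1 - 9 * x + 18 * x^2 - 14 * x^3 + 21/4 * x^4 - 21/20 * x^5 + 7/60 * x^6
     - 1/140 * x^7 + 1/4480 * x^8 - 1/362880 * x^9"
proof -
  have c: "9 choose 1 = (9::nat)" "9 choose 2 = (36::nat)" "9 choose 3 = (84::nat)" "9 choose 4 = (126::nat)"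
    "9 choose 5 = (126::nat)" "9 choose 6 = (84::nat)" "9 choose 7 = (36::nat)" "9 choose 8 = (9::nat)"
    by (simp_all add: eval_nat_numeral)
  have "{..9::nat} = {0,1,2,3,4,5,6,7,8,9}" by auto
  thus ?thesis by (simp add: laguerre_def c fact_numeral)
qed

text \<open>
  Eight decimals of \<open>\<pi>\<close> are enough: in the Laguerre polynomials below, the cancellation between the
  monomials costs about six of them, and the estimates leave a margin of several per cent.
\<close>

lemma pi_power_bounds:
  "314159265 / 100000000 \<le> pi" "pi \<le> 314159266 / 100000000"
  "98696043785 / 10000000000 \<le> pi ^ 2" "pi ^ 2 \<le> 98696044414 / 10000000000"
  "31006276574 / 1000000000 \<le> pi ^ 3" "pi ^ 3 \<le> 31006276871 / 1000000000"
  "97409090588 / 1000000000 \<le> pi ^ 4" "pi ^ 4 \<le> 97409091830 / 1000000000"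
  "30601968303 / 100000000 \<le> pi ^ 5" "pi ^ 5 \<le> 30601968791 / 100000000"
  "96138918698 / 100000000 \<le> pi ^ 6" "pi ^ 6 \<le> 96138920535 / 100000000"
  "30202932036 / 10000000 \<le> pi ^ 7" "pi ^ 7 \<le> 30202932710 / 10000000"
  "94885309293 / 10000000 \<le> pi ^ 8" "pi ^ 8 \<le> 94885311710 / 10000000"
  "29809099026 / 1000000 \<le> pi ^ 9" "pi ^ 9 \<le> 29809099881 / 1000000"
proof -
  show "314159265 / 100000000 \<le> pi" "pi \<le> 314159266 / 100000000" using pi_approx by auto
  hence lo: "(314159265 / 100000000) ^ n \<le> pi ^ n" and hi: "pi ^ n \<le> (314159266 / 100000000) ^ n" for n
    by (auto intro!: power_mono)
  show "98696043785 / 10000000000 \<le> pi ^ 2" "pi ^ 2 \<le> 98696044414 / 10000000000"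
    by (rule order_trans[OF _ lo] order_trans[OF hi], simp add: power_divide)+
  show "31006276574 / 1000000000 \<le> pi ^ 3" "pi ^ 3 \<le> 31006276871 / 1000000000"
    by (rule order_trans[OF _ lo] order_trans[OF hi], simp add: power_divide)+
  show "97409090588 / 1000000000 \<le> pi ^ 4" "pi ^ 4 \<le> 97409091830 / 1000000000"
    by (rule order_trans[OF _ lo] order_trans[OF hi], simp add: power_divide)+
  show "30601968303 / 100000000 \<le> pi ^ 5" "pi ^ 5 \<le> 30601968791 / 100000000"
    by (rule order_trans[OF _ lo] order_trans[OF hi], simp add: power_divide)+
  show "96138918698 / 100000000 \<le> pi ^ 6" "pi ^ 6 \<le> 96138920535 / 100000000"
    by (rule order_trans[OF _ lo] order_trans[OF hi], simp add: power_divide)+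
  show "30202932036 / 10000000 \<le> pi ^ 7" "pi ^ 7 \<le> 30202932710 / 10000000"
    by (rule order_trans[OF _ lo] order_trans[OF hi], simp add: power_divide)+
  show "94885309293 / 10000000 \<le> pi ^ 8" "pi ^ 8 \<le> 94885311710 / 10000000"
    by (rule order_trans[OF _ lo] order_trans[OF hi], simp add: power_divide)+
  show "29809099026 / 1000000 \<le> pi ^ 9" "pi ^ 9 \<le> 29809099881 / 1000000"
    by (rule order_trans[OF _ lo] order_trans[OF hi], simp add: power_divide)+
qed

text \<open>
  The reason why the index 9 works: its Laguerre polynomial has zeros near \<open>3 \<pi>\<close> and \<open>6 \<pi>\<close>, so that
  the weights at the squared radii 1 and 2 are far smaller than those at 4 and 5.
\<close>

lemma lattice_weight_1: "lattice_weight 1 \<le> 1 / 100"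
proof (rule lattice_weight_le)
  have "laguerre 9 (3 * pi * real 1) = 1 - 27 * pi + 162 * pi ^ 2 - 378 * pi ^ 3 + 1701 / 4 * pi ^ 4 - 5103 / 20 * pi ^ 5 + 1701 / 20 * pi ^ 6 - 2187 / 140 * pi ^ 7 + 6561 / 4480 * pi ^ 8 - 243 / 4480 * pi ^ 9"
    unfolding laguerre_9 by (simp add: power_mult_distrib)
  hence "laguerre 9 (3 * pi * real 1) \<le> 11 / 10" "- 11 / 10 \<le> laguerre 9 (3 * pi * real 1)"
    using pi_power_bounds by linarith+
  hence "\<bar>laguerre 9 (3 * pi * real 1)\<bar> \<le> 11 / 10" by linarith
  thus "\<bar>laguerre 9 (3 * pi * real 1)\<bar> \<le> 1 / 100 * 110 ^ 1" by simp
qed simp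

lemma lattice_weight_2: "lattice_weight 2 \<le> 1 / 500"
proof (rule lattice_weight_le)
  have "laguerre 9 (3 * pi * real 2) = 1 - 54 * pi + 648 * pi ^ 2 - 3024 * pi ^ 3 + 6804 * pi ^ 4 - 40824 / 5 * pi ^ 5 + 27216 / 5 * pi ^ 6 - 69984 / 35 * pi ^ 7 + 13122 / 35 * pi ^ 8 - 972 / 35 * pi ^ 9"
    unfolding laguerre_9 by (simp add: power_mult_distrib)
  hence "laguerre 9 (3 * pi * real 2) \<le> 121 / 5" "- 121 / 5 \<le> laguerre 9 (3 * pi * real 2)"
    using pi_power_bounds by linarith+
  hence "\<bar>laguerre 9 (3 * pi * real 2)\<bar> \<le> 121 / 5" by linarith
  thus "\<bar>laguerre 9 (3 * pi * real 2)\<bar> \<le> 1 / 500 * 110 ^ 2" by simp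
qed simp

lemma lattice_weight_4: "lattice_weight 4 \<le> 31 / 200"
proof (rule lattice_weight_le)
  have "laguerre 9 (3 * pi * real 4) = 1 - 108 * pi + 2592 * pi ^ 2 - 24192 * pi ^ 3 + 108864 * pi ^ 4 - 1306368 / 5 * pi ^ 5 + 1741824 / 5 * pi ^ 6 - 8957952 / 35 * pi ^ 7 + 3359232 / 35 * pi ^ 8 - 497664 / 35 * pi ^ 9"
    unfolding laguerre_9 by (simp add: power_mult_distrib)
  hence "laguerre 9 (3 * pi * real 4) \<le> 22693550" "- 22693550 \<le> laguerre 9 (3 * pi * real 4)"
    using pi_power_bounds by linarith+
  hence "\<bar>laguerre 9 (3 * pi * real 4)\<bar> \<le> 22693550" by linarith
  thus "\<bar>laguerre 9 (3 * pi * real 4)\<bar> \<le> 31 / 200 * 110 ^ 4" by simp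
qed simp

lemma lattice_weight_5: "lattice_weight 5 \<le> 3 / 125"
proof (rule lattice_weight_le)
  have "laguerre 9 (3 * pi * real 5) = 1 - 135 * pi + 4050 * pi ^ 2 - 47250 * pi ^ 3 + 1063125 / 4 * pi ^ 4 - 3189375 / 4 * pi ^ 5 + 5315625 / 4 * pi ^ 6 - 34171875 / 28 * pi ^ 7 + 512578125 / 896 * pi ^ 8 - 94921875 / 896 * pi ^ 9"
    unfolding laguerre_9 by (simp add: power_mult_distrib)
  hence "laguerre 9 (3 * pi * real 5) \<le> 386522400" "- 386522400 \<le> laguerre 9 (3 * pi * real 5)"
    using pi_power_bounds by linarith+
  hence "\<bar>laguerre 9 (3 * pi * real 5)\<bar> \<le> 386522400" by linarith
  thus "\<bar>laguerre 9 (3 * pi * real 5)\<bar> \<le> 3 / 125 * 110 ^ 5" by simp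
qed simp


lemma has_sum_int_geometric: "((\<lambda>m::int. (1 / 10) ^ nat \<bar>m\<bar> :: real) has_sum (11 / 9)) UNIV"
proof -
  let ?f = "\<lambda>m::int. (1 / 10) ^ nat \<bar>m\<bar> :: real"
  have g: "((\<lambda>n. c * (1 / 10) ^ n) has_sum (c * (10 / 9))) (UNIV :: nat set)" if "c \<ge> 0" for c :: real
  proof (rule norm_summable_imp_has_sum)
    show "(\<lambda>n. c * (1 / 10) ^ n) sums (c * (10 / 9))"
      using sums_mult[OF geometric_sums[of "1 / 10 :: real"], of c] by simp
    show "summable (\<lambda>n. norm (c * (1 / 10) ^ n :: real))"
      using that by (auto simp: abs_mult power_abs intro!: summable_mult summable_geometric)
  qed
  have 1: "(?f has_sum (10 / 9)) (range int)"
    using g[of 1] by (subst has_sum_reindex) (auto simp: o_def)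
  have 2: "(?f has_sum (1 / 9)) (range (\<lambda>n. - int (Suc n)))"
    using g[of "1 / 10"] by (subst has_sum_reindex) (auto simp: o_def inj_on_def nat_add_distrib)
  have "range int \<inter> range (\<lambda>n. - int (Suc n)) = {}" by auto
  from has_sum_Un_disjoint[OF 1 2 this]
  have "(?f has_sum (11 / 9)) (range int \<union> range (\<lambda>n. - int (Suc n)))" by simp
  also have "range int \<union> range (\<lambda>n. - int (Suc n)) = UNIV"
  proof (intro equalityI subsetI)
    fix m :: int
    show "m \<in> range int \<union> range (\<lambda>n. - int (Suc n))"
      by (cases m) auto
  qed simp
  finally show ?thesis .
qed

lemma has_sum_int_pairs_geometric:
  "((\<lambda>(m, n). (1 / 10) ^ (nat \<bar>m\<bar> + nat \<bar>n\<bar>) :: real) has_sum (121 / 81)) (UNIV :: (int \<times> int) set)"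
proof -
  let ?f = "\<lambda>(m::int, n::int). (1 / 10) ^ (nat \<bar>m\<bar> + nat \<bar>n\<bar>) :: real"
  have rows: "((\<lambda>n. ?f (m, n)) has_sum ((1 / 10) ^ nat \<bar>m\<bar> * (11 / 9))) UNIV" for m
    unfolding prod.case power_add by (intro has_sum_cmult_right has_sum_int_geometric)
  have total: "((\<lambda>m::int. (1 / 10) ^ nat \<bar>m\<bar> * (11 / 9) :: real) has_sum (11 / 9 * (11 / 9))) UNIV"
    by (intro has_sum_cmult_left has_sum_int_geometric)
  have "?f summable_on Sigma UNIV (\<lambda>_. UNIV)"
    by (rule summable_on_SigmaI[OF rows has_sum_imp_summable[OF total]]) auto
  from has_sum_SigmaI[OF rows total this] show ?thesis by simp
qed

text \<open>
  The squared radii 0, 1, 2, 4 and 5 have individual bounds, all the others the tail bound.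
\<close>

definition weight_majorant :: "nat \<Rightarrow> real" where
  "weight_majorant r = (if r = 0 then 1 else if r = 1 then 1 / 100 else if r = 2 then 1 / 500
     else if r = 4 then 31 / 200 else if r = 5 then 3 / 125 else 5 ^ 9 / 10 ^ r)"

lemma lattice_weight_le_majorant: "lattice_weight r \<le> weight_majorant r"
  using lattice_weight_0 lattice_weight_1 lattice_weight_2 lattice_weight_4 lattice_weight_5
    lattice_weight_le_tail[of r]
  by (auto simp: weight_majorant_def)

text \<open>
  Outside the box of points with coordinates at most 3 in absolute value, the squared radius exceeds the 1-norm by
  at least 12. There the weights are dominated by a geometric series over all pairs with a negligible factor.
\<close>

lemma square_ge_abs_plus_12:
  fixes m :: int
  assumes "\<bar>m\<bar> > 3" shows "\<bar>m\<bar> + 12 \<le> m\<^sup>2"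
proof -
  have "0 \<le> (\<bar>m\<bar> - 4) * (\<bar>m\<bar> + 3)" using assms by (intro mult_nonneg_nonneg) auto
  also have "\<dots> = m\<^sup>2 - \<bar>m\<bar> - 12" by (simp add: algebra_simps power2_eq_square)
  finally show ?thesis by simp
qed

lemma abs_le_square_int: "\<bar>m\<bar> \<le> (m::int)\<^sup>2"
proof (cases "m = 0")
  case False
  hence "\<bar>m\<bar> * 1 \<le> \<bar>m\<bar> * \<bar>m\<bar>" by (intro mult_left_mono) auto
  thus ?thesis by (simp add: power2_eq_square)
qed simp

lemma lattice_weight_sum:
  obtains S where "((\<lambda>(m::int, n::int). lattice_weight (nat (m\<^sup>2 + n\<^sup>2))) has_sum S) UNIV" and "S < 2"
proof -
  define Box :: "(int \<times> int) set" where "Box = {-3..3} \<times> {-3..3}"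
  define f where "f = (\<lambda>(m::int, n::int). lattice_weight (nat (m\<^sup>2 + n\<^sup>2)))"
  define h where "h = (\<lambda>(m::int, n::int). weight_majorant (nat (m\<^sup>2 + n\<^sup>2)))"
  define M where "M = (\<lambda>p. (if p \<in> Box then h p else 0) +
      5 ^ 9 / 10 ^ 12 * (case p of (m, n) \<Rightarrow> (1 / 10) ^ (nat \<bar>m\<bar> + nat \<bar>n\<bar>)))"
  have "finite Box" by (simp add: Box_def)
  hence "((\<lambda>p. if p \<in> Box then h p else 0) has_sum (\<Sum>p\<in>Box. h p)) UNIV"
    by (intro has_sum_finite_neutralI[of Box]) auto
  hence M: "(M has_sum ((\<Sum>p\<in>Box. h p) + 5 ^ 9 / 10 ^ 12 * (121 / 81))) UNIV"
    unfolding M_def by (intro has_sum_add has_sum_cmult_right has_sum_int_pairs_geometric)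
  have f_le: "f p \<le> M p" for p
  proof (cases p)
    case (Pair m n)
    show ?thesis
    proof (cases "p \<in> Box")
      case True
      have "f p \<le> h p" by (simp add: f_def h_def Pair lattice_weight_le_majorant)
      also have "\<dots> \<le> M p" using True by (simp add: M_def Pair)
      finally show ?thesis .
    next
      case False
      hence "\<bar>m\<bar> > 3 \<or> \<bar>n\<bar> > 3" by (auto simp: Box_def Pair)
      hence "\<bar>m\<bar> + \<bar>n\<bar> + 12 \<le> m\<^sup>2 + n\<^sup>2"
        using square_ge_abs_plus_12[of m] square_ge_abs_plus_12[of n] abs_le_square_int[of m] abs_le_square_int[of n]
        by linarith
      hence r: "12 + (nat \<bar>m\<bar> + nat \<bar>n\<bar>) \<le> nat (m\<^sup>2 + n\<^sup>2)" by linarith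
      have "f p \<le> 5 ^ 9 / 10 ^ nat (m\<^sup>2 + n\<^sup>2)"
        by (simp add: f_def Pair lattice_weight_le_tail del: power_numeral)
      also have "\<dots> \<le> 5 ^ 9 / 10 ^ (12 + (nat \<bar>m\<bar> + nat \<bar>n\<bar>))"
        by (intro divide_left_mono power_increasing r) auto
      also have "\<dots> = M p"
        using False by (simp add: M_def Pair power_add power_divide)
      finally show ?thesis .
    qed
  qed
  have f_nonneg: "f p \<ge> 0" for p by (cases p) (simp add: f_def lattice_weight_def)
  have f: "f summable_on UNIV"
    by (rule summable_on_comparison_test[OF has_sum_imp_summable[OF M]]) (auto intro: f_le f_nonneg)
  have "infsum f UNIV \<le> (\<Sum>p\<in>Box. h p) + 5 ^ 9 / 10 ^ 12 * (121 / 81)"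
    by (rule has_sum_mono[OF has_sum_infsum[OF f] M]) (rule f_le)
  also have "\<dots> < 2"
  proof -
    \<comment> \<open>The main contributions are 1 from the origin, 4 times \<open>31 / 200\<close> from the squared radius 4 and
    8 times \<open>3 / 125\<close> from the squared radius 5.\<close>
    have "{-3..3::int} = {-3, -2, -1, 0, 1, 2, 3}" by auto
    hence "(\<Sum>p\<in>Box. h p) = (\<Sum>m\<in>{-3, -2, -1, 0, 1, 2, 3}. \<Sum>n\<in>{-3, -2, -1, 0, 1, 2, 3}. h (m, n))"
      by (simp only: Box_def sum.cartesian_product split_def prod.collapse)
    also have "\<dots> < 199 / 100"
      by (simp add: h_def weight_majorant_def)
    finally show ?thesis by simp
  qed
  finally have "infsum f UNIV < 2" .
  with has_sum_infsum[OF f] show ?thesis using that unfolding f_def by blast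
qed

theorem proposition3p8:
  shows "gabor_frame (hermite_fun 9) ((*\<^sub>R) (1 / sqrt 3) ` (\<int> \<times> \<int>))"
proof -
  define \<alpha> :: real where "\<alpha> = 1 / sqrt 3"
  have \<alpha>: "\<alpha> > 0" by (simp add: \<alpha>_def)
  have weight: "norm (ambiguity (hermite_fun 9) (of_int m * (1 / \<alpha>)) (of_int n / \<alpha>)) = lattice_weight (nat (m\<^sup>2 + n\<^sup>2))" for m n :: int
  proof -
    have "(of_int m * (1 / \<alpha>))\<^sup>2 + (of_int n / \<alpha>)\<^sup>2 = 3 * real (nat (m\<^sup>2 + n\<^sup>2))"
      by (simp add: \<alpha>_def power_mult_distrib)
    thus ?thesis unfolding norm_ambiguity_hermite_fun lattice_weight_def by (simp add: mult_ac)
  qed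
  obtain S where S: "((\<lambda>(m::int, n::int). lattice_weight (nat (m\<^sup>2 + n\<^sup>2))) has_sum S) UNIV" "S < 2"
    by (rule lattice_weight_sum)
  have "janssen_sum (hermite_fun 9) \<alpha> (1 / \<alpha>) S"
    unfolding janssen_sum_def weight by (rule S(1))
  moreover have "norm (ambiguity (hermite_fun 9) 0 0) = 1"
    using weight[of 0 0] lattice_weight_0 by simp
  ultimately have "gabor_frame (hermite_fun 9) (range (\<lambda>(k::int, l::int). (of_int k * \<alpha>, of_int l * \<alpha>)))"
    using S(2) by (intro janssen_criterion[OF \<alpha> \<alpha> admissible_hermite_fun]) auto
  also have "range (\<lambda>(k::int, l::int). (of_int k * \<alpha>, of_int l * \<alpha>)) = (*\<^sub>R) (1 / sqrt 3) ` (\<int> \<times> \<int>)"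
    by (force simp: \<alpha>_def Ints_def image_iff)
  finally show ?thesis .
qed

end
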